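(* Let $I$ be an ideal in $R=k[[x_1,\dots,x_h]]$ such that $R/I$ is almost stretched and Gorenstein of type $(s,t)$ with $s\ge 2t$. (1) If $(s,t)$ is regular, then $I$ is isomorphic to one and only one of the following ideals: $$I_{0,1},\ I_{1,1},\ \dots,\ I_{t-1,1}.$$ (2) If $(s,t)$ is not regular and $r$ is the integer such that $0\le r\le t-2$ and $2(r+1)=s-t+1$, then $I$ is isomorphic to one and only one of the following ideals: $$I_{0,1},\dots, I_{r-1,1},\ \{I_{r,c}\}_{c\in k^*},\ \{I_{r,c+x_1}\}_{c\in k^*},\ \dots,\ \{I_{r,c+x_1^{t-r-2}}\}_{c\in k^*},\ I_{r+1,1},\dots , I_{t-1,1},$$ with the meaning that, if $r=t-2$, the list is $I_{0,1},\dots, I_{r-1,1},\{I_{r,c}\}_{c\in k^*},I_{r+1,1},\dots , I_{t-1,1}$.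
   Context: $k$ is an algebraically closed field of characteristic zero, $k^*=k\setminus\{0\}$, $h\ge 2$, $R=k[[x_1,\dots,x_h]]$ is the formal power series ring with maximal ideal $\mathfrak{n}=(x_1,\dots,x_h)$, and $s,t$ are fixed integers with $s\ge t+1\ge 3$. An Artinian local ring $(A,\mathfrak{m})$ is almost stretched if the minimal number of generators of $\mathfrak{m}^2$ is two. An almost stretched Gorenstein algebra $A=R/I$ is of type $(s,t)$ if its Hilbert function $H_A(j)=\dim_k \mathfrak{m}^j/\mathfrak{m}^{j+1}$ is $H_A(0)=1$, $H_A(1)=h$ (the number of variables of $R$), $H_A(j)=2$ for $2\le j\le t$, $H_A(j)=1$ for $t+1\le j\le s$, and $H_A(j)=0$ for $j>s$. For an integer $p\ge 0$ and a power series $z\in R$, $I_{p,z}$ is the ideal of $R$ generated by: $x_ix_j$ for $1\le i<j\le h$, $(i,j)\ne(1,2)$; $x_j^2-x_1^s$ for $3\le j\le h$; $x_2^2-x_1^{p+1}x_2-z\,x_1^{s-t+1}$; and $x_1^tx_2$. Two ideals $I,J$ of $R$ are called isomorphic, $I\sim J$, if $R/I$ and $R/J$ are isomorphic as $k$-algebras. The couple $(s,t)$ is regular if there is no integer $r$ with $0\le r\le t-2$ and $2(r+1)=s-t+1$. *)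

theory Defs
  imports
    "HOL-Library.Poly_Mapping"
    "HOL-Computational_Algebra.Polynomial"
    "HOL-Algebra.Embedded_Algebras"
    "HOL-Algebra.Ideal_Product"
    "HOL-Algebra.QuotRing"
begin

section \<open>Formal power series in the variables with indices 1 to h\<close>

text \<open>Exponent vectors are finitely supported maps from variable indices to exponents;
  a power series is its family of coefficients, and the carrier of \<open>mps_ring h\<close> admits
  only monomials in the variables with indices \<open>1..h\<close>.\<close>

type_synonym 'k mps = "(nat \<Rightarrow>\<^sub>0 nat) \<Rightarrow> 'k"

definition mps_ring :: "nat \<Rightarrow> 'k::comm_ring_1 mps ring" where
  "mps_ring h =
    \<lparr>carrier = {f. \<forall>m. f m \<noteq> 0 \<longrightarrow> Poly_Mapping.keys m \<subseteq> {1..h}},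
     mult = (\<lambda>f g m. \<Sum>(a, b) | a + b = m. f a * g b),
     one = (\<lambda>m. if m = 0 then 1 else 0),
     zero = (\<lambda>m. 0),
     add = (\<lambda>f g m. f m + g m)\<rparr>"

definition mps_const :: "'k::zero \<Rightarrow> 'k mps" where
  "mps_const c = (\<lambda>m. if m = 0 then c else 0)"

definition mps_var :: "nat \<Rightarrow> 'k::zero_neq_one mps" where
  "mps_var i = (\<lambda>m. if m = Poly_Mapping.single i 1 then 1 else 0)"


section \<open>Artinian local rings\<close>

locale artinian_ring = cring A for A (structure) +
  assumes descending_chain:
    "\<lbrakk> \<And>n::nat. ideal (J n) A; \<And>n. J (Suc n) \<subseteq> J n \<rbrakk> \<Longrightarrow> \<exists>N. \<forall>n\<ge>N. J n = J N"

locale artinian_local_ring = artinian_ring A for A (structure) +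
  assumes unique_maximal: "\<exists>!M. maximalideal M A"

definition max_ideal :: "('a, 'b) ring_scheme \<Rightarrow> 'a set" where
  "max_ideal A = (THE M. maximalideal M A)"

text \<open>Powers are taken in the monoid of ideals, whose unit is the whole ring, so that
  the zeroth power of an ideal is the ring itself.\<close>

definition ideal_power :: "('a, 'b) ring_scheme \<Rightarrow> 'a set \<Rightarrow> nat \<Rightarrow> 'a set" where
  "ideal_power A J j = J [^]\<^bsub>ideals_set A\<^esub> j"

definition min_num_gens :: "('a, 'b) ring_scheme \<Rightarrow> 'a set \<Rightarrow> nat \<Rightarrow> bool" where
  "min_num_gens A J n \<longleftrightarrow>
     (\<exists>S. finite S \<and> S \<subseteq> carrier A \<and> genideal A S = J \<and> card S = n) \<and>
     (\<forall>S. finite S \<and> S \<subseteq> carrier A \<and> genideal A S = J \<longrightarrow> n \<le> card S)"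

definition almost_stretched :: "('a, 'b) ring_scheme \<Rightarrow> bool" where
  "almost_stretched A \<longleftrightarrow>
     artinian_local_ring A \<and> min_num_gens A (ideal_power A (max_ideal A) 2) 2"


section \<open>Hilbert function, Gorenstein property and type\<close>

text \<open>A \<open>k\<close>-algebra \<open>A\<close> is given by its structure map \<open>\<iota>\<close> from \<open>k\<close> to \<open>A\<close>.
  \<open>hilbert_function A \<iota> j d\<close> says that the \<open>k\<close>-dimension of \<open>\<mm>\<^sup>j / \<mm>\<^sup>j\<^sup>+\<^sup>1\<close> is \<open>d\<close>.
  The quotient is the image of \<open>\<mm>\<^sup>j\<close> in the ring \<open>A / \<mm>\<^sup>j\<^sup>+\<^sup>1\<close>, regarded as a vector space
  over the image of \<open>k\<close> in that ring.\<close>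

definition hilbert_function ::
  "('a, 'b) ring_scheme \<Rightarrow> ('k \<Rightarrow> 'a) \<Rightarrow> nat \<Rightarrow> nat \<Rightarrow> bool" where
  "hilbert_function A \<iota> j d \<longleftrightarrow>
     (let P = ideal_power A (max_ideal A) (Suc j)
      in ring.dimension (A Quot P) d
           (range (\<lambda>c. P +>\<^bsub>A\<^esub> \<iota> c))
           ((\<lambda>a. P +>\<^bsub>A\<^esub> a) ` ideal_power A (max_ideal A) j))"

definition socle :: "('a, 'b) ring_scheme \<Rightarrow> 'a set" where
  "socle A = {a \<in> carrier A. \<forall>y \<in> max_ideal A. y \<otimes>\<^bsub>A\<^esub> a = \<zero>\<^bsub>A\<^esub>}"

text \<open>An Artinian local ring is Gorenstein if its socle is one-dimensional over the residue
  field. Over an algebraically closed \<open>k\<close> the residue field of an Artinian local quotient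
  of the power series ring is \<open>k\<close> itself, so the dimension is taken over \<open>k\<close>.\<close>

definition gorenstein :: "('a, 'b) ring_scheme \<Rightarrow> ('k \<Rightarrow> 'a) \<Rightarrow> bool" where
  "gorenstein A \<iota> \<longleftrightarrow>
     artinian_local_ring A \<and> ring.dimension A 1 (range \<iota>) (socle A)"

definition almost_stretched_gorenstein_of_type ::
  "nat \<Rightarrow> nat \<Rightarrow> nat \<Rightarrow> ('a, 'b) ring_scheme \<Rightarrow> ('k \<Rightarrow> 'a) \<Rightarrow> bool" where
  "almost_stretched_gorenstein_of_type h s t A \<iota> \<longleftrightarrow>
     almost_stretched A \<and> gorenstein A \<iota> \<and>
     hilbert_function A \<iota> 0 1 \<and>
     hilbert_function A \<iota> 1 h \<and>
     (\<forall>j. 2 \<le> j \<and> j \<le> t \<longrightarrow> hilbert_function A \<iota> j 2) \<and>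
     (\<forall>j. t + 1 \<le> j \<and> j \<le> s \<longrightarrow> hilbert_function A \<iota> j 1) \<and>
     (\<forall>j. s < j \<longrightarrow> hilbert_function A \<iota> j 0)"


section \<open>Ideals of the power series ring\<close>

definition quot_const :: "nat \<Rightarrow> 'k::comm_ring_1 mps set \<Rightarrow> 'k \<Rightarrow> 'k mps set" where
  "quot_const h I c = I +>\<^bsub>mps_ring h\<^esub> mps_const c"

text \<open>A \<open>k\<close>-algebra isomorphism is a ring isomorphism that commutes with the structure maps.\<close>

definition isomorphic_ideals ::
  "nat \<Rightarrow> 'k::comm_ring_1 mps set \<Rightarrow> 'k mps set \<Rightarrow> bool" where
  "isomorphic_ideals h I J \<longleftrightarrow>
     (\<exists>\<phi> \<in> ring_iso (mps_ring h Quot I) (mps_ring h Quot J).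
        \<forall>c. \<phi> (quot_const h I c) = quot_const h J c)"

definition ideal_Ipz ::
  "nat \<Rightarrow> nat \<Rightarrow> nat \<Rightarrow> nat \<Rightarrow> 'k::comm_ring_1 mps \<Rightarrow> 'k mps set" where
  "ideal_Ipz h s t p z =
     (let R = mps_ring h; x = mps_var
      in genideal R
       ({x i \<otimes>\<^bsub>R\<^esub> x j | i j. 1 \<le> i \<and> i < j \<and> j \<le> h \<and> (i, j) \<noteq> (1, 2)} \<union>
        {(x j [^]\<^bsub>R\<^esub> (2::nat)) \<ominus>\<^bsub>R\<^esub> (x 1 [^]\<^bsub>R\<^esub> s) | j. 3 \<le> j \<and> j \<le> h} \<union>
        {(x 2 [^]\<^bsub>R\<^esub> (2::nat)) \<ominus>\<^bsub>R\<^esub> (x 1 [^]\<^bsub>R\<^esub> (p + 1) \<otimes>\<^bsub>R\<^esub> x 2)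
           \<ominus>\<^bsub>R\<^esub> (z \<otimes>\<^bsub>R\<^esub> x 1 [^]\<^bsub>R\<^esub> (s - t + 1))} \<union>
        {x 1 [^]\<^bsub>R\<^esub> t \<otimes>\<^bsub>R\<^esub> x 2}))"

text \<open>The natural-number subtractions below are only used for \<open>s \<ge> t + 1 \<ge> 3\<close>, where they do
  not truncate.\<close>

definition regular_couple :: "nat \<Rightarrow> nat \<Rightarrow> bool" where
  "regular_couple s t \<longleftrightarrow> \<not> (\<exists>r. r \<le> t - 2 \<and> 2 * (r + 1) = s - t + 1)"

text \<open>The lists of canonical forms, as sets of labels \<open>(p, z)\<close> standing for the ideals
  \<open>ideal_Ipz h s t p z\<close>. In the non-regular list the range \<open>1 \<le> j \<and> j + r + 2 \<le> t\<close> of the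
  exponent in \<open>c + x\<^sub>1\<^sup>j\<close> is empty when \<open>r = t - 2\<close>.\<close>

definition regular_list :: "nat \<Rightarrow> nat \<Rightarrow> (nat \<times> 'k::comm_ring_1 mps) set" where
  "regular_list h t = {(p, \<one>\<^bsub>mps_ring h\<^esub>) | p. p \<le> t - 1}"

definition nonregular_list ::
  "nat \<Rightarrow> nat \<Rightarrow> nat \<Rightarrow> (nat \<times> 'k::comm_ring_1 mps) set" where
  "nonregular_list h t r =
     {(p, \<one>\<^bsub>mps_ring h\<^esub>) | p. p < r} \<union>
     {(r, mps_const c) | c. c \<noteq> 0} \<union>
     {(r, mps_const c \<oplus>\<^bsub>mps_ring h\<^esub> mps_var 1 [^]\<^bsub>mps_ring h\<^esub> j) | c j.
        c \<noteq> 0 \<and> 1 \<le> j \<and> j + r + 2 \<le> t} \<union>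
     {(p, \<one>\<^bsub>mps_ring h\<^esub>) | p. r + 1 \<le> p \<and> p \<le> t - 1}"

end

theory Submission
  imports Defs "HOL-Computational_Algebra.Formal_Power_Series"
begin

text \<open>The classification rests on a change of coordinates that puts the defining relations of
\<open>A = R / I\<close> into the form \<open>I\<^sub>p\<^sub>,\<^sub>z\<close>. Let \<open>\<mm>\<close> be the maximal ideal of \<open>A\<close> and \<open>n = s - t + 1\<close>.

\<^bold>\<open>Structure.\<close> As the characteristic is zero, \<open>\<mm>\<^sup>s\<close> is spanned by a power \<open>x\<^sup>s\<close>, and for a general
choice of \<open>x\<close> and \<open>y\<close> the ideal \<open>\<mm>\<^sup>2\<close> equals \<open>(x\<^sup>2, x y)\<close>; since \<open>\<mm>\<^sup>t\<^sup>+\<^sup>1\<close> is generated by \<open>x\<^sup>t\<^sup>+\<^sup>1\<close>,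
a multiple of \<open>x\<close> can be subtracted from \<open>y\<close> so that \<open>x\<^sup>t y = 0\<close> (\<open>exists_coords\<close>). Then
\<open>y\<^sup>2 = x B(x) y + x\<^sup>n Z(x)\<close> for power series \<open>B\<close> and \<open>Z\<close>, and \<open>Z\<close> is a unit, because otherwise
\<open>x\<^sup>t\<^sup>-\<^sup>1 y\<close> would be a second socle element (\<open>y_square\<close>, \<open>y_square_unit\<close>). The other coordinates can
be corrected so that \<open>x\<close> and \<open>y\<close> kill them. Their products are then multiples of the socle
generator \<open>x\<^sup>s\<close>, and this symmetric form is non-degenerate, so Gram-Schmidt over an algebraically
closed field yields an orthonormal family (\<open>exists_onb\<close>).

\<^bold>\<open>Normal form.\<close> What is left is the freedom to replace \<open>x\<close> by \<open>a(x) x\<close> and \<open>y\<close> by \<open>v(x) y\<close> for units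
\<open>a\<close> and \<open>v\<close>. If \<open>B = x\<^sup>p U\<close> with a unit \<open>U\<close>, this replaces \<open>U\<close> by \<open>v U / a\<^sup>p\<^sup>+\<^sup>1\<close> and \<open>Z\<close> by \<open>v\<^sup>2 Z / a\<^sup>n\<close>,
so that \<open>Z / U\<^sup>2\<close> is multiplied by \<open>a\<^sup>2\<^sup>(\<^sup>p\<^sup>+\<^sup>1\<^sup>) / a\<^sup>n\<close>. Roots of units exist, hence \<open>U\<close> and \<open>Z\<close> can both be
made \<open>1\<close> unless \<open>n = 2 (p + 1)\<close>. In this resonant case \<open>Z / U\<^sup>2\<close> is unaffected as a function; it can only be
reparametrised, which leads to the forms \<open>c\<close> and \<open>c + x\<^sup>j\<close> (\<open>normal_form_choice\<close>, \<open>system_exists\<close>).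

\<^bold>\<open>Uniqueness.\<close> In any coordinates satisfying the relations, the elements \<open>x\<^sup>i\<close>, \<open>x\<^sup>i y\<close> and the
remaining coordinates form a basis (\<open>rep_indep\<close>). Writing a second system of coordinates in
terms of the first and comparing coefficients in its quadratic relation recovers \<open>p\<close>, and in the
resonant case it recovers \<open>Z\<close> up to reparametrisation, to the order that determines \<open>c\<close> and \<open>j\<close>
(\<open>plane_change\<close>, \<open>normal_label_unique\<close>).

\<^bold>\<open>Transport.\<close> Coordinates of \<open>A\<close> satisfying the relations of \<open>I\<^sub>p\<^sub>,\<^sub>z\<close> amount to an isomorphism
\<open>R / I\<^sub>p\<^sub>,\<^sub>z \<cong> A\<close>: evaluating power series at them is surjective, it kills the generators, and it is
injective modulo \<open>I\<^sub>p\<^sub>,\<^sub>z\<close> because the basis of \<open>A\<close> is the image of a spanning set of the model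
(\<open>isomorphic_of_system\<close>, \<open>system_of_isomorphic\<close>). All computations take place with representatives
modulo an ideal of a ring type.\<close>

section \<open>Power series as a commutative ring type\<close>

text \<open>Series in all variables with natural number indices. A type with class instances makes ordinary
ring calculations available; the ring in the variables \<open>1..h\<close> is its image under the map \<open>rho\<close> below.\<close>

typedef 'k ser = "UNIV :: 'k mps set" morphisms cf Ser ..

lemma ser_eqI: "(\<And>m. cf f m = cf g m) \<Longrightarrow> f = g"
  by (metis cf_inject ext)

lemma cf_Ser [simp]: "cf (Ser f) = f"
  by (simp add: Ser_inverse)

lemma finite_exponents_bounded:
  assumes "finite S"
  shows "finite {a :: nat \<Rightarrow>\<^sub>0 nat. Poly_Mapping.keys a \<subseteq> S \<and> (\<forall>i. Poly_Mapping.lookup a i \<le> N)}" (is "finite ?A")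
proof -
  let ?F = "{f :: nat \<Rightarrow> nat. \<forall>i. (i \<in> S \<longrightarrow> f i \<in> {..N}) \<and> (i \<notin> S \<longrightarrow> f i = 0)}"
  have "finite ?F"
    by (rule finite_set_of_finite_funs) (use assms in auto)
  moreover have "Poly_Mapping.lookup ` ?A \<subseteq> ?F"
    by (auto simp: in_keys_iff)
  ultimately have "finite (Poly_Mapping.lookup ` ?A)"
    by (rule rev_finite_subset)
  then show ?thesis
    by (rule finite_imageD) (auto simp: inj_on_def)
qed

lemma finite_splits [simp, intro]: "finite {(a, b). a + b = (m :: nat \<Rightarrow>\<^sub>0 nat)}"
proof -
  define N where "N = Max (Poly_Mapping.lookup m ` Poly_Mapping.keys m)"
  define A where "A = {a :: nat \<Rightarrow>\<^sub>0 nat. Poly_Mapping.keys a \<subseteq> Poly_Mapping.keys m \<and> (\<forall>i. Poly_Mapping.lookup a i \<le> N)}"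
  have bound: "Poly_Mapping.lookup m i \<le> N" for i
    unfolding N_def by (cases "i \<in> Poly_Mapping.keys m") (simp_all add: in_keys_iff)
  have A: "a \<in> A" if "a + b = m" for a b
  proof -
    have "Poly_Mapping.lookup a i \<le> Poly_Mapping.lookup m i" for i
      using that by (auto simp: lookup_add)
    then have "i \<in> Poly_Mapping.keys m" if "i \<in> Poly_Mapping.keys a" for i
      using that le_zero_eq[of "Poly_Mapping.lookup a i"] by (metis in_keys_iff)
    moreover have "Poly_Mapping.lookup a i \<le> N" for i
      using \<open>\<And>i. Poly_Mapping.lookup a i \<le> Poly_Mapping.lookup m i\<close> bound order_trans by blast
    ultimately show ?thesis
      unfolding A_def by blast
  qed
  have "{(a, b). a + b = m} \<subseteq> A \<times> A"
  proof
    fix p assume "p \<in> {(a, b). a + b = m}"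
    then show "p \<in> A \<times> A"
      using A[of "fst p" "snd p"] A[of "snd p" "fst p"] by (cases p) (simp add: add.commute)
  qed
  moreover have "finite (A \<times> A)"
    unfolding A_def by (intro finite_cartesian_product finite_exponents_bounded finite_keys)
  ultimately show ?thesis
    by (rule finite_subset)
qed

instantiation ser :: (comm_ring_1) comm_ring_1
begin

definition "0 = Ser (\<lambda>m. 0)"
definition "1 = Ser (\<lambda>m. if m = 0 then 1 else 0)"
definition "f + g = Ser (\<lambda>m. cf f m + cf g m)"
definition "f - g = Ser (\<lambda>m. cf f m - cf g m)"
definition "- f = Ser (\<lambda>m. - cf f m)" for f :: "'a ser"
definition "f * g = Ser (\<lambda>m. \<Sum>(a, b) | a + b = m. cf f a * cf g b)"

lemma cf_zero [simp]: "cf 0 m = 0"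
  and cf_add [simp]: "cf (f + g) m = cf f m + cf g m"
  and cf_diff [simp]: "cf (f - g) m = cf f m - cf g m"
  and cf_uminus [simp]: "cf (- f) m = - cf f m"
  and cf_one: "cf 1 m = (if m = 0 then 1 else 0)"
  and cf_mult: "cf (f * g) m = (\<Sum>(a, b) | a + b = m. cf f a * cf g b)"
  for f g :: "'a ser"
  by (simp_all add: zero_ser_def one_ser_def plus_ser_def minus_ser_def uminus_ser_def times_ser_def)

instance
proof
  fix f g e :: "'a ser"
  show "f * g * e = f * (g * e)"
  proof (rule ser_eqI)
    fix m :: "nat \<Rightarrow>\<^sub>0 nat"
    define S where "S = (\<lambda>m :: nat \<Rightarrow>\<^sub>0 nat. {p. fst p + snd p = m})"
    have S: "{(a, b). a + b = l} = S l" for l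
      by (auto simp: S_def)
    have fin: "finite (S l)" for l
      using finite_splits[of l] by (simp only: S)
    have mult: "cf (x * y) l = (\<Sum>p\<in>S l. cf x (fst p) * cf y (snd p))" for x y :: "'a ser" and l
      by (simp only: cf_mult S_def case_prod_unfold)
    have "cf (f * g * e) m = (\<Sum>p\<in>S m. \<Sum>q\<in>S (fst p). cf f (fst q) * cf g (snd q) * cf e (snd p))"
      by (simp only: mult sum_distrib_right)
    also have "\<dots> = (\<Sum>(p, q)\<in>Sigma (S m) (\<lambda>p. S (fst p)). cf f (fst q) * cf g (snd q) * cf e (snd p))"
      by (rule sum.Sigma) (simp_all add: fin)
    also have "\<dots> = (\<Sum>(p, q)\<in>Sigma (S m) (\<lambda>p. S (snd p)). cf f (fst p) * (cf g (fst q) * cf e (snd q)))"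
      by (rule sum.reindex_bij_witness[of _
            "\<lambda>(p, q). ((fst p + fst q, snd q), (fst p, fst q))"
            "\<lambda>(p, q). ((fst q, snd q + snd p), (snd q, snd p))"])
         (clarsimp simp: S_def mult.assoc add.assoc)+
    also have "\<dots> = (\<Sum>p\<in>S m. \<Sum>q\<in>S (snd p). cf f (fst p) * (cf g (fst q) * cf e (snd q)))"
      by (rule sum.Sigma[symmetric]) (simp_all add: fin)
    also have "\<dots> = cf (f * (g * e)) m"
      by (simp only: mult sum_distrib_left)
    finally show "cf (f * g * e) m = cf (f * (g * e)) m" .
  qed
  show "f * g = g * f"
  proof (rule ser_eqI)
    fix m
    show "cf (f * g) m = cf (g * f) m"
      unfolding cf_mult
      by (rule sum.reindex_bij_witness[of _ "\<lambda>(a, b). (b, a)" "\<lambda>(a, b). (b, a)"]) (auto simp: ac_simps)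
  qed
  show "1 * f = f"
  proof (rule ser_eqI)
    fix m
    have "cf (1 * f) m = (\<Sum>(a, b) \<in> {(0, m)}. cf 1 a * cf f b)"
      unfolding cf_mult
    proof (rule sum.mono_neutral_right)
      show "\<forall>p\<in>{(a, b). a + b = m} - {(0, m)}. (case p of (a, b) \<Rightarrow> cf 1 a * cf f b) = 0"
      proof
        fix p assume "p \<in> {(a, b). a + b = m} - {(0, m)}"
        then have "fst p \<noteq> 0" by (cases p) auto
        then show "(case p of (a, b) \<Rightarrow> cf 1 a * cf f b) = 0"
          by (simp add: cf_one case_prod_unfold)
      qed
    qed simp_all
    then show "cf (1 * f) m = cf f m" by (simp add: cf_one)
  qed
  show "(f + g) * e = f * e + g * e"
    by (rule ser_eqI) (simp only: cf_mult case_prod_unfold cf_add distrib_right sum.distrib)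
  show "(0 :: 'a ser) \<noteq> 1"
  proof
    assume "(0 :: 'a ser) = 1"
    then have "cf (0 :: 'a ser) 0 = cf 1 0" by simp
    then show False by (simp add: cf_one)
  qed
  show "f + g + e = f + (g + e)"
    by (rule ser_eqI) (simp add: add.assoc)
  show "f + g = g + f"
    by (rule ser_eqI) (simp add: add.commute)
  show "0 + f = f"
    by (rule ser_eqI) simp
  show "- f + f = 0"
    by (rule ser_eqI) simp
  show "f - g = f + - g"
    by (rule ser_eqI) simp
qed

end

lemma cf_sum [simp]: "cf (sum f A) m = (\<Sum>i\<in>A. cf (f i) m)"
  by (induction A rule: infinite_finite_induct) auto

definition ser_const :: "'k::comm_ring_1 \<Rightarrow> 'k ser" where
  "ser_const c = Ser (mps_const c)"

definition ser_var :: "nat \<Rightarrow> 'k::comm_ring_1 ser" where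
  "ser_var i = Ser (mps_var i)"

lemma cf_const: "cf (ser_const c) m = (if m = 0 then c else 0)"
  by (simp add: ser_const_def mps_const_def)

lemma cf_var: "cf (ser_var i) m = (if m = Poly_Mapping.single i 1 then 1 else 0)"
  by (simp add: ser_var_def mps_var_def)

lemma cf_mult_monom:
  assumes "\<And>a. a \<noteq> e \<Longrightarrow> cf f a = 0"
  shows "cf (f * g) m = (\<Sum>p | fst p = e \<and> e + snd p = m. cf f e * cf g (snd p))"
proof -
  have "cf (f * g) m = (\<Sum>p\<in>{(a, b). a + b = m}. cf f (fst p) * cf g (snd p))"
    by (simp add: cf_mult case_prod_unfold)
  also have "\<dots> = (\<Sum>p | fst p = e \<and> e + snd p = m. cf f (fst p) * cf g (snd p))"
  proof (rule sum.mono_neutral_right)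
    show "\<forall>p\<in>{(a, b). a + b = m} - {p. fst p = e \<and> e + snd p = m}. cf f (fst p) * cf g (snd p) = 0"
    proof
      fix p assume "p \<in> {(a, b). a + b = m} - {p. fst p = e \<and> e + snd p = m}"
      then have "fst p \<noteq> e" by (cases p) auto
      then show "cf f (fst p) * cf g (snd p) = 0" using assms by simp
    qed
  qed auto
  finally show ?thesis by simp
qed

lemma cf_const_mult: "cf (ser_const c * f) m = c * cf f m"
proof -
  have eq: "{p. fst p = (0 :: nat \<Rightarrow>\<^sub>0 nat) \<and> 0 + snd p = m} = {(0, m)}" by auto
  have "cf (ser_const c * f) m = (\<Sum>p | fst p = (0 :: nat \<Rightarrow>\<^sub>0 nat) \<and> 0 + snd p = m. cf (ser_const c) 0 * cf f (snd p))"
    by (rule cf_mult_monom) (simp add: cf_const)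
  then show ?thesis
    by (simp only: eq) (simp add: cf_const)
qed

lemma ser_const_add: "ser_const (a + b) = ser_const a + ser_const b"
  and ser_const_mult: "ser_const (a * b) = ser_const a * ser_const b"
  and ser_const_1 [simp]: "ser_const 1 = 1"
  by (rule ser_eqI; simp add: cf_const cf_const_mult cf_one)+

lemma cf_mult_0 [simp]: "cf (f * g) 0 = cf f 0 * cf g 0"
proof -
  have zero: "a = 0" if "a + b = 0" for a b :: "nat \<Rightarrow>\<^sub>0 nat"
  proof (rule poly_mapping_eqI)
    fix i
    have "Poly_Mapping.lookup (a + b) i = 0" using that by simp
    then show "Poly_Mapping.lookup a i = Poly_Mapping.lookup 0 i" by (simp add: lookup_add)
  qed
  have "{(a, b). a + b = (0 :: nat \<Rightarrow>\<^sub>0 nat)} = {(0, 0)}"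
  proof (intro equalityI subsetI)
    fix p :: "(nat \<Rightarrow>\<^sub>0 nat) \<times> (nat \<Rightarrow>\<^sub>0 nat)" assume "p \<in> {(a, b). a + b = 0}"
    then show "p \<in> {(0, 0)}"
      using zero[of "fst p" "snd p"] zero[of "snd p" "fst p"] by (cases p) (simp add: add.commute)
  qed simp
  then show ?thesis by (simp add: cf_mult)
qed

text \<open>A monomial containing \<open>x\<^sub>i\<close> splits in exactly one way with first factor \<open>x\<^sub>i\<close>.\<close>

lemma cf_var_mult:
  "cf (ser_var i * f) m = (if i \<in> Poly_Mapping.keys m then cf f (m - Poly_Mapping.single i 1) else 0)"
proof -
  let ?e = "Poly_Mapping.single i (1 :: nat)"
  have split: "?e + b = m \<longleftrightarrow> i \<in> Poly_Mapping.keys m \<and> b = m - ?e" for b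
  proof
    assume "?e + b = m"
    then show "i \<in> Poly_Mapping.keys m \<and> b = m - ?e"
      by (auto simp: in_keys_iff lookup_add)
  next
    assume "i \<in> Poly_Mapping.keys m \<and> b = m - ?e"
    then have "Poly_Mapping.lookup (?e + b) j = Poly_Mapping.lookup m j" for j
      by (auto simp: in_keys_iff lookup_add lookup_minus lookup_single when_def)
    then show "?e + b = m" by (rule poly_mapping_eqI)
  qed
  have eq: "{p. fst p = ?e \<and> ?e + snd p = m} = (if i \<in> Poly_Mapping.keys m then {(?e, m - ?e)} else {})"
  proof (intro equalityI subsetI)
    fix p assume "p \<in> {p. fst p = ?e \<and> ?e + snd p = m}"
    then show "p \<in> (if i \<in> Poly_Mapping.keys m then {(?e, m - ?e)} else {})"
      using split[of "snd p"] by (cases p) simp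
  next
    fix p assume "p \<in> (if i \<in> Poly_Mapping.keys m then {(?e, m - ?e)} else {})"
    then show "p \<in> {p. fst p = ?e \<and> ?e + snd p = m}"
      using split[of "snd p"] by (cases p) (simp split: if_splits)
  qed
  have "cf (ser_var i * f) m = (\<Sum>p | fst p = ?e \<and> ?e + snd p = m. cf (ser_var i) ?e * cf f (snd p))"
    by (rule cf_mult_monom) (simp add: cf_var)
  then show ?thesis
    by (simp only: eq) (simp add: cf_var)
qed

unbundle fps_syntax

section \<open>Calculating modulo an ideal\<close>

definition idl :: "'r::comm_ring_1 set \<Rightarrow> bool" where
  "idl J \<longleftrightarrow> 0 \<in> J \<and> (\<forall>f\<in>J. \<forall>g\<in>J. f + g \<in> J) \<and> (\<forall>f\<in>J. \<forall>g. g * f \<in> J)"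

lemma idlI:
  assumes "0 \<in> J" "\<And>f g. f \<in> J \<Longrightarrow> g \<in> J \<Longrightarrow> f + g \<in> J" "\<And>f g. f \<in> J \<Longrightarrow> g * f \<in> J"
  shows "idl J"
  using assms by (simp add: idl_def)

lemma idl_0: "idl J \<Longrightarrow> 0 \<in> J"
  and idl_add: "idl J \<Longrightarrow> f \<in> J \<Longrightarrow> g \<in> J \<Longrightarrow> f + g \<in> J"
  and idl_mult: "idl J \<Longrightarrow> f \<in> J \<Longrightarrow> g * f \<in> J"
  by (simp_all add: idl_def)

lemma idl_mult2: "idl J \<Longrightarrow> f \<in> J \<Longrightarrow> f * g \<in> J"
  using idl_mult[of J f g] by (simp add: mult.commute)

lemma idl_minus: "idl J \<Longrightarrow> f \<in> J \<Longrightarrow> - f \<in> J"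
  using idl_mult[of J f "-1"] by simp

lemma idl_diff: "idl J \<Longrightarrow> f \<in> J \<Longrightarrow> g \<in> J \<Longrightarrow> f - g \<in> J"
  using idl_add[of J f "- g"] idl_minus[of J g] by simp

lemma idl_sum: "idl J \<Longrightarrow> (\<And>i. i \<in> A \<Longrightarrow> f i \<in> J) \<Longrightarrow> sum f A \<in> J"
  by (induction A rule: infinite_finite_induct) (auto simp: idl_0 idl_add)

lemma idl_sumset:
  assumes "idl J" "idl K"
  shows "idl {f. \<exists>g\<in>J. f - g \<in> K}" (is "idl ?L")
proof (rule idlI)
  have "0 - 0 \<in> K" using idl_0[OF assms(2)] by simp
  then show "0 \<in> ?L" using idl_0[OF assms(1)] by blast
next
  fix f f' assume "f \<in> ?L" "f' \<in> ?L"
  then obtain g g' where g: "g \<in> J" "f - g \<in> K" "g' \<in> J" "f' - g' \<in> K" by blast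
  have "(f + f') - (g + g') = (f - g) + (f' - g')" by (simp add: algebra_simps)
  then have "(f + f') - (g + g') \<in> K" using idl_add[OF assms(2) g(2,4)] by (simp only:)
  then show "f + f' \<in> ?L" using idl_add[OF assms(1) g(1,3)] by blast
next
  fix f h assume "f \<in> ?L"
  then obtain g where g: "g \<in> J" "f - g \<in> K" by blast
  have "h * f - h * g = h * (f - g)" by (simp add: algebra_simps)
  then have "h * f - h * g \<in> K" using idl_mult[OF assms(2) g(2)] by (simp only:)
  then show "h * f \<in> ?L" using idl_mult[OF assms(1) g(1)] by blast
qed

text \<open>Quotient algebras are handled through representatives in a ring type: an equation in the quotient
is a congruence modulo \<open>I\<close>. The same ring can then be viewed modulo several ideals at once.\<close>

locale alg_mod =
  fixes C :: "'k::field_char_0 \<Rightarrow> 'r::comm_ring_1" and I :: "'r set"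
  assumes C_add: "C (a + b) = C a + C b"
    and C_mult: "C (a * b) = C a * C b"
    and C_1 [simp]: "C 1 = 1"
    and I_idl: "idl I"
begin

lemma C_0 [simp]: "C 0 = 0"
  using C_add[of 0 0] by simp

lemma C_minus: "C (- a) = - C a"
  using C_add[of a "- a"] by (simp add: eq_neg_iff_add_eq_0 add.commute)

lemma C_power: "C (a ^ n) = C a ^ n"
  by (induction n) (simp_all add: C_mult)

lemma C_sum: "C (sum f A) = (\<Sum>i\<in>A. C (f i))"
  by (induction A rule: infinite_finite_induct) (simp_all add: C_add)

lemma C_of_nat: "C (of_nat n) = of_nat n"
  by (induction n) (simp_all add: C_add)

lemma C_2: "C 2 = 2"
  using C_of_nat[of 2] by simp

lemma C_inverse: "c \<noteq> 0 \<Longrightarrow> C (inverse c) * C c = 1"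
  by (simp flip: C_mult)

definition cg :: "'r \<Rightarrow> 'r \<Rightarrow> bool" (infix "\<asymp>" 50) where
  "f \<asymp> g \<longleftrightarrow> f - g \<in> I"

lemmas I_0 = idl_0[OF I_idl]
lemmas I_add = idl_add[OF I_idl]
lemmas I_diff = idl_diff[OF I_idl]
lemmas I_minus = idl_minus[OF I_idl]
lemmas I_mult = idl_mult[OF I_idl]
lemmas I_mult2 = idl_mult2[OF I_idl]

lemma cg_0_iff: "f \<asymp> 0 \<longleftrightarrow> f \<in> I"
  by (simp add: cg_def)

lemma cg_refl [simp]: "f \<asymp> f"
  by (simp add: cg_def I_0)

lemma cg_eq: "f = g \<Longrightarrow> f \<asymp> g"
  by simp

lemma cg_sym: "f \<asymp> g \<Longrightarrow> g \<asymp> f"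
  using I_minus[of "f - g"] by (simp add: cg_def)

lemma cg_trans [trans]: "f \<asymp> g \<Longrightarrow> g \<asymp> h \<Longrightarrow> f \<asymp> h"
  using I_add[of "f - g" "g - h"] by (simp add: cg_def)

lemma cg_add: "f \<asymp> g \<Longrightarrow> f' \<asymp> g' \<Longrightarrow> f + f' \<asymp> g + g'"
  using I_add[of "f - g" "f' - g'"] by (simp add: cg_def algebra_simps)

lemma cg_minus: "f \<asymp> g \<Longrightarrow> - f \<asymp> - g"
  using I_minus[of "f - g"] by (simp add: cg_def)

lemma cg_diff: "f \<asymp> g \<Longrightarrow> f' \<asymp> g' \<Longrightarrow> f - f' \<asymp> g - g'"
  using cg_add[OF _ cg_minus, of f g f' g'] by simp

lemma cg_mult: "f \<asymp> g \<Longrightarrow> f' \<asymp> g' \<Longrightarrow> f * f' \<asymp> g * g'"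
proof -
  assume a: "f \<asymp> g" "f' \<asymp> g'"
  have "f * f' - g * g' = f' * (f - g) + g * (f' - g')" by (simp add: algebra_simps)
  then show ?thesis using a I_add I_mult by (simp add: cg_def)
qed

lemma cg_mult_l: "f \<asymp> g \<Longrightarrow> h * f \<asymp> h * g"
  by (simp add: cg_mult)

lemma cg_mult_r: "f \<asymp> g \<Longrightarrow> f * h \<asymp> g * h"
  by (simp add: cg_mult)

lemma cg_power: "f \<asymp> g \<Longrightarrow> f ^ n \<asymp> g ^ n"
  by (induction n) (simp_all add: cg_mult)

lemma cg_sum: "(\<And>i. i \<in> A \<Longrightarrow> f i \<asymp> g i) \<Longrightarrow> sum f A \<asymp> sum g A"
  by (induction A rule: infinite_finite_induct) (simp_all add: cg_add)

lemma cg_in_I: "f \<asymp> g \<Longrightarrow> f \<in> I \<longleftrightarrow> g \<in> I"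
  using cg_trans cg_sym cg_0_iff by blast

lemma cg_idl: "idl J \<Longrightarrow> I \<subseteq> J \<Longrightarrow> f \<asymp> g \<Longrightarrow> g \<in> J \<Longrightarrow> f \<in> J"
  using idl_add[of J "f - g" g] by (auto simp: cg_def)

lemma cg_mult_0: "f \<asymp> 0 \<Longrightarrow> h * f \<asymp> 0" "f \<asymp> 0 \<Longrightarrow> f * h \<asymp> 0"
  using cg_mult_l[of f 0 h] cg_mult_r[of f 0 h] by simp_all

lemma cg_add_0: "f \<asymp> 0 \<Longrightarrow> g \<asymp> 0 \<Longrightarrow> f + g \<asymp> 0"
  using cg_add[of f 0 g 0] by simp

lemma C_mult_cg_0_iff: "c \<noteq> 0 \<Longrightarrow> C c * f \<asymp> 0 \<longleftrightarrow> f \<asymp> 0"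
proof
  assume "c \<noteq> 0" "C c * f \<asymp> 0"
  then have "C (inverse c) * (C c * f) \<asymp> 0" by (blast intro: cg_mult_0(1))
  then show "f \<asymp> 0"
    by (simp only: mult.assoc[symmetric] C_inverse[OF \<open>c \<noteq> 0\<close>] mult_1_left)
qed (rule cg_mult_0(1))

lemma C_mult_in_I_iff: "c \<noteq> 0 \<Longrightarrow> C c * f \<in> I \<longleftrightarrow> f \<in> I"
  using C_mult_cg_0_iff[of c f] by (simp add: cg_0_iff)

lemma power_le_in_I: "x ^ m \<in> I \<Longrightarrow> m \<le> n \<Longrightarrow> x ^ n \<in> I"
  using I_mult[of "x ^ m" "x ^ (n - m)"] by (simp flip: power_add)

end

lemma fps_factor: "(\<And>i. i < k \<Longrightarrow> F $ i = 0) \<Longrightarrow> \<exists>G. F = fps_X ^ k * (G :: 'a::comm_ring_1 fps)"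
  by (rule exI[of _ "fps_shift k F"]) (auto simp: fps_eq_iff fps_X_power_mult_nth)

lemma fps_least_nonzero:
  assumes "\<not> (\<forall>i<k. F $ i = 0)"
  obtains l H where "l < k" "F = fps_X ^ l * (H :: 'a::comm_ring_1 fps)" "H $ 0 \<noteq> 0"
proof -
  define l where "l = (LEAST i. F $ i \<noteq> 0)"
  obtain i where i: "i < k" "F $ i \<noteq> 0" using assms by auto
  have l: "F $ l \<noteq> 0" unfolding l_def using i(2) by (rule LeastI)
  have less: "F $ j = 0" if "j < l" for j
    using not_less_Least[of j "\<lambda>i. F $ i \<noteq> 0"] that by (auto simp: l_def)
  have "l \<le> i" unfolding l_def using i(2) by (rule Least_le)
  moreover obtain H where H: "F = fps_X ^ l * H" using fps_factor[of l F] less by auto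
  moreover have "H $ 0 \<noteq> 0" using l by (simp add: H fps_X_power_mult_nth)
  ultimately show thesis using that[of l H] i(1) by simp
qed

text \<open>Since \<open>x\<^sup>N\<close> vanishes, a power series in one variable can be evaluated at \<open>x\<close> by truncation.\<close>

locale nil_elt = alg_mod C I for C :: "'k::field_char_0 \<Rightarrow> 'r::comm_ring_1" and I +
  fixes x :: 'r and N :: nat
  assumes x_nil: "x ^ N \<in> I"
begin

definition ev :: "'k fps \<Rightarrow> 'r" where
  "ev F = (\<Sum>i<N. C (F $ i) * x ^ i)"

lemma x_power_0: "N \<le> k \<Longrightarrow> x ^ k \<asymp> 0"
  using power_le_in_I[OF x_nil] by (simp add: cg_0_iff)

lemma ev_0 [simp]: "ev 0 = 0"
  by (simp add: ev_def)

lemma ev_add: "ev (F + G) = ev F + ev G"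
  by (simp add: ev_def C_add algebra_simps sum.distrib)

lemma ev_minus: "ev (- F) = - ev F"
  by (simp add: ev_def C_minus sum_negf)

lemma ev_diff: "ev (F - G) = ev F - ev G"
  using ev_add[of F "- G"] by (simp add: ev_minus)

lemma ev_X_power: "ev (fps_X ^ k) \<asymp> x ^ k"
proof -
  have "ev (fps_X ^ k) = (\<Sum>i<N. if i = k then x ^ i else 0)"
    unfolding ev_def by (rule sum.cong) (auto simp: fps_X_power_iff)
  also have "\<dots> \<asymp> x ^ k"
    using x_power_0[of k] by (auto simp: cg_sym not_less)
  finally show ?thesis .
qed

lemma ev_X: "ev fps_X \<asymp> x"
  using ev_X_power[of 1] by simp

lemma ev_const: "ev (fps_const c) \<asymp> C c"
proof -
  have "ev (fps_const c) = C c * ev (fps_X ^ 0)"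
    unfolding ev_def sum_distrib_left by (rule sum.cong) auto
  then show ?thesis
    using cg_mult_l[OF ev_X_power[of 0], of "C c"] by simp
qed

lemma ev_1: "ev 1 \<asymp> 1"
  using ev_X_power[of 0] by simp

text \<open>The products of monomials that truncation loses have degree at least \<open>N\<close>, so evaluation is a ring
homomorphism modulo \<open>I\<close>.\<close>

lemma ev_mult: "ev (F * G) \<asymp> ev F * ev G"
proof -
  define u where "u = (\<lambda>i j. (C (F $ i) * x ^ i) * (C (G $ j) * x ^ j))"
  let ?T = "{(i, j). i + j < N}"
  have fin: "finite ?T"
    by (rule finite_subset[of _ "{..<N} \<times> {..<N}"]) auto
  have u0: "u i j \<asymp> 0" if "\<not> i + j < N" for i j
  proof -
    have "u i j = C (F $ i) * C (G $ j) * x ^ (i + j)" by (simp add: u_def power_add ac_simps)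
    then show ?thesis using x_power_0[of "i + j"] that by (simp add: cg_mult_0)
  qed
  have "ev F * ev G = (\<Sum>(i, j)\<in>{..<N} \<times> {..<N}. u i j)"
    by (simp add: ev_def u_def sum_product sum.cartesian_product)
  also have "\<dots> = (\<Sum>(i, j)\<in>?T. u i j) + (\<Sum>(i, j)\<in>{..<N} \<times> {..<N} - ?T. u i j)"
    by (subst sum.subset_diff[of ?T]) auto
  also have "\<dots> \<asymp> (\<Sum>(i, j)\<in>?T. u i j) + 0"
  proof (rule cg_add[OF cg_refl])
    have "(\<Sum>(i, j)\<in>{..<N} \<times> {..<N} - ?T. u i j) \<asymp> (\<Sum>(i, j)\<in>{..<N} \<times> {..<N} - ?T. 0)"
      by (rule cg_sum) (auto intro: u0)
    then show "(\<Sum>(i, j)\<in>{..<N} \<times> {..<N} - ?T. u i j) \<asymp> 0" by simp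
  qed
  also have "(\<Sum>(i, j)\<in>?T. u i j) + 0 = (\<Sum>k<N. \<Sum>i\<le>k. u i (k - i))"
    by (simp add: sum.triangle_reindex)
  also have "\<dots> = ev (F * G)"
    unfolding ev_def
  proof (rule sum.cong[OF refl])
    fix k
    have "u i (k - i) = C (F $ i * G $ (k - i)) * x ^ k" if "i \<in> {..k}" for i
    proof -
      have "x ^ i * x ^ (k - i) = x ^ k" using that by (simp flip: power_add)
      then show ?thesis unfolding u_def C_mult by (metis mult.assoc mult.left_commute)
    qed
    then have "(\<Sum>i\<le>k. u i (k - i)) = (\<Sum>i\<le>k. C (F $ i * G $ (k - i)) * x ^ k)"
      by (rule sum.cong[OF refl])
    then show "(\<Sum>i\<le>k. u i (k - i)) = C ((F * G) $ k) * x ^ k"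
      by (simp add: fps_mult_nth C_sum sum_distrib_right atLeast0AtMost)
  qed
  finally show ?thesis by (rule cg_sym)
qed

lemma ev_power: "ev (F ^ n) \<asymp> ev F ^ n"
proof (induction n)
  case (Suc n)
  then show ?case using cg_trans[OF ev_mult[of F "F ^ n"] cg_mult_l[OF Suc]] by simp
qed (simp add: ev_1)

lemma ev_shift: "ev (fps_X ^ k * F) \<asymp> x ^ k * ev F"
  using cg_trans[OF ev_mult cg_mult_r[OF ev_X_power]] .

text \<open>Multiplication by \<open>x ^ k\<close> kills all terms of degree at least \<open>N - k\<close>.\<close>

lemma ev_cong_le:
  assumes "\<And>i. i < m \<Longrightarrow> F $ i = G $ i" "N \<le> k + m"
  shows "x ^ k * ev F \<asymp> x ^ k * ev G"
proof -
  obtain H where H: "F - G = fps_X ^ m * H"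
    using fps_factor[of m "F - G"] assms(1) by auto
  have "x ^ k * ev F - x ^ k * ev G = x ^ k * ev (fps_X ^ m * H)"
    by (simp only: ev_diff right_diff_distrib H[symmetric])
  also have "\<dots> \<asymp> x ^ k * (x ^ m * ev H)"
    by (rule cg_mult_l[OF ev_shift])
  also have "x ^ k * (x ^ m * ev H) = x ^ (k + m) * ev H"
    by (simp only: power_add mult.assoc)
  also have "\<dots> \<asymp> 0"
    by (rule cg_mult_0(2)[OF x_power_0[OF assms(2)]])
  finally show ?thesis by (simp add: cg_def)
qed

lemma ev_top: "N \<le> Suc k \<Longrightarrow> x ^ k * ev F \<asymp> x ^ k * C (F $ 0)"
  using cg_trans[OF ev_cong_le[of 1 F "fps_const (F $ 0)" k] cg_mult_l[OF ev_const]] by simp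

lemma ev_decomp: "\<exists>G. ev F \<asymp> C (F $ 0) + x * ev G"
proof -
  obtain G where G: "F - fps_const (F $ 0) = fps_X ^ 1 * G" using fps_factor[of 1 "F - fps_const (F $ 0)"] by auto
  have "F = fps_const (F $ 0) + fps_X ^ 1 * G" by (simp only: G[symmetric]) simp
  then have "ev F = ev (fps_const (F $ 0)) + ev (fps_X ^ 1 * G)" by (metis ev_add)
  also have "\<dots> \<asymp> C (F $ 0) + x ^ 1 * ev G" by (intro cg_add ev_const ev_shift)
  finally show ?thesis by auto
qed

end

context nil_elt
begin

lemma ev_eq_0D:
  assumes "ev F \<asymp> 0" "x ^ (N - 1) \<notin> I" "i < N"
  shows "F $ i = 0"
proof (rule ccontr)
  assume "F $ i \<noteq> 0"
  then have "\<not> (\<forall>i<N. F $ i = 0)" using assms(3) by blast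
  then obtain l H where l: "l < N" and H: "F = fps_X ^ l * H" "H $ 0 \<noteq> 0"
    by (rule fps_least_nonzero)
  have "C (H $ 0) * x ^ (N - 1) = x ^ (N - 1) * C (H $ 0)" by (rule mult.commute)
  also have "\<dots> \<asymp> x ^ (N - 1) * ev H"
    by (rule cg_sym[OF ev_top]) simp
  also have "x ^ (N - 1) * ev H = x ^ (N - 1 - l) * (x ^ l * ev H)"
    using l by (simp flip: power_add mult.assoc)
  also have "\<dots> \<asymp> x ^ (N - 1 - l) * ev F"
    unfolding H(1) by (rule cg_mult_l[OF cg_sym[OF ev_shift]])
  also have "\<dots> \<asymp> 0" by (rule cg_mult_0(1)[OF assms(1)])
  finally show False
    using assms(2) H(2) by (simp add: C_mult_in_I_iff cg_0_iff)
qed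

lemma x_ev_eq_0D:
  assumes "x ^ k * ev F \<asymp> 0" "x ^ (N - 1) \<notin> I" "i + k < N"
  shows "F $ i = 0"
proof -
  have "ev (fps_X ^ k * F) \<asymp> 0" using cg_trans[OF ev_shift assms(1)] .
  from ev_eq_0D[OF this assms(2,3)] show ?thesis by (simp add: fps_X_power_mult_nth)
qed

end

section \<open>Plane algebras\<close>

text \<open>The relation for \<open>y\<^sup>2\<close> reduces every polynomial in \<open>x\<close> and \<open>y\<close> to the form \<open>F(x) + G(x) y\<close>; the relation
\<open>x\<^sup>t y = 0\<close> leaves only the first \<open>t\<close> coefficients of \<open>G\<close> relevant.\<close>

locale plane = nil_elt C I x N for C :: "'k::field_char_0 \<Rightarrow> 'r::comm_ring_1" and I x N +
  fixes y :: 'r and t n :: nat and B Z :: "'k fps"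
  assumes xt_y: "x ^ t * y \<asymp> 0"
    and y_sq: "y * y \<asymp> x * ev B * y + x ^ n * ev Z"
begin

definition pr :: "'k fps \<Rightarrow> 'k fps \<Rightarrow> 'r" where
  "pr F G = ev F + ev G * y"

lemma ev_y_0: "(\<And>i. i < t \<Longrightarrow> G $ i = 0) \<Longrightarrow> ev G * y \<asymp> 0"
proof -
  assume "\<And>i. i < t \<Longrightarrow> G $ i = 0"
  then obtain H where "G = fps_X ^ t * H" using fps_factor[of t G] by auto
  then have "ev G * y \<asymp> x ^ t * ev H * y" using cg_mult_r[OF ev_shift] by simp
  also have "x ^ t * ev H * y = ev H * (x ^ t * y)" by (simp add: ac_simps)
  also have "\<dots> \<asymp> 0" by (rule cg_mult_0(1)[OF xt_y])
  finally show ?thesis .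
qed

lemma ev_cong: "(\<And>i. i < N \<Longrightarrow> F $ i = G $ i) \<Longrightarrow> ev F \<asymp> ev G"
  using ev_cong_le[of N F G 0] by simp

lemma pr_cong:
  assumes "\<And>i. i < N \<Longrightarrow> F $ i = F' $ i" "\<And>i. i < t \<Longrightarrow> G $ i = G' $ i"
  shows "pr F G \<asymp> pr F' G'"
proof -
  have "ev (G - G') * y \<asymp> 0" by (rule ev_y_0) (simp add: assms(2))
  then have "ev G * y \<asymp> ev G' * y" by (simp add: cg_def ev_diff left_diff_distrib)
  then show ?thesis unfolding pr_def by (intro cg_add ev_cong assms(1))
qed

lemma pr_add: "pr F G + pr F' G' = pr (F + F') (G + G')"
  by (simp add: pr_def ev_add algebra_simps)

lemma pr_diff: "pr F G - pr F' G' = pr (F - F') (G - G')"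
  by (simp add: pr_def ev_diff algebra_simps)

lemma pr_0_1: "pr 0 1 \<asymp> y"
  using cg_mult_r[OF ev_1, of y] by (simp add: pr_def)

lemma pr_0: "pr 0 0 = 0"
  by (simp add: pr_def)

lemma pr_ev: "pr F 0 = ev F"
  by (simp add: pr_def)

lemma pr_mult: "pr F G * pr F' G' \<asymp>
  pr (F * F' + fps_X ^ n * (G * G' * Z)) (F * G' + F' * G + fps_X * (G * G' * B))"
proof -
  have 1: "ev F * ev F' \<asymp> ev (F * F')" "ev F * ev G' \<asymp> ev (F * G')" "ev F' * ev G \<asymp> ev (F' * G)"
    by (rule cg_sym[OF ev_mult])+
  have 2: "ev G * ev G' * ev H \<asymp> ev (G * G' * H)" for H
    using cg_sym[OF cg_trans[OF ev_mult cg_mult_r[OF ev_mult]]] .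
  have "ev G * ev G' * (y * y) \<asymp> ev G * ev G' * (x * ev B * y + x ^ n * ev Z)"
    by (rule cg_mult_l[OF y_sq])
  also have "\<dots> = x * (ev G * ev G' * ev B) * y + x ^ n * (ev G * ev G' * ev Z)"
    by (simp add: algebra_simps)
  also have "\<dots> \<asymp> x * ev (G * G' * B) * y + x ^ n * ev (G * G' * Z)"
    by (intro cg_add cg_mult_r cg_mult_l 2)
  also have "\<dots> \<asymp> ev (fps_X * (G * G' * B)) * y + ev (fps_X ^ n * (G * G' * Z))"
    using ev_shift[of 1] by (intro cg_add cg_mult_r) (auto intro: cg_sym ev_shift)
  finally have 3: "ev G * ev G' * (y * y) \<asymp>
    ev (fps_X * (G * G' * B)) * y + ev (fps_X ^ n * (G * G' * Z))" .
  have "pr F G * pr F' G' = (ev F * ev F' + (ev F * ev G' + ev F' * ev G) * y) + ev G * ev G' * (y * y)"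
    by (simp add: pr_def algebra_simps)
  also have "\<dots> \<asymp> (ev (F * F') + (ev (F * G') + ev (F' * G)) * y)
      + (ev (fps_X * (G * G' * B)) * y + ev (fps_X ^ n * (G * G' * Z)))"
    by (intro cg_add cg_mult_r 1 3)
  also have "\<dots> = pr (F * F' + fps_X ^ n * (G * G' * Z)) (F * G' + F' * G + fps_X * (G * G' * B))"
    by (simp add: pr_def ev_add algebra_simps)
  finally show ?thesis .
qed

text \<open>Each factor \<open>a x + b y\<close> either contributes \<open>x\<close> or replaces \<open>y\<close> by \<open>y\<^sup>2\<close>, which has order \<open>n\<close> in \<open>x\<close> and, in the
coefficient of \<open>y\<close>, order \<open>p + 1\<close>; this is why the errors are so small.\<close>

lemma power_times_y:
  assumes "B = fps_X ^ p * U" "t < n"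
  shows "\<exists>f g. pr (fps_X * a) b ^ Suc m * y \<asymp>
           pr (fps_X ^ (m + n) * f) (fps_X ^ Suc m * (a ^ Suc m + fps_X ^ p * g))"
proof (induction m)
  case 0
  have "pr (fps_X * a) b ^ Suc 0 * y \<asymp> pr (fps_X * a) b * pr 0 1"
    using cg_mult_l[OF cg_sym[OF pr_0_1]] by simp
  also have "\<dots> \<asymp> pr (fps_X ^ n * (b * Z)) (fps_X * (a + fps_X ^ p * (b * U)))"
    using pr_mult[of "fps_X * a" b 0 1] by (simp add: assms(1) algebra_simps)
  finally show ?case by (metis add_0 power_Suc0_right)
next
  case (Suc m)
  then obtain f g :: "'k fps" where fg: "pr (fps_X * a) b ^ Suc m * y \<asymp>
      pr (fps_X ^ (m + n) * f) (fps_X ^ Suc m * (a ^ Suc m + fps_X ^ p * g))" by blast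
  let ?h = "a ^ Suc m + fps_X ^ p * g"
  have "pr (fps_X * a) b ^ Suc (Suc m) * y = pr (fps_X * a) b * (pr (fps_X * a) b ^ Suc m * y)"
    by (simp add: ac_simps)
  also have "\<dots> \<asymp> pr (fps_X * a) b * pr (fps_X ^ (m + n) * f) (fps_X ^ Suc m * ?h)"
    by (rule cg_mult_l[OF fg])
  also note pr_mult
  also have "pr (fps_X * a * (fps_X ^ (m + n) * f) + fps_X ^ n * (b * (fps_X ^ Suc m * ?h) * Z))
      (fps_X * a * (fps_X ^ Suc m * ?h) + fps_X ^ (m + n) * f * b + fps_X * (b * (fps_X ^ Suc m * ?h) * B))
    = pr (fps_X ^ (Suc m + n) * (a * f + b * ?h * Z))
       (fps_X ^ Suc (Suc m) * (a ^ Suc (Suc m) + fps_X ^ p * (a * g + b * U * ?h)) + fps_X ^ (m + n) * (f * b))"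
    unfolding assms(1) by (rule arg_cong2[of _ _ _ _ pr]) (simp_all add: algebra_simps power_add)
  also have "\<dots> \<asymp> pr (fps_X ^ (Suc m + n) * (a * f + b * ?h * Z))
       (fps_X ^ Suc (Suc m) * (a ^ Suc (Suc m) + fps_X ^ p * (a * g + b * U * ?h)))"
    using assms(2) by (intro pr_cong) (simp_all add: fps_X_power_mult_nth)
  finally show ?case by blast
qed

text \<open>The same bookkeeping for the powers themselves: apart from \<open>(a x)\<^sup>l\<^sup>+\<^sup>1\<close>, the part without \<open>y\<close> arises from at
least one \<open>y\<^sup>2\<close> and therefore has order at least \<open>l - 1 + n\<close>.\<close>

lemma power_of_linear:
  assumes "t < n"
  shows "\<exists>f g. pr (fps_X * a) b ^ Suc l \<asymp>
           pr (fps_X ^ Suc l * a ^ Suc l + fps_X ^ (l + n - 1) * f) (fps_X ^ l * g)"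
proof (induction l)
  case 0
  have "pr (fps_X * a) b ^ Suc 0 \<asymp> pr (fps_X ^ Suc 0 * a ^ Suc 0 + fps_X ^ (0 + n - 1) * 0) (fps_X ^ 0 * b)"
    by simp
  then show ?case by blast
next
  case (Suc l)
  then obtain f g where fg: "pr (fps_X * a) b ^ Suc l \<asymp>
      pr (fps_X ^ Suc l * a ^ Suc l + fps_X ^ (l + n - 1) * f) (fps_X ^ l * g)" by blast
  let ?F = "fps_X ^ Suc l * a ^ Suc l + fps_X ^ (l + n - 1) * f"
  have n: "fps_X ^ (l + n) = fps_X * (fps_X :: 'k fps) ^ (l + n - 1)"
    using assms by (simp flip: power_Suc)
  have "pr (fps_X * a) b ^ Suc (Suc l) = pr (fps_X * a) b * pr (fps_X * a) b ^ Suc l" by simp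
  also have "\<dots> \<asymp> pr (fps_X * a) b * pr ?F (fps_X ^ l * g)"
    by (rule cg_mult_l[OF fg])
  also note pr_mult
  also have "pr (fps_X * a * ?F + fps_X ^ n * (b * (fps_X ^ l * g) * Z))
      (fps_X * a * (fps_X ^ l * g) + ?F * b + fps_X * (b * (fps_X ^ l * g) * B))
    = pr (fps_X ^ Suc (Suc l) * a ^ Suc (Suc l) + fps_X ^ (l + n) * (a * f + b * g * Z))
       (fps_X ^ Suc l * (a * g + a ^ Suc l * b + b * g * B) + fps_X ^ (l + n - 1) * (f * b))"
    by (rule arg_cong2[of _ _ _ _ pr]) (simp_all add: algebra_simps power_add n[unfolded power_add])
  also have "\<dots> \<asymp> pr (fps_X ^ Suc (Suc l) * a ^ Suc (Suc l) + fps_X ^ (l + n) * (a * f + b * g * Z))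
       (fps_X ^ Suc l * (a * g + a ^ Suc l * b + b * g * B))"
    using assms by (intro pr_cong) (auto simp add: fps_X_power_mult_nth)
  finally show ?case by (metis Suc_diff_1 add_Suc diff_Suc_1)
qed

text \<open>Multiplication by \<open>x\<^sup>t\<close> shows that the first \<open>t\<close> coefficients of \<open>F\<close> vanish, so \<open>y\<close> kills \<open>F(x)\<close>. If \<open>G\<close> had order \<open>l < t\<close>,
multiplication by \<open>x\<^sup>t\<^sup>-\<^sup>1\<^sup>-\<^sup>l y\<close> would turn \<open>G(x) y\<close> into a non-zero multiple of \<open>x\<^sup>N\<^sup>-\<^sup>1\<close>, because \<open>Z\<close> is a unit.\<close>

lemma pr_eq_0D:
  assumes "pr F G \<asymp> 0" "x ^ (N - 1) \<notin> I" "Z $ 0 \<noteq> 0" "N = n + t" "t \<le> n" "1 \<le> t"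
  shows "\<forall>i<n + t. F $ i = 0" "\<forall>i<t. G $ i = 0"
proof -
  have N: "n + t = N" "t - 1 + n = N - 1" using assms(4-6) by auto
  show G: "\<forall>i<t. G $ i = 0"
  proof (rule ccontr)
    assume "\<not> (\<forall>i<t. G $ i = 0)"
    then obtain l H where l: "l < t" and H: "G = fps_X ^ l * H" "H $ 0 \<noteq> 0"
      by (rule fps_least_nonzero)
    have F0: "F $ i = 0" if "i < t" for i
    proof (rule x_ev_eq_0D[OF _ assms(2)])
      have "x ^ t * ev F = x ^ t * pr F G - ev G * (x ^ t * y)"
        by (simp add: pr_def algebra_simps)
      also have "\<dots> \<asymp> 0 - 0" by (intro cg_diff cg_mult_0(1) assms(1) xt_y)
      finally show "x ^ t * ev F \<asymp> 0" by simp
      show "i + t < N" using that assms(4,5) by simp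
    qed
    have "x ^ (t - 1 - l) * y * pr F G \<asymp> 0" by (rule cg_mult_0(1)[OF assms(1)])
    moreover have "x ^ (t - 1 - l) * y * pr F G \<asymp> x ^ (N - 1) * C (H $ 0 * Z $ 0)"
    proof -
      have "x ^ (t - 1 - l) * y * pr F G = x ^ (t - 1 - l) * (ev F * y) + x ^ (t - 1 - l) * ev G * (y * y)"
        by (simp add: pr_def algebra_simps)
      also have "\<dots> \<asymp> x ^ (t - 1 - l) * 0 + x ^ (t - 1 - l) * (x ^ l * ev H) * (x * ev B * y + x ^ n * ev Z)"
        unfolding H(1) by (intro cg_add cg_mult_l cg_mult ev_y_0 F0 ev_shift y_sq)
      also have "\<dots> = x ^ (t - 1) * ev H * (x * ev B * y + x ^ n * ev Z)"
        using l by (simp flip: power_add mult.assoc)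
      also have "\<dots> = ev H * ev B * (x ^ t * y) + x ^ (N - 1) * (ev H * ev Z)"
      proof -
        have "x ^ t = x ^ (t - 1) * x" using assms(6) by (cases t) (simp_all add: mult.commute)
        moreover have "x ^ (N - 1) = x ^ (t - 1) * x ^ n" by (simp only: N(2)[symmetric] power_add)
        ultimately show ?thesis by (simp only: algebra_simps)
      qed
      also have "\<dots> \<asymp> 0 + x ^ (N - 1) * ev (H * Z)"
        by (intro cg_add cg_mult_0 xt_y cg_mult_l cg_sym[OF ev_mult])
      also have "0 + x ^ (N - 1) * ev (H * Z) \<asymp> x ^ (N - 1) * C ((H * Z) $ 0)"
        using ev_top[of "N - 1" "H * Z"] by simp
      finally show ?thesis by simp
    qed
    ultimately have "C (H $ 0 * Z $ 0) * x ^ (N - 1) \<asymp> 0"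
      using cg_trans cg_sym by (metis mult.commute)
    then show False using H(2) assms(2,3) by (simp add: C_mult_in_I_iff cg_0_iff)
  qed
  have "ev F \<asymp> 0"
  proof -
    have "ev F = pr F G - ev G * y" by (simp add: pr_def)
    also have "\<dots> \<asymp> 0 - 0" using G by (intro cg_diff assms(1) ev_y_0) simp
    finally show ?thesis by simp
  qed
  then show "\<forall>i<n + t. F $ i = 0"
    using ev_eq_0D[OF _ assms(2)] N(1) by simp
qed

end

text \<open>A second pair \<open>x', y'\<close> satisfying relations of the same shape, with \<open>B = x\<^sup>p\<close>. The ideal is one in which the
monomials \<open>x\<^sup>i\<close> are independent only for \<open>i < N = n + t - 1\<close>: it arises by dividing out the socle, which removes
the influence of the coordinates other than \<open>x\<close> and \<open>y\<close>.\<close>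

locale plane_change = plane C I x N y t n B Z
  for C :: "'k::field_char_0 \<Rightarrow> 'r::comm_ring_1" and I x N y t n B Z +
  fixes p p' j' :: nat and c' d' :: 'k and a b W V :: "'k fps" and x' y' :: 'r
  assumes N: "N + 1 = n + t" and t_n: "t < n" and t: "2 \<le> t" and p: "p < t" "p' < t"
    and B: "B = fps_X ^ p" and Z: "Z $ 0 \<noteq> 0"
    and indep: "\<And>F G. pr F G \<asymp> 0 \<Longrightarrow> (\<forall>i<N. F $ i = 0) \<and> (\<forall>i<t. G $ i = 0)"
    and x': "x' \<asymp> pr (fps_X * a) b" and y': "y' \<asymp> pr W V"
    and a: "a $ 0 \<noteq> 0" and W: "W $ 0 = 0"
    and xt_y': "x' ^ t * y' \<asymp> 0"
    and y'_sq: "y' * y' \<asymp> x' ^ Suc p' * y' + (C c' + C d' * x' ^ j') * x' ^ n"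
begin

lemma pr_cong': 
  assumes "F = F' + fps_X ^ N * F''" "G = G' + fps_X ^ t * G''"
  shows "pr F G \<asymp> pr F' G'"
  unfolding assms by (rule pr_cong) (simp_all add: fps_X_power_mult_nth)

lemma B1: "B = fps_X ^ p * 1"
  using B by simp

lemma high_power: "n \<le> m \<Longrightarrow> x' ^ m \<asymp> pr (fps_X ^ m * a ^ m) 0"
proof -
  assume m: "n \<le> m"
  then obtain l where l: "m = Suc l" using t_n by (cases m) auto
  have "x' ^ m \<asymp> pr (fps_X * a) b ^ m" by (rule cg_power[OF x'])
  also obtain f g where fg: "pr (fps_X * a) b ^ m \<asymp>
      pr (fps_X ^ m * a ^ m + fps_X ^ (l + n - 1) * f) (fps_X ^ l * g)"
    using power_of_linear[OF t_n, of a b l] l by auto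
  note fg
  also have "pr (fps_X ^ m * a ^ m + fps_X ^ (l + n - 1) * f) (fps_X ^ l * g) \<asymp> pr (fps_X ^ m * a ^ m) 0"
    using m l t_n N by (intro pr_cong) (auto simp: fps_X_power_mult_nth)
  finally show ?thesis .
qed

text \<open>As \<open>x'\<^sup>t y' = 0\<close> and \<open>x'\<^sup>t y\<close> vanishes too, the part \<open>W\<close> of \<open>y'\<close> is killed by \<open>x\<^sup>t\<close>.\<close>

lemma W_low: "\<exists>w. W = fps_X ^ (n - 1) * w"
proof -
  obtain m where m: "t = Suc m" using t by (cases t) auto
  obtain f g where fg: "pr (fps_X * a) b ^ t * y \<asymp> pr (fps_X ^ (m + n) * f) (fps_X ^ t * g)"
    using power_times_y[OF B1 t_n, of a b m] m by blast
  have mn: "m + n = N" using m N by simp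
  have 1: "pr (fps_X * a) b ^ t * y \<asymp> 0"
  proof -
    have "pr (fps_X * a) b ^ t * y \<asymp> pr (fps_X ^ (m + n) * f) (fps_X ^ t * g)" by (rule fg)
    also have "\<dots> \<asymp> pr 0 0" by (rule pr_cong) (simp_all add: fps_X_power_mult_nth mn)
    finally show ?thesis by (simp add: pr_0)
  qed
  obtain f g where fg: "pr (fps_X * a) b ^ t \<asymp>
      pr (fps_X ^ t * a ^ t + fps_X ^ (m + n - 1) * f) (fps_X ^ m * g)"
    using power_of_linear[OF t_n, of a b m] m by blast
  obtain w0 where w0: "W = fps_X * w0" using fps_factor[of 1 W] W by auto
  have N1: "N = Suc (m + n - 1)" using mn t_n by simp
  have 2: "pr (fps_X * a) b ^ t * ev W \<asymp> pr (fps_X ^ t * a ^ t * W) 0"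
  proof -
    have "pr (fps_X * a) b ^ t * ev W \<asymp>
        pr (fps_X ^ t * a ^ t + fps_X ^ (m + n - 1) * f) (fps_X ^ m * g) * pr W 0"
      using cg_mult_r[OF fg] by (simp add: pr_ev)
    also note pr_mult
    also have "pr ((fps_X ^ t * a ^ t + fps_X ^ (m + n - 1) * f) * W + fps_X ^ n * (fps_X ^ m * g * 0 * Z))
        ((fps_X ^ t * a ^ t + fps_X ^ (m + n - 1) * f) * 0 + W * (fps_X ^ m * g) + fps_X * (fps_X ^ m * g * 0 * B))
      \<asymp> pr (fps_X ^ t * a ^ t * W) 0"
      by (rule pr_cong'[of _ _ "f * w0" _ _ "w0 * g"]) (simp_all only: N1 m w0 power_Suc, simp_all add: algebra_simps)
    finally show ?thesis .
  qed
  have "pr (fps_X ^ t * a ^ t * W) 0 \<asymp> pr (fps_X * a) b ^ t * ev W" by (rule cg_sym[OF 2])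
  also have "\<dots> = pr (fps_X * a) b ^ t * pr W V - ev V * (pr (fps_X * a) b ^ t * y)"
    by (simp add: pr_def[of W V] algebra_simps)
  also have "\<dots> \<asymp> x' ^ t * y' - ev V * 0"
    by (intro cg_diff cg_mult cg_power cg_sym[OF x'] cg_sym[OF y'] cg_refl 1)
  also have "x' ^ t * y' - ev V * 0 \<asymp> 0" using xt_y' by simp
  finally have "\<forall>i<N. (fps_X ^ t * (a ^ t * W)) $ i = 0" using indep by (simp add: mult.assoc)
  then have aW: "(a ^ t * W) $ i = 0" if "i < n - 1" for i
    using that N by (auto simp: fps_X_power_mult_nth dest!: spec[of _ "i + t"])
  have "(a ^ t) $ 0 \<noteq> 0" using a by (simp add: fps_nth_power_0)
  then have inv: "inverse (a ^ t) * a ^ t = 1" by (rule inverse_mult_eq_1)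
  obtain H where "a ^ t * W = fps_X ^ (n - 1) * H" using fps_factor[of "n - 1" "a ^ t * W"] aW by blast
  then have "inverse (a ^ t) * (a ^ t * W) = fps_X ^ (n - 1) * (inverse (a ^ t) * H)"
    by (simp add: mult.left_commute)
  then have "W = fps_X ^ (n - 1) * (inverse (a ^ t) * H)"
    by (simp only: mult.assoc[symmetric] inv mult_1_left)
  then show ?thesis by blast
qed

lemma C_times_pr: "C c * pr F G \<asymp> pr (fps_const c * F) (fps_const c * G)"
proof -
  have "C c * pr F G \<asymp> pr (fps_const c) 0 * pr F G"
    using cg_mult_r[OF cg_sym[OF ev_const[of c]], of "pr F G"] by (simp add: pr_ev)
  also have "\<dots> \<asymp> pr (fps_const c * F) (fps_const c * G)"
    using pr_mult[of "fps_const c" 0 F G] by simp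
  finally show ?thesis .
qed

text \<open>Both sides of the quadratic relation of \<open>x', y'\<close> are written in the form \<open>F(x) + G(x) y\<close>, and coefficients
are compared. In the first conclusion the error \<open>x\<^sup>p\<^sup>' f\<close> comes from \<open>x'\<^sup>p\<^sup>'\<^sup>+\<^sup>1 y'\<close>.\<close>

lemma compare:
  "\<exists>f g. (\<forall>i<t - 1. (V\<^sup>2 * Z) $ i =
            (fps_X ^ p' * f + a ^ n * (fps_const c' + fps_const d' * (fps_X * a) ^ j')) $ i) \<and>
         (\<forall>i<t. (fps_X ^ Suc p * V\<^sup>2) $ i = (fps_X ^ Suc p' * (a ^ Suc p' + fps_X ^ p * g) * V) $ i)"
proof -
  obtain w where w: "W = fps_X ^ (n - 1) * w" using W_low by blast
  define P where "P = pr (fps_X * a) b"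
  let ?Z = "fps_const c' + fps_const d' * (fps_X * a) ^ j'"
  have nn: "n - 1 + (n - 1) = N + (n - 1 - t)" "n - 1 = t + (n - 1 - t)"
    using N t_n by auto
  have Xnn: "fps_X ^ (n - 1) * (fps_X ^ (n - 1) * F) = fps_X ^ N * (fps_X ^ (n - 1 - t) * F)" for F :: "'k fps"
    by (simp only: mult.assoc[symmetric] power_add[symmetric] nn(1))
  have Xn1: "fps_X ^ (n - 1) * F = fps_X ^ t * (fps_X ^ (n - 1 - t) * F)" for F :: "'k fps"
    by (simp only: mult.assoc[symmetric] power_add[symmetric] nn(2)[symmetric])
  have lhs: "y' * y' \<asymp> pr (fps_X ^ n * (V\<^sup>2 * Z)) (fps_X ^ Suc p * V\<^sup>2)"
  proof -
    have "y' * y' \<asymp> pr W V * pr W V" by (intro cg_mult y')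
    also note pr_mult
    also have "pr (W * W + fps_X ^ n * (V * V * Z)) (W * V + W * V + fps_X * (V * V * B))
        \<asymp> pr (fps_X ^ n * (V\<^sup>2 * Z)) (fps_X ^ Suc p * V\<^sup>2)"
    proof (rule pr_cong')
      show "W * W + fps_X ^ n * (V * V * Z)
          = fps_X ^ n * (V\<^sup>2 * Z) + fps_X ^ N * (fps_X ^ (n - 1 - t) * (w * w))"
        unfolding w Xnn[symmetric] power2_eq_square by (simp only: ac_simps)
      show "W * V + W * V + fps_X * (V * V * B)
          = fps_X ^ Suc p * V\<^sup>2 + fps_X ^ t * (fps_X ^ (n - 1 - t) * (w * V + w * V))"
        unfolding w B Xn1[symmetric] power2_eq_square by (simp add: algebra_simps)
    qed
    finally show ?thesis .
  qed
  obtain f g where fg: "P ^ Suc p' * y \<asymp> pr (fps_X ^ (p' + n) * f) (fps_X ^ Suc p' * (a ^ Suc p' + fps_X ^ p * g))"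
    using power_times_y[OF B1 t_n, of a b p'] unfolding P_def by blast
  obtain f' g' where fg': "P ^ Suc p' \<asymp> pr (fps_X ^ Suc p' * a ^ Suc p' + fps_X ^ (p' + n - 1) * f') (fps_X ^ p' * g')"
    using power_of_linear[OF t_n, of a b p'] unfolding P_def by blast
  have 1: "P ^ Suc p' * y * ev V \<asymp> pr (fps_X ^ (p' + n) * (f * V)) (fps_X ^ Suc p' * (a ^ Suc p' + fps_X ^ p * g) * V)"
    using cg_trans[OF cg_mult_r[OF fg, of "ev V"] pr_mult[of _ _ V 0, unfolded pr_ev]]
    by (simp add: ac_simps)
  have 2: "P ^ Suc p' * ev W \<asymp> pr (fps_X ^ (p' + n) * (a ^ Suc p' * w)) 0"
  proof -
    have "P ^ Suc p' * ev W \<asymp> pr (fps_X ^ Suc p' * a ^ Suc p' + fps_X ^ (p' + n - 1) * f') (fps_X ^ p' * g') * pr W 0"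
      using cg_mult_r[OF fg', of "ev W"] by (simp add: pr_ev)
    also note pr_mult
    also have "pr ((fps_X ^ Suc p' * a ^ Suc p' + fps_X ^ (p' + n - 1) * f') * W + fps_X ^ n * (fps_X ^ p' * g' * 0 * Z))
        ((fps_X ^ Suc p' * a ^ Suc p' + fps_X ^ (p' + n - 1) * f') * 0 + W * (fps_X ^ p' * g') + fps_X * (fps_X ^ p' * g' * 0 * B))
       \<asymp> pr (fps_X ^ (p' + n) * (a ^ Suc p' * w)) 0"
    proof (rule pr_cong')
      have pn: "p' + n - 1 = p' + (n - 1)" "p' + n = Suc p' + (n - 1)" using t_n by auto
      show "(fps_X ^ Suc p' * a ^ Suc p' + fps_X ^ (p' + n - 1) * f') * W + fps_X ^ n * (fps_X ^ p' * g' * 0 * Z)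
         = fps_X ^ (p' + n) * (a ^ Suc p' * w) + fps_X ^ N * (fps_X ^ (n - 1 - t) * (fps_X ^ p' * f' * w))"
        unfolding w pn power_add Xnn[symmetric] by (simp add: algebra_simps power_add)
      show "(fps_X ^ Suc p' * a ^ Suc p' + fps_X ^ (p' + n - 1) * f') * 0 + W * (fps_X ^ p' * g') + fps_X * (fps_X ^ p' * g' * 0 * B)
         = 0 + fps_X ^ t * (fps_X ^ (n - 1 - t) * (w * fps_X ^ p' * g'))"
        unfolding w Xn1[symmetric] by (simp add: algebra_simps)
    qed
    finally show ?thesis .
  qed
  have 3: "x' ^ Suc p' * y' \<asymp> pr (fps_X ^ (p' + n) * (f * V + a ^ Suc p' * w)) (fps_X ^ Suc p' * (a ^ Suc p' + fps_X ^ p * g) * V)"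
  proof -
    have "x' ^ Suc p' * y' \<asymp> P ^ Suc p' * pr W V"
      unfolding P_def by (intro cg_mult cg_power x' y')
    also have "P ^ Suc p' * pr W V = P ^ Suc p' * y * ev V + P ^ Suc p' * ev W"
      by (simp add: pr_def[of W] algebra_simps)
    also have "\<dots> \<asymp> pr (fps_X ^ (p' + n) * (f * V)) (fps_X ^ Suc p' * (a ^ Suc p' + fps_X ^ p * g) * V)
        + pr (fps_X ^ (p' + n) * (a ^ Suc p' * w)) 0"
      by (rule cg_add[OF 1 2])
    finally show ?thesis by (simp add: pr_add distrib_left)
  qed
  have 4: "(C c' + C d' * x' ^ j') * x' ^ n \<asymp> pr (fps_X ^ n * (a ^ n * ?Z)) 0"
  proof -
    have "(C c' + C d' * x' ^ j') * x' ^ n = C c' * x' ^ n + C d' * x' ^ (j' + n)"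
      by (simp add: algebra_simps power_add)
    also have "\<dots> \<asymp> C c' * pr (fps_X ^ n * a ^ n) 0 + C d' * pr (fps_X ^ (j' + n) * a ^ (j' + n)) 0"
      by (intro cg_add cg_mult_l high_power) auto
    also have "\<dots> \<asymp> pr (fps_const c' * (fps_X ^ n * a ^ n)) (fps_const c' * 0) +
        pr (fps_const d' * (fps_X ^ (j' + n) * a ^ (j' + n))) (fps_const d' * 0)"
      by (intro cg_add C_times_pr)
    also have "\<dots> = pr (fps_X ^ n * (a ^ n * ?Z)) 0"
      by (simp add: pr_add algebra_simps power_add power_mult_distrib)
    finally show ?thesis .
  qed
  let ?f = "f * V + a ^ Suc p' * w"
  have "pr (fps_X ^ n * (V\<^sup>2 * Z)) (fps_X ^ Suc p * V\<^sup>2) \<asymp> y' * y'" by (rule cg_sym[OF lhs])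
  also note y'_sq
  also have "x' ^ Suc p' * y' + (C c' + C d' * x' ^ j') * x' ^ n \<asymp>
      pr (fps_X ^ (p' + n) * ?f) (fps_X ^ Suc p' * (a ^ Suc p' + fps_X ^ p * g) * V) + pr (fps_X ^ n * (a ^ n * ?Z)) 0"
    by (rule cg_add[OF 3 4])
  finally have "pr (fps_X ^ n * (V\<^sup>2 * Z) - (fps_X ^ (p' + n) * ?f + fps_X ^ n * (a ^ n * ?Z)))
      (fps_X ^ Suc p * V\<^sup>2 - fps_X ^ Suc p' * (a ^ Suc p' + fps_X ^ p * g) * V) \<asymp> 0"
    by (simp add: pr_add flip: pr_diff) (simp add: cg_def)
  also have "fps_X ^ n * (V\<^sup>2 * Z) - (fps_X ^ (p' + n) * ?f + fps_X ^ n * (a ^ n * ?Z))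
      = fps_X ^ n * (V\<^sup>2 * Z - (fps_X ^ p' * ?f + a ^ n * ?Z))"
    by (simp add: algebra_simps power_add)
  finally have eq: "(\<forall>i<N. (fps_X ^ n * (V\<^sup>2 * Z - (fps_X ^ p' * ?f + a ^ n * ?Z))) $ i = 0) \<and>
      (\<forall>i<t. (fps_X ^ Suc p * V\<^sup>2 - fps_X ^ Suc p' * (a ^ Suc p' + fps_X ^ p * g) * V) $ i = 0)"
    by (rule indep)
  have "(V\<^sup>2 * Z) $ i = (fps_X ^ p' * ?f + a ^ n * ?Z) $ i" if "i < t - 1" for i
  proof -
    have "i + n < N" using that N by simp
    with eq have "(fps_X ^ n * (V\<^sup>2 * Z - (fps_X ^ p' * ?f + a ^ n * ?Z))) $ (i + n) = 0" by blast
    then show ?thesis by (simp add: fps_X_power_mult_nth)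
  qed
  moreover have "(fps_X ^ Suc p * V\<^sup>2) $ i = (fps_X ^ Suc p' * (a ^ Suc p' + fps_X ^ p * g) * V) $ i" if "i < t" for i
    using eq that by (simp only: fps_sub_nth) simp
  ultimately show ?thesis by blast
qed

text \<open>In the comparison of the coefficients of \<open>y\<close>, the left-hand side has order exactly \<open>p + 1\<close>, and the right-hand side
has order at least \<open>p' + 1\<close>, with equality for \<open>p > 0\<close>.\<close>

lemma p_eq:
  assumes V: "V $ 0 \<noteq> 0"
  shows "p = p'"
proof -
  obtain f g where g: "\<And>i. i < t \<Longrightarrow>
      (fps_X ^ Suc p * V\<^sup>2) $ i = (fps_X ^ Suc p' * ((a ^ Suc p' + fps_X ^ p * g) * V)) $ i"
    using compare by (auto simp only: mult.assoc)
  consider "p < p'" | "p' < p" | "p = p'" by linarith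
  then show ?thesis
  proof cases
    case 1
    have "(fps_X ^ Suc p * V\<^sup>2) $ Suc p = (fps_X ^ Suc p' * ((a ^ Suc p' + fps_X ^ p * g) * V)) $ Suc p"
      using 1 p by (intro g) simp
    also have "\<dots> = 0" using 1 by (simp only: fps_X_power_mult_nth) simp
    finally have "(fps_X ^ Suc p * V\<^sup>2) $ Suc p = 0" .
    moreover have "(fps_X ^ Suc p * V\<^sup>2) $ Suc p = (V $ 0)\<^sup>2"
      by (simp only: fps_X_power_mult_nth) (simp add: power2_eq_square)
    ultimately show ?thesis using V by simp
  next
    case 2
    have "(fps_X ^ Suc p * V\<^sup>2) $ Suc p' = (fps_X ^ Suc p' * ((a ^ Suc p' + fps_X ^ p * g) * V)) $ Suc p'"
      using 2 p by (intro g) simp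
    then show ?thesis using 2 a V
      by (simp only: fps_X_power_mult_nth) (cases p, simp_all add: fps_X_power_mult_nth fps_nth_power_0)
  qed
qed

text \<open>Comparison of the coefficients of \<open>y\<close> gives \<open>V = a\<^sup>p\<^sup>+\<^sup>1\<close> up to order \<open>t - 1 - p\<close>, hence \<open>V\<^sup>2 = a\<^sup>n\<close>, and this
factor cancels from the comparison of the other coefficients. Since \<open>t < n = 2 (p + 1)\<close>, the error of
order \<open>p\<close> lies beyond this range.\<close>

lemma Z_eq:
  assumes V: "V $ 0 \<noteq> 0" and n: "n = 2 * Suc p" and i: "i < t - 1 - p"
  shows "Z $ i = (fps_const c' + fps_const d' * (fps_X * a) ^ j') $ i"
proof -
  define D where "D = (fps_X :: 'k fps) ^ (t - 1 - p)"
  have D: "D dvd F" if "\<And>i. i < t - 1 - p \<Longrightarrow> F $ i = 0" for F :: "'k fps"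
    unfolding D_def dvd_def by (rule fps_factor) (rule that)
  have Dp: "D dvd fps_X ^ p * F" for F
    using n t_n unfolding D_def by (intro dvd_mult2 le_imp_power_dvd) simp
  have cancel: "D dvd F" if "D dvd G * F" "G $ 0 \<noteq> 0" for F G
  proof -
    have "F = inverse G * (G * F)"
      using inverse_mult_eq_1[OF that(2)] by (simp flip: mult.assoc)
    then show ?thesis using that(1) by (metis dvd_mult)
  qed
  let ?Z = "fps_const c' + fps_const d' * (fps_X * a) ^ j'"
  obtain f g where f: "\<And>i. i < t - 1 \<Longrightarrow> (V\<^sup>2 * Z) $ i = (fps_X ^ p' * f + a ^ n * ?Z) $ i"
    and g: "\<And>i. i < t \<Longrightarrow> (fps_X ^ Suc p * V\<^sup>2) $ i = (fps_X ^ Suc p' * (a ^ Suc p' + fps_X ^ p * g) * V) $ i"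
    using compare by blast
  have 1: "D dvd V\<^sup>2 * Z - (fps_X ^ p * f + a ^ n * ?Z)"
    by (rule D) (use f p_eq[OF V] in simp)
  have 2: "D dvd V\<^sup>2 - (a ^ Suc p + fps_X ^ p * g) * V"
  proof (rule D)
    fix i assume "i < t - 1 - p"
    then have "i + Suc p < t" by simp
    from g[OF this] show "(V\<^sup>2 - (a ^ Suc p + fps_X ^ p * g) * V) $ i = 0"
      unfolding p_eq[OF V, symmetric] mult.assoc by (simp only: fps_X_power_mult_nth) simp
  qed
  have "V\<^sup>2 - (a ^ Suc p + fps_X ^ p * g) * V = V * (V - a ^ Suc p) - fps_X ^ p * (g * V)"
    by (simp add: power2_eq_square algebra_simps)
  with 2 Dp[of "g * V"] have "D dvd V * (V - a ^ Suc p)"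
    by (metis diff_add_cancel dvd_add)
  then have 3: "D dvd V - a ^ Suc p" using V by (rule cancel)
  have "a ^ n = a ^ Suc p * a ^ Suc p"
    unfolding n by (simp only: mult_2 power_add)
  then have "a ^ n * (Z - ?Z) = (V\<^sup>2 * Z - (fps_X ^ p * f + a ^ n * ?Z)) + fps_X ^ p * f
      - (V - a ^ Suc p) * ((V + a ^ Suc p) * Z)"
    by (simp add: power2_eq_square algebra_simps)
  then have "D dvd a ^ n * (Z - ?Z)"
    using 1 Dp[of f] 3 by (simp only: dvd_add dvd_diff dvd_mult2)
  then have "D dvd Z - ?Z" by (rule cancel) (use a in \<open>simp add: fps_nth_power_0\<close>)
  then obtain H where "Z - ?Z = D * H" by (rule dvdE)
  then have "(Z - ?Z) $ i = 0" unfolding D_def using i by (simp only: fps_X_power_mult_nth) simp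
  then show ?thesis by simp
qed

end

section \<open>Powers of the maximal ideal and dimensions of subquotients\<close>

context alg_mod
begin

definition lin :: "'r set \<Rightarrow> bool" where
  "lin P \<longleftrightarrow> 0 \<in> P \<and> (\<forall>f\<in>P. \<forall>g\<in>P. f + g \<in> P) \<and> (\<forall>f\<in>P. \<forall>c. C c * f \<in> P)"

lemma idl_lin: "idl J \<Longrightarrow> lin J"
  by (auto simp: lin_def idl_def)

lemma lin_0: "lin P \<Longrightarrow> 0 \<in> P"
  and lin_add: "lin P \<Longrightarrow> f \<in> P \<Longrightarrow> g \<in> P \<Longrightarrow> f + g \<in> P"
  and lin_scale: "lin P \<Longrightarrow> f \<in> P \<Longrightarrow> C c * f \<in> P"
  by (simp_all add: lin_def)

lemma lin_minus: "lin P \<Longrightarrow> f \<in> P \<Longrightarrow> - f \<in> P"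
  using lin_scale[of P f "-1"] by (simp add: C_minus)

lemma lin_diff: "lin P \<Longrightarrow> f \<in> P \<Longrightarrow> g \<in> P \<Longrightarrow> f - g \<in> P"
  using lin_add[of P f "- g"] lin_minus[of P g] by simp

definition lspan :: "'r set \<Rightarrow> 'r set \<Rightarrow> 'r set" where
  "lspan Q S = \<Inter>{P. lin P \<and> Q \<subseteq> P \<and> S \<subseteq> P}"

lemma lspan_lin: "lin (lspan Q S)"
  unfolding lspan_def lin_def by blast

lemma lspan_superset: "Q \<subseteq> lspan Q S" "S \<subseteq> lspan Q S"
  unfolding lspan_def by blast+

lemma lspan_least: "lin P \<Longrightarrow> Q \<subseteq> P \<Longrightarrow> S \<subseteq> P \<Longrightarrow> lspan Q S \<subseteq> P"
  unfolding lspan_def by blast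

lemma lspan_mono: "S \<subseteq> lspan Q S' \<Longrightarrow> lspan Q S \<subseteq> lspan Q S'"
  by (rule lspan_least) (auto simp: lspan_lin lspan_superset)

lemma lspan_empty: "lin Q \<Longrightarrow> lspan Q {} = Q"
  using lspan_least[of Q Q "{}"] lspan_superset[of Q "{}"] by blast

lemma lin_line:
  assumes "lin Q"
  shows "lin {f. \<exists>c. f - C c * u \<in> Q}" (is "lin ?L")
  unfolding lin_def
proof (intro conjI ballI allI)
  have "0 - C 0 * u \<in> Q" using lin_0[OF assms] by simp
  then show "0 \<in> ?L" by blast
next
  fix f g assume "f \<in> ?L" "g \<in> ?L"
  then obtain c d where cd: "f - C c * u \<in> Q" "g - C d * u \<in> Q" by blast
  have "f + g - C (c + d) * u = (f - C c * u) + (g - C d * u)" by (simp add: C_add algebra_simps)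
  then have "f + g - C (c + d) * u \<in> Q" using lin_add[OF assms cd] by (simp only:)
  then show "f + g \<in> ?L" by blast
next
  fix f a assume "f \<in> ?L"
  then obtain c where c: "f - C c * u \<in> Q" by blast
  have "C a * f - C (a * c) * u = C a * (f - C c * u)" by (simp add: C_mult algebra_simps)
  then have "C a * f - C (a * c) * u \<in> Q" using lin_scale[OF assms c] by (simp only:)
  then show "C a * f \<in> ?L" by blast
qed

lemma lspan_insert:
  assumes "f \<in> lspan Q (insert u S)"
  shows "\<exists>c. f - C c * u \<in> lspan Q S"
proof -
  let ?L = "{f. \<exists>c. f - C c * u \<in> lspan Q S}"
  have sub: "lspan Q S \<subseteq> ?L"
  proof
    fix g assume "g \<in> lspan Q S"
    then have "g - C 0 * u \<in> lspan Q S" by simp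
    then show "g \<in> ?L" by blast
  qed
  have "u - C 1 * u \<in> lspan Q S" using lin_0[OF lspan_lin] by simp
  then have "u \<in> ?L" by blast
  then have "lspan Q (insert u S) \<subseteq> ?L"
    using sub lspan_superset(1)[of Q S] lspan_superset(2)[of S Q] by (intro lspan_least lin_line lspan_lin) auto
  then show ?thesis using assms by blast
qed

fun indep :: "'r set \<Rightarrow> 'r list \<Rightarrow> bool" where
  "indep Q [] = True"
| "indep Q (u # us) = (u \<notin> lspan Q (set us) \<and> indep Q us)"

text \<open>\<open>qdim P Q d\<close> captures that \<open>P / Q\<close> has dimension \<open>d\<close> in the form in which it is used:
  independent families extend to spanning families of length \<open>d\<close>, and no spanning family is shorter.\<close>

definition qdim :: "'r set \<Rightarrow> 'r set \<Rightarrow> nat \<Rightarrow> bool" where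
  "qdim P Q d \<longleftrightarrow>
     (\<forall>us. set us \<subseteq> P \<longrightarrow> indep Q us \<longrightarrow>
        (\<exists>vs. set vs \<subseteq> P \<and> length (vs @ us) = d \<and> P \<subseteq> lspan Q (set (vs @ us)))) \<and>
     (\<forall>us. set us \<subseteq> P \<longrightarrow> P \<subseteq> lspan Q (set us) \<longrightarrow> d \<le> length us)"

lemma qdim_extend:
  assumes "qdim P Q d" "set us \<subseteq> P" "indep Q us"
  obtains vs where "set vs \<subseteq> P" "length vs + length us = d" "P \<subseteq> lspan Q (set vs \<union> set us)"
  using assms unfolding qdim_def by (metis length_append set_append)

lemma qdim_le: "qdim P Q d \<Longrightarrow> set us \<subseteq> P \<Longrightarrow> P \<subseteq> lspan Q (set us) \<Longrightarrow> d \<le> length us"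
  unfolding qdim_def by blast

lemma qdim_1_spans:
  assumes "qdim P Q 1" "lin Q" "u \<in> P" "u \<notin> Q" "f \<in> P"
  shows "\<exists>c. f - C c * u \<in> Q"
proof -
  obtain vs where "length vs + length [u] = 1" and P: "P \<subseteq> lspan Q (set vs \<union> set [u])"
    by (rule qdim_extend[OF assms(1), of "[u]"]) (use assms in \<open>auto simp: lspan_empty\<close>)
  then have "P \<subseteq> lspan Q {u}" by simp
  then show ?thesis using assms(5) lspan_insert[of f Q u "{}"] lspan_empty[OF assms(2)] by auto
qed

lemma qdim_2_spans:
  assumes "qdim P Q 2" "lin Q" "u \<in> P" "v \<in> P" "u \<notin> Q" "\<And>c. v - C c * u \<notin> Q" "f \<in> P"
  shows "\<exists>c d. f - C c * u - C d * v \<in> Q"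
proof -
  have "v \<notin> lspan Q {u}"
    using assms(6) lspan_insert[of v Q u "{}"] lspan_empty[OF assms(2)] by auto
  then have "indep Q [v, u]" using assms(5) by (simp add: lspan_empty[OF assms(2)])
  then obtain vs where "length vs + length [v, u] = 2" and P: "P \<subseteq> lspan Q (set vs \<union> set [v, u])"
    by (rule qdim_extend[OF assms(1), of "[v, u]", rotated]) (use assms in auto)
  then have "f \<in> lspan Q (insert u {v})" using assms(7) by (auto simp: insert_commute)
  then obtain c where "f - C c * u \<in> lspan Q (insert v {})" using lspan_insert by blast
  then show ?thesis using lspan_insert lspan_empty[OF assms(2)] by blast
qed

lemma qdim_2_not_line:
  assumes "qdim P Q 2" "lin Q" "u \<in> P"
  shows "\<exists>f\<in>P. \<forall>c. f - C c * u \<notin> Q"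
proof (rule ccontr)
  assume "\<not> ?thesis"
  then have *: "\<exists>c. f - C c * u \<in> Q" if "f \<in> P" for f using that by blast
  have "P \<subseteq> lspan Q (set [u])"
  proof
    fix f assume "f \<in> P"
    then obtain c where "f - C c * u \<in> Q" using * by blast
    then have "(f - C c * u) + C c * u \<in> lspan Q {u}"
      by (intro lin_add[OF lspan_lin] lin_scale[OF lspan_lin]) (use lspan_superset in blast)+
    then show "f \<in> lspan Q (set [u])" by simp
  qed
  then show False using qdim_le[OF assms(1), of "[u]"] assms(3) by simp
qed

text \<open>Along a line, such a family is given by a non-zero polynomial in the parameter.\<close>

lemma finite_vanishing:
  assumes "\<And>i. i \<le> n \<Longrightarrow> \<exists>l. a i \<asymp> C l * w" "w \<notin> I" "j \<le> n" "a j \<notin> I"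
  shows "finite {c. (\<Sum>i\<le>n. C c ^ i * a i) \<in> I}"
proof -
  obtain l where l: "\<And>i. i \<le> n \<Longrightarrow> a i \<asymp> C (l i) * w" using assms(1) by metis
  have "l j \<noteq> 0"
  proof
    assume "l j = 0"
    then have "a j \<asymp> 0" using l[OF assms(3)] by simp
    then show False using assms(4) by (simp add: cg_0_iff)
  qed
  define q where "q = (\<Sum>i\<le>n. Polynomial.monom (l i) i)"
  have "poly.coeff q j = l j"
    using assms(3) by (simp add: q_def coeff_sum)
  then have "q \<noteq> 0" using \<open>l j \<noteq> 0\<close> by auto
  then have "finite {c. poly q c = 0}" by (rule poly_roots_finite)
  moreover have "{c. (\<Sum>i\<le>n. C c ^ i * a i) \<in> I} \<subseteq> {c. poly q c = 0}"
  proof clarify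
    fix c assume c: "(\<Sum>i\<le>n. C c ^ i * a i) \<in> I"
    have "(\<Sum>i\<le>n. C c ^ i * a i) \<asymp> (\<Sum>i\<le>n. C c ^ i * (C (l i) * w))"
      by (intro cg_sum cg_mult_l l) simp
    also have "\<dots> = (\<Sum>i\<le>n. C (l i) * C c ^ i) * w"
      by (simp add: sum_distrib_left ac_simps)
    also have "\<dots> = C (poly q c) * w"
      by (simp add: q_def poly_sum poly_monom C_sum C_mult C_power)
    finally have "C (poly q c) * w \<in> I" using c cg_in_I by blast
    then show "poly q c = 0" using assms(2) C_mult_in_I_iff by blast
  qed
  ultimately show ?thesis by (rule rev_finite_subset)
qed

lemma idl_principal: "idl {f. \<exists>g. f \<asymp> x * g}" (is "idl ?J")
proof (rule idlI)
  have "0 \<asymp> x * 0" by simp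
  then show "0 \<in> ?J" by blast
  fix f g assume "f \<in> ?J"
  then obtain u where u: "f \<asymp> x * u" by blast
  have "g * f \<asymp> x * (g * u)" using cg_mult_l[OF u, of g] by (simp add: mult.left_commute)
  then show "g * f \<in> ?J" by blast
  assume "g \<in> ?J"
  then obtain v where v: "g \<asymp> x * v" by blast
  have "f + g \<asymp> x * (u + v)" using cg_add[OF u v] by (simp add: distrib_left)
  then show "f + g \<in> ?J" by blast
qed

lemma idl_two: "idl {f. \<exists>u v. f \<asymp> w * (u * x + v * y)}" (is "idl ?J")
proof (rule idlI)
  have "0 \<asymp> w * (0 * x + 0 * y)" by simp
  then show "0 \<in> ?J" by blast
  fix f g assume "f \<in> ?J"
  then obtain u v where u: "f \<asymp> w * (u * x + v * y)" by blast
  have "g * f \<asymp> w * (g * u * x + g * v * y)" using cg_mult_l[OF u, of g] by (simp add: algebra_simps)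
  then show "g * f \<in> ?J" by blast
  assume "g \<in> ?J"
  then obtain u' v' where v: "g \<asymp> w * (u' * x + v' * y)" by blast
  have "f + g \<asymp> w * ((u + u') * x + (v + v') * y)" using cg_add[OF u v] by (simp add: algebra_simps)
  then show "f + g \<in> ?J" by blast
qed

lemma I_idl_principal: "I \<subseteq> {f. \<exists>g. f \<asymp> x * g}"
proof
  fix f assume "f \<in> I"
  then have "f \<asymp> x * 0" by (simp add: cg_0_iff)
  then show "f \<in> {f. \<exists>g. f \<asymp> x * g}" by blast
qed

lemma I_idl_two: "I \<subseteq> {f. \<exists>u v. f \<asymp> w * (u * x + v * y)}"
proof
  fix f assume "f \<in> I"
  then have "f \<asymp> w * (0 * x + 0 * y)" by (simp add: cg_0_iff)
  then show "f \<in> {f. \<exists>u v. f \<asymp> w * (u * x + v * y)}" by blast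
qed

end

text \<open>\<open>M\<close> is the preimage of a maximal ideal with residue field \<open>'k\<close>, and \<open>mp j\<close> below is the preimage of its
\<open>j\<close>-th power.\<close>

locale local_alg = alg_mod C I for C :: "'k::field_char_0 \<Rightarrow> 'r::comm_ring_1" and I +
  fixes M :: "'r set"
  assumes M_idl: "idl M" and I_M: "I \<subseteq> M" and one_M: "1 \<notin> M"
    and decomp: "\<exists>c. f - C c \<in> M"
begin

primrec mp :: "nat \<Rightarrow> 'r set" where
  "mp 0 = UNIV"
| "mp (Suc j) = \<Inter>{J. idl J \<and> I \<subseteq> J \<and> (\<forall>a\<in>M. \<forall>b\<in>mp j. a * b \<in> J)}"

lemma mp_least: "idl J \<Longrightarrow> I \<subseteq> J \<Longrightarrow> (\<And>a b. a \<in> M \<Longrightarrow> b \<in> mp j \<Longrightarrow> a * b \<in> J) \<Longrightarrow> mp (Suc j) \<subseteq> J"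
  by auto

lemma mp_prod: "a \<in> M \<Longrightarrow> b \<in> mp j \<Longrightarrow> a * b \<in> mp (Suc j)"
  by auto

lemma mp_idl: "idl (mp j)"
  by (cases j) (auto simp: idl_def)

lemma mp_lin: "lin (mp j)"
  by (rule idl_lin[OF mp_idl])

lemma I_mp: "I \<subseteq> mp j"
  by (cases j) auto

declare mp.simps(2) [simp del]

lemma mp_Suc_subset: "mp (Suc j) \<subseteq> mp j"
  by (rule mp_least) (auto simp: mp_idl I_mp intro: idl_mult[OF mp_idl] dest: subsetD[OF I_mp])

lemma mp_antimono: "i \<le> j \<Longrightarrow> mp j \<subseteq> mp i"
  by (rule lift_Suc_antimono_le[of mp]) (use mp_Suc_subset in auto)

lemma mp_1: "mp (Suc 0) = M"
proof
  show "mp (Suc 0) \<subseteq> M"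
    by (rule mp_least) (auto simp: M_idl I_M intro: idl_mult2[OF M_idl] dest: subsetD[OF I_M])
  show "M \<subseteq> mp (Suc 0)"
    using mp_prod[of _ 1 0] by auto
qed

lemma mp_Suc_M: "mp (Suc j) \<subseteq> M"
  using mp_antimono[of "Suc 0" "Suc j"] by (simp only: mp_1)

lemma mp_2_M: "mp 2 \<subseteq> M"
  using mp_Suc_M[of "Suc 0"] by (simp only: numeral_2_eq_2)

lemma mp_mult: "a \<in> mp i \<Longrightarrow> b \<in> mp j \<Longrightarrow> a * b \<in> mp (i + j)"
proof (induction i arbitrary: a)
  case 0
  then show ?case using idl_mult[OF mp_idl, of b j a] by simp
next
  case (Suc i)
  have "idl {f. f * b \<in> mp (Suc i + j)}"
  proof (rule idlI)
    show "0 \<in> {f. f * b \<in> mp (Suc i + j)}" using idl_0[OF mp_idl] by simp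
    show "f + g \<in> {f. f * b \<in> mp (Suc i + j)}"
      if "f \<in> {f. f * b \<in> mp (Suc i + j)}" "g \<in> {f. f * b \<in> mp (Suc i + j)}" for f g
      using that idl_add[OF mp_idl] by (simp only: mem_Collect_eq distrib_right)
    show "g * f \<in> {f. f * b \<in> mp (Suc i + j)}" if "f \<in> {f. f * b \<in> mp (Suc i + j)}" for f g
      using that idl_mult[OF mp_idl] by (simp only: mem_Collect_eq mult.assoc)
  qed
  then have "mp (Suc i) \<subseteq> {f. f * b \<in> mp (Suc i + j)}"
  proof (rule mp_least)
    show "I \<subseteq> {f. f * b \<in> mp (Suc i + j)}" using I_mp I_mult2 by blast
    fix u v assume "u \<in> M" "v \<in> mp i"
    then have "u * (v * b) \<in> mp (Suc (i + j))" by (intro mp_prod Suc)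
    then show "u * v \<in> {f. f * b \<in> mp (Suc i + j)}" by (simp only: mem_Collect_eq mult.assoc add_Suc)
  qed
  then show ?case using Suc.prems(1) by blast
qed

lemma M_mult: "a \<in> M \<Longrightarrow> b \<in> M \<Longrightarrow> a * b \<in> mp 2"
  using mp_mult[of a 1 b 1] by (simp only: mp_1 One_nat_def) (simp add: numeral_2_eq_2)

lemma M_power: "x \<in> M \<Longrightarrow> x ^ j \<in> mp j"
  by (induction j) (simp_all add: mp_prod del: mp.simps(2))

lemma mp_cg: "f \<asymp> g \<Longrightarrow> g \<in> mp j \<Longrightarrow> f \<in> mp j"
  by (rule cg_idl[OF mp_idl I_mp])

lemma M_add: "a \<in> M \<Longrightarrow> b \<in> M \<Longrightarrow> a + b \<in> M"
  by (rule idl_add[OF M_idl])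

lemma M_scale: "a \<in> M \<Longrightarrow> g * a \<in> M"
  by (rule idl_mult[OF M_idl])

lemma mp_add_least:
  assumes "idl J" "I \<subseteq> J" "\<And>a b. a \<in> mp i \<Longrightarrow> b \<in> mp k \<Longrightarrow> a * b \<in> J"
  shows "mp (i + k) \<subseteq> J"
  using assms
proof (induction i arbitrary: J)
  case 0
  then show ?case using 0(3)[of 1] by auto
next
  case (Suc i)
  have "u * v \<in> J" if u: "u \<in> M" and v: "v \<in> mp (i + k)" for u v
  proof -
    have "mp (i + k) \<subseteq> {v. u * v \<in> J}"
    proof (rule Suc.IH)
      show "idl {v. u * v \<in> J}"
        using idl_0[OF Suc.prems(1)] idl_add[OF Suc.prems(1)] idl_mult[OF Suc.prems(1)]
        by (intro idlI) (auto simp: distrib_left mult.left_commute)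
      show "I \<subseteq> {v. u * v \<in> J}" using Suc.prems(2) I_mult by auto
      fix a b assume "a \<in> mp i" "b \<in> mp k"
      then have "(u * a) * b \<in> J" using mp_prod[OF u] by (intro Suc.prems(3))
      then show "a * b \<in> {v. u * v \<in> J}" by (simp add: mult.assoc)
    qed
    then show ?thesis using v by blast
  qed
  then show ?case using mp_least[OF Suc.prems(1,2)] by simp
qed

end

section \<open>Almost stretched Gorenstein algebras\<close>

text \<open>An almost stretched Gorenstein algebra of type \<open>(s, t)\<close>, reduced to the vanishing of \<open>\<mm>\<^sup>s\<^sup>+\<^sup>1\<close>, the values of
the Hilbert function, and the dimension of the socle.\<close>

locale asg = local_alg C I M
  for C :: "'k::{alg_closed_field, field_char_0} \<Rightarrow> 'r::comm_ring_1" and I M +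
  fixes h s t :: nat
  assumes h: "2 \<le> h" and t: "2 \<le> t" and st: "2 * t \<le> s"
    and nil: "mp (Suc s) \<subseteq> I"
    and dim_1: "qdim (mp 1) (mp 2) h"
    and dim_low: "2 \<le> j \<Longrightarrow> j \<le> t \<Longrightarrow> qdim (mp j) (mp (Suc j)) 2"
    and dim_high: "t + 1 \<le> j \<Longrightarrow> j \<le> s \<Longrightarrow> qdim (mp j) (mp (Suc j)) 1"
    and dim_socle: "qdim {f. \<forall>g\<in>M. g * f \<in> I} I 1"
begin

definition n :: nat where "n = Suc s - t"

lemma n_t: "n + t = Suc s" "t < n"
  using st by (auto simp: n_def)

lemma mp_top: "mp (Suc s) = I"
  using nil I_mp by blast

lemma mp_above: "Suc s \<le> j \<Longrightarrow> mp j = I"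
  using mp_antimono[of "Suc s" j] nil I_mp by blast

lemma I_lin: "lin I"
  by (rule idl_lin[OF I_idl])

lemma dim_top: "qdim (mp s) I 1"
  using dim_high[of s] st t by (simp add: mp_top)

lemma nil_elt: "x \<in> M \<Longrightarrow> nil_elt C I x (Suc s)"
  using M_power[of x "Suc s"] mp_top by (unfold_locales) auto

text \<open>The coefficients of the powers of \<open>c\<close> lie in the line \<open>\<mm>\<^sup>s\<close>, and the one with index \<open>i\<close> is non-zero
because binomial coefficients are invertible.\<close>

lemma power_family:
  assumes "x \<in> M" "y \<in> M" "m \<le> s" "w \<in> mp (s - m)" "i \<le> m" "y ^ i * x ^ (m - i) * w \<notin> I"
  shows "finite {c. (x + C c * y) ^ m * w \<in> I}"
proof -
  define a where "a = (\<lambda>i. of_nat (m choose i) * (y ^ i * x ^ (m - i) * w))"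
  have eq: "(x + C c * y) ^ m * w = (\<Sum>i\<le>m. C c ^ i * a i)" for c
  proof -
    have "(x + C c * y) ^ m = (\<Sum>i\<le>m. of_nat (m choose i) * (C c * y) ^ i * x ^ (m - i))"
      using binomial_ring[of "C c * y" x m] by (simp add: add.commute)
    then show ?thesis
      by (simp add: a_def power_mult_distrib sum_distrib_left sum_distrib_right ac_simps)
  qed
  have mem: "y ^ j * x ^ (m - j) * w \<in> mp s" if "j \<le> m" for j
  proof -
    have "y ^ j * x ^ (m - j) * w \<in> mp ((j + (m - j)) + (s - m))"
      by (intro mp_mult M_power assms)
    then show ?thesis using that assms(3) by simp
  qed
  have "\<exists>l. a j \<asymp> C l * (y ^ i * x ^ (m - i) * w)" if "j \<le> m" for j
  proof -
    have "a j \<in> mp s" unfolding a_def by (rule idl_mult[OF mp_idl mem[OF that]])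
    then show ?thesis
      using qdim_1_spans[OF dim_top I_lin mem[OF assms(5)] assms(6)] by (auto simp: cg_def)
  qed
  moreover have "a i \<notin> I"
    using assms(5,6) C_mult_in_I_iff[of "of_nat (m choose i)" "y ^ i * x ^ (m - i) * w"]
    by (simp add: a_def C_of_nat)
  ultimately have "finite {c. (\<Sum>j\<le>m. C c ^ j * a j) \<in> I}"
    using assms(5,6) by (intro finite_vanishing[of m a "y ^ i * x ^ (m - i) * w" i]) auto
  then show ?thesis by (simp add: eq)
qed

text \<open>Starting from a non-zero product of \<open>s\<close> elements of the maximal ideal, the factors are replaced one after
the other by a power of a general element.\<close>

lemma exists_power: "\<exists>x\<in>M. x ^ s \<notin> I"
proof -
  have "\<exists>x\<in>M. \<exists>w\<in>mp (s - k). x ^ k * w \<notin> I" if "k \<le> s" for k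
    using that
  proof (induction k)
    case 0
    have "\<not> mp s \<subseteq> I"
    proof
      assume "mp s \<subseteq> I"
      then have "mp s \<subseteq> lspan I (set [])" by (simp add: lspan_empty I_lin)
      then show False using qdim_le[OF dim_top, of "[]"] by simp
    qed
    then obtain w where "w \<in> mp s" "w \<notin> I" by blast
    moreover have "0 \<in> M" using idl_0[OF M_idl] .
    ultimately show ?case by (intro bexI[of _ 0] bexI[of _ w]) auto
  next
    case (Suc k)
    then obtain x w where xw: "x \<in> M" "w \<in> mp (s - k)" "x ^ k * w \<notin> I" by auto
    have sk: "s - k = Suc (s - Suc k)" using Suc.prems by simp
    have "\<exists>y\<in>M. \<exists>v\<in>mp (s - Suc k). x ^ k * (y * v) \<notin> I"
    proof (rule ccontr)
      assume *: "\<not> ?thesis"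
      have "idl {f. x ^ k * f \<in> I}"
      proof (rule idlI)
        show "0 \<in> {f. x ^ k * f \<in> I}" using I_0 by simp
        show "f + g \<in> {f. x ^ k * f \<in> I}" if "f \<in> {f. x ^ k * f \<in> I}" "g \<in> {f. x ^ k * f \<in> I}" for f g
          using that I_add by (simp only: mem_Collect_eq distrib_left)
        show "g * f \<in> {f. x ^ k * f \<in> I}" if "f \<in> {f. x ^ k * f \<in> I}" for f g
          using that I_mult by (simp only: mem_Collect_eq mult.left_commute)
      qed
      then have "mp (Suc (s - Suc k)) \<subseteq> {f. x ^ k * f \<in> I}"
        by (rule mp_least) (use * I_mult in auto)
      then show False using xw sk by auto
    qed
    then obtain y v where y: "y \<in> M" and v: "v \<in> mp (s - Suc k)" and yv: "x ^ k * (y * v) \<notin> I" by blast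
    have "finite {c. (x + C c * y) ^ Suc k * v \<in> I}"
      using xw(1) y Suc.prems v by (rule power_family[of _ _ _ _ 1]) (use yv in \<open>auto simp: ac_simps\<close>)
    then have "\<exists>c. c \<notin> {c. (x + C c * y) ^ Suc k * v \<in> I}"
      using ex_new_if_finite[OF infinite_UNIV_char_0] by blast
    then obtain c where "(x + C c * y) ^ Suc k * v \<notin> I" by blast
    then show ?case using M_add[OF xw(1) M_scale[OF y]] v by blast
  qed
  from this[of s] show ?thesis using I_mult2 by auto
qed

lemma power_not_in_next: "x \<in> M \<Longrightarrow> x ^ s \<notin> I \<Longrightarrow> j \<le> s \<Longrightarrow> x ^ j \<notin> mp (Suc j)"
proof
  assume x: "x \<in> M" "x ^ s \<notin> I" "j \<le> s" "x ^ j \<in> mp (Suc j)"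
  then have "x ^ (s - j) * x ^ j \<in> mp ((s - j) + Suc j)" by (intro mp_mult M_power)
  then show False using x(2,3) nil by (auto simp flip: power_add)
qed

text \<open>By polarisation, squares span \<open>\<mm>\<^sup>2\<close> modulo \<open>\<mm>\<^sup>3\<close>, so some \<open>x0\<^sup>2, y\<^sup>2\<close> form a basis there. For general \<open>c\<close> the elements
\<open>x\<^sup>2, x y\<close> with \<open>x = x0 + c y\<close> form a basis as well, and \<open>x\<^sup>s \<noteq> 0\<close> persists.\<close>

lemma exists_good_pair:
  "\<exists>x\<in>M. \<exists>y\<in>M. x ^ s \<notin> I \<and> (\<forall>f\<in>mp 2. \<exists>a b. f - C a * (x * x) - C b * (x * y) \<in> mp 3)"
proof -
  obtain x0 where x0: "x0 \<in> M" "x0 ^ s \<notin> I" using exists_power by blast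
  have s3: "2 \<le> s" using st t by simp
  have dim: "qdim (mp 2) (mp 3) 2" using dim_low[of 2] t by (simp add: numeral_3_eq_3 numeral_2_eq_2)
  have x0sq: "x0 * x0 \<in> mp 2" by (rule M_mult[OF x0(1) x0(1)])
  have x0n: "x0 * x0 \<notin> mp 3"
    using power_not_in_next[OF x0 s3] by (simp add: power2_eq_square numeral_3_eq_3 numeral_2_eq_2)
  have "\<exists>y\<in>M. \<forall>c. y * y - C c * (x0 * x0) \<notin> mp 3"
  proof (rule ccontr)
    assume "\<not> ?thesis"
    then have sq: "\<exists>c. y * y - C c * (x0 * x0) \<in> mp 3" if "y \<in> M" for y using that by blast
    let ?L = "{f. \<exists>c. f - C c * (x0 * x0) \<in> mp 3}"
    have lin: "lin ?L" by (rule lin_line[OF mp_lin])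
    have prod: "u * v \<in> ?L" if "u \<in> M" "v \<in> M" for u v
    proof -
      have "(u + v) * (u + v) \<in> ?L" "u * u \<in> ?L" "v * v \<in> ?L"
        using sq M_add that by blast+
      then have "(u + v) * (u + v) - u * u - v * v \<in> ?L" by (intro lin_diff[OF lin])
      then have "C (1 / 2) * ((u + v) * (u + v) - u * u - v * v) \<in> ?L" by (rule lin_scale[OF lin])
      also have "(u + v) * (u + v) - u * u - v * v = C 2 * (u * v)"
        by (simp add: C_2 algebra_simps)
      also have "C (1 / 2) * (C 2 * (u * v)) = u * v" by (simp flip: mult.assoc C_mult)
      finally show ?thesis .
    qed
    have idl: "idl ?L"
    proof (rule idlI)
      fix f g assume "f \<in> ?L"
      then obtain c where c: "f - C c * (x0 * x0) \<in> mp 3" by blast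
      obtain d where d: "g - C d \<in> M" using decomp by blast
      have "(g - C d) * (x0 * x0) \<in> mp (Suc 2)" using d x0sq by (rule mp_prod)
      then have "(g - C d) * (x0 * x0) \<in> mp 3" by simp
      then have "C c * ((g - C d) * (x0 * x0)) \<in> mp 3" by (rule idl_mult[OF mp_idl])
      moreover have "g * (f - C c * (x0 * x0)) \<in> mp 3" by (rule idl_mult[OF mp_idl c])
      ultimately have "g * (f - C c * (x0 * x0)) + C c * ((g - C d) * (x0 * x0)) \<in> mp 3"
        by (rule idl_add[OF mp_idl, rotated])
      also have "g * (f - C c * (x0 * x0)) + C c * ((g - C d) * (x0 * x0)) = g * f - C (c * d) * (x0 * x0)"
        by (simp add: C_mult algebra_simps)
      finally show "g * f \<in> ?L" by blast
    qed (use lin in \<open>auto simp: lin_def\<close>)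
    have "mp (Suc (Suc 0)) \<subseteq> ?L"
    proof (rule mp_least[OF idl])
      show "I \<subseteq> ?L"
      proof
        fix f assume "f \<in> I"
        then have "f - C 0 * (x0 * x0) \<in> mp 3" using I_mp by auto
        then show "f \<in> ?L" by blast
      qed
    qed (use prod mp_1 in auto)
    then have "mp 2 \<subseteq> ?L" by (simp only: numeral_2_eq_2)
    then show False using qdim_2_not_line[OF dim mp_lin x0sq] by blast
  qed
  then obtain y where y: "y \<in> M" and y2: "\<And>c. y * y - C c * (x0 * x0) \<notin> mp 3" by blast
  have span: "\<exists>a b. f - C a * (x0 * x0) - C b * (y * y) \<in> mp 3" if "f \<in> mp 2" for f
    by (rule qdim_2_spans[OF dim mp_lin x0sq M_mult[OF y y] x0n y2 that])
  obtain \<alpha> \<beta> where ab: "x0 * y - C \<alpha> * (x0 * x0) - C \<beta> * (y * y) \<in> mp 3"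
    using span[OF M_mult[OF x0(1) y]] by blast
  define q where "q = [:\<beta>, 1, \<alpha>:]"
  have "finite {c. poly q c = 0}" unfolding q_def by (rule poly_roots_finite) simp
  moreover have "finite {c. (x0 + C c * y) ^ s * 1 \<in> I}"
    by (rule power_family[OF x0(1) y, of s 1 0]) (use x0(2) in auto)
  ultimately obtain c where c: "poly q c \<noteq> 0" "(x0 + C c * y) ^ s \<notin> I"
    using ex_new_if_finite[OF infinite_UNIV_char_0, of "{c. poly q c = 0} \<union> {c. (x0 + C c * y) ^ s * 1 \<in> I}"]
    by auto
  define D where "D = \<beta> + c + \<alpha> * c * c"
  have D: "D \<noteq> 0" using c(1) by (simp add: q_def D_def algebra_simps)
  define x where "x = x0 + C c * y"
  have x: "x \<in> M" unfolding x_def by (rule M_add[OF x0(1) M_scale[OF y]])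
  \<comment> \<open>\<open>D\<close> is the determinant of \<open>x\<^sup>2, x y\<close> in terms of \<open>x0\<^sup>2, y\<^sup>2\<close>, which gives the formulas for \<open>a\<close> and \<open>b\<close>\<close>
  have "\<exists>a b. f - C a * (x * x) - C b * (x * y) \<in> mp 3" if f: "f \<in> mp 2" for f
  proof -
    obtain u v where uv: "f - C u * (x0 * x0) - C v * (y * y) \<in> mp 3" using span[OF f] by blast
    define a where "a = (u * (\<beta> + c) - v * \<alpha>) / D"
    define b where "b = (v * (1 + 2 * c * \<alpha>) - u * (2 * c * \<beta> + c * c)) / D"
    have u: "u = a * (1 + 2 * c * \<alpha>) + b * \<alpha>"
      using D unfolding a_def b_def by (simp add: field_simps) (simp add: D_def algebra_simps)
    have v: "v = a * (2 * c * \<beta> + c * c) + b * (\<beta> + c)"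
      using D unfolding a_def b_def by (simp add: field_simps) (simp add: D_def algebra_simps)
    have "C u = C a * (1 + 2 * C c * C \<alpha>) + C b * C \<alpha>"
      "C v = C a * (2 * C c * C \<beta> + C c * C c) + C b * (C \<beta> + C c)"
      by (simp_all add: u v C_add C_mult C_2)
    then have "f - C a * (x * x) - C b * (x * y) =
        (f - C u * (x0 * x0) - C v * (y * y)) - (2 * C a * C c + C b) * (x0 * y - C \<alpha> * (x0 * x0) - C \<beta> * (y * y))"
      by (simp add: x_def algebra_simps)
    also have "\<dots> \<in> mp 3"
      by (intro idl_diff[OF mp_idl] idl_mult[OF mp_idl] uv ab)
    finally show ?thesis by blast
  qed
  then show ?thesis using x y c(2) unfolding x_def by blast
qed

text \<open>The inclusion modulo \<open>\<mm>\<^sup>j\<^sup>+\<^sup>1\<close> propagates to all higher powers, and these vanish eventually.\<close>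

lemma nakayama:
  assumes "idl J" "I \<subseteq> J" "\<And>f. f \<in> mp j \<Longrightarrow> \<exists>g\<in>J. f - g \<in> mp (Suc j)"
  shows "mp j \<subseteq> J"
proof -
  have step: "mp (j + i) \<subseteq> {f. \<exists>g\<in>J. f - g \<in> mp (Suc (j + i))}" for i
  proof (induction i)
    case 0
    then show ?case using assms(3) by auto
  next
    case (Suc i)
    have "mp (Suc (j + i)) \<subseteq> {f. \<exists>g\<in>J. f - g \<in> mp (Suc (Suc (j + i)))}"
    proof (rule mp_least[OF idl_sumset[OF assms(1) mp_idl]])
      show "I \<subseteq> {f. \<exists>g\<in>J. f - g \<in> mp (Suc (Suc (j + i)))}"
      proof
        fix f assume "f \<in> I"
        then have "f \<in> J" "f - f \<in> mp (Suc (Suc (j + i)))" using assms(2) idl_0[OF mp_idl] by auto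
        then show "f \<in> {f. \<exists>g\<in>J. f - g \<in> mp (Suc (Suc (j + i)))}" by blast
      qed
      fix a b assume a: "a \<in> M" and "b \<in> mp (j + i)"
      then obtain g where g: "g \<in> J" "b - g \<in> mp (Suc (j + i))" using Suc by blast
      have "a * b - a * g = a * (b - g)" by (simp add: algebra_simps)
      then have "a * b - a * g \<in> mp (Suc (Suc (j + i)))" using mp_prod[OF a g(2)] by (simp only:)
      then show "a * b \<in> {f. \<exists>g\<in>J. f - g \<in> mp (Suc (Suc (j + i)))}"
        using idl_mult[OF assms(1) g(1)] by blast
    qed
    then show ?case by simp
  qed
  have down: "mp (j + i) \<subseteq> J" if sub: "mp (Suc (j + i)) \<subseteq> J" for i
  proof
    fix f assume "f \<in> mp (j + i)"
    then obtain g where "g \<in> J" "f - g \<in> J" using step[of i] sub by blast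
    then show "f \<in> J" using idl_add[OF assms(1)] by (metis add_diff_cancel_left' diff_add_cancel)
  qed
  have "mp (j + Suc s) \<subseteq> J" using mp_above[of "j + Suc s"] assms(2) by simp
  then have "mp (j + (Suc s - k)) \<subseteq> J" if "k \<le> Suc s" for k
    using that
  proof (induction k)
    case (Suc k)
    then have "mp (Suc (j + (Suc s - Suc k))) \<subseteq> J"
      by (metis Suc_diff_le Suc_leD add_Suc_right diff_Suc_Suc less_eq_Suc_le)
    then show ?case by (rule down)
  qed simp
  from this[of "Suc s"] show ?thesis by simp
qed

end

locale coords = asg C I M h s t
  for C :: "'k::{alg_closed_field, field_char_0} \<Rightarrow> 'r::comm_ring_1" and I M h s t +
  fixes x y :: 'r
  assumes x: "x \<in> M" and y: "y \<in> M" and xs: "x ^ s \<notin> I"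
    and xty: "x ^ t * y \<asymp> 0"
    and m2: "f \<in> mp 2 \<Longrightarrow> \<exists>u v. f \<asymp> x * (u * x + v * y)"

context asg
begin

lemma m2_powers:
  assumes "x \<in> M" "y \<in> M" "\<And>f. f \<in> mp 2 \<Longrightarrow> \<exists>u v. f \<asymp> x * (u * x + v * y)" "f \<in> mp (Suc (Suc j))"
  shows "\<exists>u v. f \<asymp> x ^ Suc j * (u * x + v * y)"
  using assms(4)
proof (induction j arbitrary: f)
  case 0
  then show ?case using assms(3) by (simp add: numeral_2_eq_2)
next
  case (Suc j)
  have "mp (Suc (Suc (Suc j))) \<subseteq> {f. \<exists>u v. f \<asymp> x ^ Suc (Suc j) * (u * x + v * y)}"
  proof (rule mp_least[OF idl_two I_idl_two])
    fix a b assume a: "a \<in> M" and "b \<in> mp (Suc (Suc j))"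
    then obtain u v where b: "b \<asymp> x ^ Suc j * (u * x + v * y)" using Suc.IH by blast
    have "a * (u * x + v * y) \<in> mp 2" using a assms by (intro M_mult M_add M_scale)
    then obtain u' v' where uv: "a * (u * x + v * y) \<asymp> x * (u' * x + v' * y)" using assms(3) by blast
    have "a * b \<asymp> a * (x ^ Suc j * (u * x + v * y))" by (rule cg_mult_l[OF b])
    also have "\<dots> = x ^ Suc j * (a * (u * x + v * y))" by (simp add: ac_simps)
    also have "\<dots> \<asymp> x ^ Suc j * (x * (u' * x + v' * y))" by (rule cg_mult_l[OF uv])
    also have "\<dots> = x ^ Suc (Suc j) * (u' * x + v' * y)" by (simp add: ac_simps)
    finally show "a * b \<in> {f. \<exists>u v. f \<asymp> x ^ Suc (Suc j) * (u * x + v * y)}" by blast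
  qed
  then show ?case using Suc.prems by blast
qed

text \<open>\<open>\<mm>\<^sup>t\<^sup>+\<^sup>1\<close> is principal, generated by \<open>x\<^sup>t\<^sup>+\<^sup>1\<close>, since its successive quotients are lines. So \<open>x\<^sup>t y0 = x\<^sup>t\<^sup>+\<^sup>1 g\<close> for some \<open>g\<close>, and
\<open>y0 - g x\<close> is killed by \<open>x\<^sup>t\<close>.\<close>

lemma exists_coords: "\<exists>x y. coords C I M h s t x y"
proof -
  obtain x y0 where x: "x \<in> M" and y0: "y0 \<in> M" and xs: "x ^ s \<notin> I"
    and span: "\<And>f. f \<in> mp 2 \<Longrightarrow> \<exists>a b. f - C a * (x * x) - C b * (x * y0) \<in> mp 3"
    using exists_good_pair by blast
  have "mp 2 \<subseteq> {f. \<exists>u v. f \<asymp> x * (u * x + v * y0)}"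
  proof (rule nakayama[OF idl_two I_idl_two])
    fix f assume "f \<in> mp 2"
    then obtain a b where ab: "f - C a * (x * x) - C b * (x * y0) \<in> mp 3" using span by blast
    have "C a * (x * x) + C b * (x * y0) \<asymp> x * (C a * x + C b * y0)"
      by (rule cg_eq) (simp add: algebra_simps)
    then have "C a * (x * x) + C b * (x * y0) \<in> {f. \<exists>u v. f \<asymp> x * (u * x + v * y0)}"
      by blast
    moreover have "f - (C a * (x * x) + C b * (x * y0)) \<in> mp (Suc 2)" using ab by (simp add: diff_diff_add)
    ultimately show "\<exists>g\<in>{f. \<exists>u v. f \<asymp> x * (u * x + v * y0)}. f - g \<in> mp (Suc 2)" by blast
  qed
  then have m2: "\<exists>u v. f \<asymp> x * (u * x + v * y0)" if "f \<in> mp 2" for f using that by blast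
  have "mp (t + 1) \<subseteq> {f. \<exists>g. f \<asymp> x ^ (t + 1) * g}"
  proof (rule nakayama[OF idl_principal I_idl_principal])
    fix f assume f: "f \<in> mp (t + 1)"
    have "t + 1 \<le> s" using st t by simp
    then obtain c where "f - C c * x ^ (t + 1) \<in> mp (Suc (t + 1))"
      using qdim_1_spans[OF dim_high mp_lin M_power[OF x] power_not_in_next[OF x xs] f] by auto
    moreover have "C c * x ^ (t + 1) \<asymp> x ^ (t + 1) * C c" by (simp add: mult.commute)
    ultimately show "\<exists>g\<in>{f. \<exists>g. f \<asymp> x ^ (t + 1) * g}. f - g \<in> mp (Suc (t + 1))" by blast
  qed
  moreover have "x ^ t * y0 \<in> mp (t + 1)"
    using mp_mult[OF M_power[OF x, of t], of y0 "Suc 0"] y0 by (simp add: mp_1)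
  ultimately obtain g where g: "x ^ t * y0 \<asymp> x ^ (t + 1) * g" by blast
  define y where "y = y0 - g * x"
  have "coords C I M h s t x y"
  proof unfold_locales
    show "x \<in> M" "x ^ s \<notin> I" by fact+
    show "y \<in> M" unfolding y_def by (intro idl_diff[OF M_idl] M_scale x y0)
    have "x ^ t * y = x ^ t * y0 - x ^ (t + 1) * g" by (simp add: y_def algebra_simps)
    then show "x ^ t * y \<asymp> 0" using g by (simp add: cg_def)
    fix f assume "f \<in> mp 2"
    then obtain u v where uv: "f \<asymp> x * (u * x + v * y0)" using m2 by blast
    have "x * (u * x + v * y0) = x * ((u + v * g) * x + v * y)" by (simp add: y_def algebra_simps)
    then show "\<exists>u v. f \<asymp> x * (u * x + v * y)" using uv by metis
  qed
  then show ?thesis by blast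
qed

end

section \<open>The quadratic relation of the distinguished pair\<close>

context coords
begin

sublocale nil_elt C I x "Suc s"
  by (rule nil_elt[OF x])

lemma m2_powers': "f \<in> mp (Suc (Suc j)) \<Longrightarrow> \<exists>u v. f \<asymp> x ^ Suc j * (u * x + v * y)"
  by (rule m2_powers[OF x y m2])

text \<open>Repeatedly replacing the coefficients \<open>u\<close> and \<open>v\<close> by their constant terms builds up the two series.\<close>

lemma m2_ev: "f \<in> mp 2 \<Longrightarrow> \<exists>F G. f \<asymp> x ^ 2 * ev F + x * ev G * y"
proof -
  have "\<forall>f\<in>mp (Suc (Suc j)). \<exists>F G. f \<asymp> x ^ Suc (Suc j) * ev F + x ^ Suc j * ev G * y" if "j \<le> s" for j
    using that
  proof (induction "s - j" arbitrary: j)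
    case 0
    show ?case
    proof
      fix f assume "f \<in> mp (Suc (Suc j))"
      then have "f \<asymp> 0"
        using mp_above[of "Suc (Suc j)"] 0 by (simp add: cg_0_iff)
      then have "f \<asymp> x ^ Suc (Suc j) * ev 0 + x ^ Suc j * ev 0 * y" by simp
      then show "\<exists>F G. f \<asymp> x ^ Suc (Suc j) * ev F + x ^ Suc j * ev G * y" by blast
    qed
  next
    case (Suc k)
    show ?case
    proof
      fix f assume "f \<in> mp (Suc (Suc j))"
      then obtain u v where f: "f \<asymp> x ^ Suc j * (u * x + v * y)" using m2_powers' by blast
      obtain a b where a: "u - C a \<in> M" and b: "v - C b \<in> M" using decomp by metis
      define g where "g = x ^ Suc j * ((u - C a) * x + (v - C b) * y)"
      have "g \<in> mp (Suc j + 2)"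
        unfolding g_def using a b x y
        by (intro mp_mult M_power idl_add[OF mp_idl] M_mult)
      then have "g \<in> mp (Suc (Suc (Suc j)))" by simp
      moreover have "\<forall>f\<in>mp (Suc (Suc (Suc j))). \<exists>F G. f \<asymp> x ^ Suc (Suc (Suc j)) * ev F + x ^ Suc (Suc j) * ev G * y"
        by (rule Suc(1)) (use Suc(2,3) in linarith)+
      ultimately obtain F G where FG: "g \<asymp> x ^ Suc (Suc (Suc j)) * ev F + x ^ Suc (Suc j) * ev G * y"
        by blast
      have const: "C c + x * ev H \<asymp> ev (fps_const c + fps_X * H)" for c H
        unfolding ev_add using ev_shift[of 1 H] by (intro cg_add cg_sym[OF ev_const]) (simp add: cg_sym)
      note f
      also have "x ^ Suc j * (u * x + v * y) = x ^ Suc (Suc j) * C a + x ^ Suc j * C b * y + g"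
        by (simp add: g_def algebra_simps)
      also have "\<dots> \<asymp> x ^ Suc (Suc j) * C a + x ^ Suc j * C b * y
          + (x ^ Suc (Suc (Suc j)) * ev F + x ^ Suc (Suc j) * ev G * y)"
        by (rule cg_add[OF cg_refl FG])
      also have "\<dots> = x ^ Suc (Suc j) * (C a + x * ev F) + x ^ Suc j * (C b + x * ev G) * y"
        by (simp add: algebra_simps)
      also have "\<dots> \<asymp> x ^ Suc (Suc j) * ev (fps_const a + fps_X * F) + x ^ Suc j * ev (fps_const b + fps_X * G) * y"
        by (intro cg_add cg_mult_r cg_mult_l const)
      finally show "\<exists>F G. f \<asymp> x ^ Suc (Suc j) * ev F + x ^ Suc j * ev G * y" by blast
    qed
  qed
  from this[of 0] show "f \<in> mp 2 \<Longrightarrow> ?thesis" by (simp add: numeral_2_eq_2)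
qed

text \<open>Otherwise \<open>\<mm>\<^sup>t\<close> would be spanned by \<open>x\<^sup>t\<close> modulo \<open>\<mm>\<^sup>t\<^sup>+\<^sup>1\<close>, but its dimension there is two.\<close>

lemma xy_top: "x ^ (t - 1) * y - C c * x ^ t \<notin> mp (Suc t)"
proof
  assume xy: "x ^ (t - 1) * y - C c * x ^ t \<in> mp (Suc t)"
  obtain f where f: "f \<in> mp t" and nf: "\<And>c. f - C c * x ^ t \<notin> mp (Suc t)"
    using qdim_2_not_line[OF dim_low[OF t order_refl] mp_lin M_power[OF x]] by blast
  obtain j where j: "t = Suc (Suc j)" using t by (metis Suc_le_D numeral_2_eq_2 Suc_le_mono)
  obtain u v where uv: "f \<asymp> x ^ Suc j * (u * x + v * y)" using m2_powers' f j by blast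
  obtain a b where a: "u - C a \<in> M" and b: "v - C b \<in> M" using decomp by metis
  have "x ^ Suc j * ((u - C a) * x + (v - C b) * y) \<in> mp (Suc j + 2)"
    using a b x y by (intro mp_mult M_power idl_add[OF mp_idl] M_mult)
  then have 1: "x ^ Suc j * ((u - C a) * x + (v - C b) * y) \<in> mp (Suc t)" by (simp only: j) simp
  have 3: "C b * (x ^ (t - 1) * y - C c * x ^ t) \<in> mp (Suc t)"
    by (rule idl_mult[OF mp_idl xy])
  have 2: "f - x ^ Suc j * (u * x + v * y) \<in> mp (Suc t)" using uv I_mp unfolding cg_def by blast
  have "f - C (a + b * c) * x ^ t = (f - x ^ Suc j * (u * x + v * y))
      + x ^ Suc j * ((u - C a) * x + (v - C b) * y) + C b * (x ^ (t - 1) * y - C c * x ^ t)"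
    by (simp add: j C_add C_mult algebra_simps)
  also have "\<dots> \<in> mp (Suc t)"
    by (rule idl_add[OF mp_idl idl_add[OF mp_idl 2 1] 3])
  finally show False using nf by blast
qed

text \<open>Write \<open>y\<^sup>2 = x\<^sup>2 F(x) + x G(x) y\<close>. As \<open>x\<^sup>t\<close> kills \<open>y\<close>, it kills \<open>x\<^sup>2 F(x)\<close>, and \<open>x\<^sup>s \<noteq> 0\<close> bounds the order of \<open>F\<close> from below.\<close>

lemma y_square: "\<exists>B Z. y * y \<asymp> x * ev B * y + x ^ n * ev Z"
proof -
  obtain F G where FG: "y * y \<asymp> x ^ 2 * ev F + x * ev G * y" using m2_ev[OF M_mult[OF y y]] by blast
  have "x ^ (t + 2) * ev F = x ^ t * (x ^ 2 * ev F + x * ev G * y) - x * ev G * (x ^ t * y)"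
    by (simp add: algebra_simps power_add power2_eq_square)
  also have "\<dots> \<asymp> x ^ t * (y * y) - 0"
    by (intro cg_diff cg_mult_l cg_sym[OF FG] cg_mult_0 xty)
  also have "x ^ t * (y * y) - 0 = y * (x ^ t * y)" by (simp add: ac_simps)
  also have "\<dots> \<asymp> 0" by (rule cg_mult_0(1)[OF xty])
  finally have "F $ i = 0" if "i < n - 2" for i
    by (rule x_ev_eq_0D) (use xs that n_t in auto)
  then obtain Z where Z: "F = fps_X ^ (n - 2) * Z" using fps_factor[of "n - 2" F] by blast
  have "x ^ 2 * ev F \<asymp> x ^ 2 * (x ^ (n - 2) * ev Z)" unfolding Z by (rule cg_mult_l[OF ev_shift])
  also have "\<dots> = x ^ (2 + (n - 2)) * ev Z" by (simp only: power_add mult.assoc)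
  also have "2 + (n - 2) = n" using n_t t by simp
  finally have "x ^ 2 * ev F + x * ev G * y \<asymp> x * ev G * y + x ^ n * ev Z"
    using cg_add by (metis add.commute cg_refl)
  then show ?thesis using cg_trans[OF FG] by blast
qed

lemma scale_in_lspan:
  assumes "a \<in> M" "a \<in> lspan (mp 2) S"
  shows "u * a \<in> lspan (mp 2) S"
proof -
  obtain c where c: "u - C c \<in> M" using decomp by blast
  have "u * a = (u - C c) * a + C c * a" by (simp add: algebra_simps)
  also have "\<dots> \<in> lspan (mp 2) S"
    using M_mult[OF c assms(1)] lspan_superset(1)[of "mp 2" S] assms(2)
    by (intro lin_add[OF lspan_lin] lin_scale[OF lspan_lin]) auto
  finally show ?thesis .
qed

text \<open>A product \<open>x z\<close> lies in \<open>\<mm>\<^sup>2\<close>, hence equals \<open>x (u x + v y)\<close>, and \<open>z\<close> is corrected by \<open>u x + v y\<close>.\<close>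

lemma exists_complement:
  "\<exists>S. finite S \<and> card S + 2 \<le> h \<and> S \<subseteq> M \<and> M \<subseteq> lspan (mp 2) ({x, y} \<union> S) \<and> (\<forall>z\<in>S. x * z \<asymp> 0)"
proof -
  have t1: "t - 1 + 2 = Suc t" using t by simp
  have "y - C c * x \<notin> mp 2" for c
  proof
    assume "y - C c * x \<in> mp 2"
    then have "x ^ (t - 1) * (y - C c * x) \<in> mp (t - 1 + 2)" by (intro mp_mult M_power x)
    moreover have "x ^ (t - 1) * (y - C c * x) = x ^ (t - 1) * y - C c * x ^ t"
      using t by (cases t) (simp_all add: algebra_simps)
    ultimately show False using xy_top by (simp only: t1)
  qed
  then have "y \<notin> lspan (mp 2) {x}"
    using lspan_insert[of y "mp 2" x "{}"] lspan_empty[OF mp_lin] by auto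
  moreover have "x \<notin> mp 2"
    using power_not_in_next[OF x xs, of 1] st t by (simp add: numeral_2_eq_2)
  ultimately have "indep (mp 2) [y, x]" by (simp add: lspan_empty[OF mp_lin])
  moreover have "set [y, x] \<subseteq> mp 1" using x y by (simp add: mp_1)
  ultimately obtain vs where vs: "set vs \<subseteq> M" "length vs + length [y, x] = h"
    and span: "M \<subseteq> lspan (mp 2) (set vs \<union> set [y, x])"
    using qdim_extend[OF dim_1] by (metis One_nat_def mp_1)
  have "\<exists>u v. x * (z - u * x - v * y) \<asymp> 0" if z: "z \<in> M" for z
  proof -
    obtain u v where "x * z \<asymp> x * (u * x + v * y)" using m2[OF M_mult[OF x z]] by blast
    then have "x * (z - u * x - v * y) \<asymp> 0" by (simp add: cg_def algebra_simps)
    then show ?thesis by blast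
  qed
  then obtain u v where uv: "\<And>z. z \<in> M \<Longrightarrow> x * (z - u z * x - v z * y) \<asymp> 0" by metis
  define S where "S = (\<lambda>z. z - u z * x - v z * y) ` set vs"
  have xy: "x \<in> lspan (mp 2) ({x, y} \<union> S)" "y \<in> lspan (mp 2) ({x, y} \<union> S)"
    using lspan_superset(2)[of "{x, y} \<union> S" "mp 2"] by auto
  have "set vs \<union> set [y, x] \<subseteq> lspan (mp 2) ({x, y} \<union> S)"
  proof
    fix z assume "z \<in> set vs \<union> set [y, x]"
    then consider "z \<in> set vs" | "z = x" | "z = y" by auto
    then show "z \<in> lspan (mp 2) ({x, y} \<union> S)"
    proof cases
      case 1
      then have "z - u z * x - v z * y \<in> lspan (mp 2) ({x, y} \<union> S)"
        using lspan_superset(2)[of "{x, y} \<union> S" "mp 2"] by (auto simp: S_def)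
      then have "(z - u z * x - v z * y) + (u z * x + v z * y) \<in> lspan (mp 2) ({x, y} \<union> S)"
        by (intro lin_add[OF lspan_lin] scale_in_lspan x y xy)
      then show ?thesis by simp
    qed (use xy in auto)
  qed
  then have "M \<subseteq> lspan (mp 2) ({x, y} \<union> S)"
    using subset_trans[OF span lspan_mono] by blast
  moreover have "card S \<le> card (set vs)" unfolding S_def by (rule card_image_le) simp
  then have "card S + 2 \<le> h" using vs(2) card_length[of vs] by simp
  moreover have "S \<subseteq> M" using vs(1) x y by (auto simp: S_def intro!: idl_diff[OF M_idl] M_scale)
  moreover have "\<forall>z\<in>S. x * z \<asymp> 0" using vs(1) uv by (auto simp: S_def)
  moreover have "finite S" by (simp add: S_def)
  ultimately show ?thesis by blast
qed

text \<open>If \<open>Z\<close> had no constant term, \<open>x\<^sup>t\<^sup>-\<^sup>1 y\<close> would be killed by \<open>x\<close>, by \<open>y\<close> and by the remaining coordinates. It would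
then be a multiple of the socle generator \<open>x\<^sup>s\<close>, contrary to \<open>xy_top\<close>.\<close>

lemma y_square_unit:
  assumes "y * y \<asymp> x * ev B * y + x ^ n * ev Z"
  shows "Z $ 0 \<noteq> 0"
proof
  assume Z: "Z $ 0 = 0"
  let ?a = "x ^ (t - 1) * y"
  have xt: "x * x ^ (t - 1) = x ^ t" "x ^ (t - 1) * x ^ n = x ^ s"
  proof -
    show "x * x ^ (t - 1) = x ^ t" using t by (cases t) simp_all
    have "t - 1 + n = s" using t n_t by simp
    then show "x ^ (t - 1) * x ^ n = x ^ s" by (simp only: power_add[symmetric])
  qed
  have xa: "x * ?a \<asymp> 0" using xty by (simp only: mult.assoc[symmetric] xt)
  have ya: "y * ?a \<asymp> 0"
  proof -
    have "y * ?a = x ^ (t - 1) * (y * y)" by (simp add: ac_simps)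
    also have "\<dots> \<asymp> x ^ (t - 1) * (x * ev B * y + x ^ n * ev Z)" by (rule cg_mult_l[OF assms])
    also have "\<dots> = ev B * (x * ?a) + x ^ s * ev Z" unfolding xt(2)[symmetric] by (simp add: algebra_simps)
    also have "\<dots> \<asymp> 0 + x ^ s * C (Z $ 0)" by (intro cg_add cg_mult_0(1) xa ev_top) simp
    finally show ?thesis by (simp add: Z)
  qed
  obtain S where S: "S \<subseteq> M" "M \<subseteq> lspan (mp 2) ({x, y} \<union> S)" "\<forall>z\<in>S. x * z \<asymp> 0"
    using exists_complement by blast
  have "lin {f. f * ?a \<in> I}"
    unfolding lin_def using I_0 I_add I_mult by (auto simp: distrib_right mult.assoc)
  then have "lspan (mp 2) ({x, y} \<union> S) \<subseteq> {f. f * ?a \<in> I}"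
  proof (rule lspan_least)
    show "mp 2 \<subseteq> {f. f * ?a \<in> I}"
    proof
      fix f assume "f \<in> mp 2"
      then obtain u v where "f \<asymp> x * (u * x + v * y)" using m2 by blast
      then have "f * ?a \<asymp> x * (u * x + v * y) * ?a" by (rule cg_mult_r)
      also have "\<dots> = (u * x + v * y) * (x * ?a)" by (simp add: ac_simps)
      also have "\<dots> \<asymp> 0" by (rule cg_mult_0(1)[OF xa])
      finally show "f \<in> {f. f * ?a \<in> I}" by (simp add: cg_0_iff)
    qed
    have "z * ?a \<in> I" if "z \<in> S" for z
    proof -
      have "z * ?a = x ^ (t - 2) * y * (x * z)"
      proof -
        obtain m where "t = Suc (Suc m)" using t by (metis Suc_le_D numeral_2_eq_2 Suc_le_mono)
        then show ?thesis by (simp add: ac_simps)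
      qed
      then show ?thesis using cg_mult_0(1)[of "x * z"] S(3) that by (simp add: cg_0_iff)
    qed
    then show "{x, y} \<union> S \<subseteq> {f. f * ?a \<in> I}"
      using xa ya by (auto simp: cg_0_iff)
  qed
  then have soc: "?a \<in> {f. \<forall>g\<in>M. g * f \<in> I}" using S(2) by blast
  have "x ^ s \<in> {f. \<forall>g\<in>M. g * f \<in> I}"
    using mp_prod[OF _ M_power[OF x, of s]] nil by auto
  then obtain c where "?a - C c * x ^ s \<in> I"
    using qdim_1_spans[OF dim_socle I_lin _ xs soc] by blast
  moreover have "x ^ s \<in> mp (Suc t)" using M_power[OF x, of s] mp_antimono[of "Suc t" s] st t by auto
  ultimately have "(?a - C c * x ^ s) + C c * x ^ s \<in> mp (Suc t)"
    using I_mp by (intro idl_add[OF mp_idl] idl_mult[OF mp_idl]) auto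
  then show False using xy_top[of 0] by simp
qed

end

section \<open>Orthogonal coordinates\<close>

locale asg_plane = coords C I M h s t x y
  for C :: "'k::{alg_closed_field, field_char_0} \<Rightarrow> 'r::comm_ring_1" and I M h s t x y +
  fixes B Z :: "'k fps"
  assumes y_sq: "y * y \<asymp> x * ev B * y + x ^ n * ev Z"
begin

sublocale plane C I x "Suc s" y t n B Z
  using xty y_sq by unfold_locales

lemma Z0: "Z $ 0 \<noteq> 0"
  using y_square_unit[OF y_sq] .

lemma pr_eq_0:
  assumes "pr F G \<asymp> 0"
  shows "i < Suc s \<Longrightarrow> F $ i = 0" "j < t \<Longrightarrow> G $ j = 0"
proof -
  have *: "x ^ (Suc s - 1) \<notin> I" "Suc s = n + t" "t \<le> n" "1 \<le> t" using xs n_t t by simp_all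
  show "i < Suc s \<Longrightarrow> F $ i = 0" using pr_eq_0D(1)[OF assms *(1) Z0 *(2,3,4)] *(2) by simp
  show "j < t \<Longrightarrow> G $ j = 0" using pr_eq_0D(2)[OF assms *(1) Z0 *(2,3,4)] by simp
qed

lemma killed_by_x_y:
  assumes "f \<in> mp 2" "x * f \<asymp> 0" "y * f \<asymp> 0"
  shows "\<exists>q. f \<asymp> C q * x ^ s"
proof -
  obtain F G where "f \<asymp> x ^ 2 * ev F + x * ev G * y" using m2_ev[OF assms(1)] by blast
  also have "x ^ 2 * ev F + x * ev G * y = x ^ 2 * ev F + x ^ 1 * ev G * y" by simp
  also have "\<dots> \<asymp> pr (fps_X ^ 2 * F) (fps_X ^ 1 * G)"
    unfolding pr_def by (intro cg_add cg_mult_r cg_sym[OF ev_shift])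
  finally have f: "f \<asymp> pr (fps_X ^ 2 * F) (fps_X ^ 1 * G)" .
  have "pr (fps_X * (fps_X ^ 2 * F)) (fps_X * (fps_X ^ 1 * G)) \<asymp> pr fps_X 0 * pr (fps_X ^ 2 * F) (fps_X ^ 1 * G)"
    using pr_mult[of fps_X 0 "fps_X ^ 2 * F" "fps_X ^ 1 * G"] by (simp add: cg_sym)
  also have "\<dots> \<asymp> x * f"
    using ev_X by (intro cg_mult cg_sym[OF f]) (simp add: pr_ev)
  also note assms(2)
  finally have 0: "pr (fps_X * (fps_X ^ 2 * F)) (fps_X * (fps_X ^ 1 * G)) \<asymp> 0" .
  define a b where "a = (fps_X ^ 2 * F) $ s" and "b = (fps_X ^ 1 * G) $ (t - 1)"
  define F1 G1 where "F1 = fps_const a * fps_X ^ s" and "G1 = fps_const b * fps_X ^ (t - 1)"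
  have "pr (fps_X ^ 2 * F) (fps_X ^ 1 * G) \<asymp> pr F1 G1"
  proof (rule pr_cong)
    fix i assume "i < Suc s"
    then show "(fps_X ^ 2 * F) $ i = F1 $ i"
      using pr_eq_0(1)[OF 0, of "Suc i"] by (cases "i = s") (auto simp: F1_def a_def fps_X_power_nth)
  next
    fix i assume "i < t"
    then show "(fps_X ^ 1 * G) $ i = G1 $ i"
      using pr_eq_0(2)[OF 0, of "Suc i"] by (cases "i = t - 1") (auto simp: G1_def b_def fps_X_power_nth)
  qed
  with f have f1: "f \<asymp> pr F1 G1" by (rule cg_trans)
  have "pr 0 1 * pr F1 G1 \<asymp> y * f"
    by (intro cg_mult pr_0_1 cg_sym[OF f1])
  also note assms(3)
  finally have "pr 0 1 * pr F1 G1 \<asymp> 0" .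
  then have "pr (0 * F1 + fps_X ^ n * (1 * G1 * Z)) (0 * G1 + F1 * 1 + fps_X * (1 * G1 * B)) \<asymp> 0"
    using cg_trans[OF cg_sym[OF pr_mult]] by blast
  then have "(0 * F1 + fps_X ^ n * (1 * G1 * Z)) $ s = 0" by (rule pr_eq_0(1)) simp
  also have "0 * F1 + fps_X ^ n * (1 * G1 * Z) = fps_X ^ s * (fps_const b * Z)"
  proof -
    have "n + (t - 1) = s" using n_t t by simp
    then have "fps_X ^ s = fps_X ^ n * (fps_X :: 'k fps) ^ (t - 1)" by (simp only: power_add[symmetric])
    then show ?thesis by (simp add: G1_def ac_simps)
  qed
  finally have "b = 0" using Z0 by (simp add: fps_X_power_mult_nth)
  then have "f \<asymp> ev F1" using f1 by (simp add: G1_def pr_ev)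
  also have "\<dots> \<asymp> ev (fps_const a) * ev (fps_X ^ s)" unfolding F1_def by (rule ev_mult)
  also have "\<dots> \<asymp> C a * x ^ s" by (intro cg_mult ev_const ev_X_power)
  finally show ?thesis by blast
qed

definition kills :: "'r \<Rightarrow> bool" where
  "kills z \<longleftrightarrow> z \<in> M \<and> x * z \<asymp> 0 \<and> y * z \<asymp> 0"

lemma kills_add: "kills u \<Longrightarrow> kills v \<Longrightarrow> kills (u + v)"
  by (simp add: kills_def M_add distrib_left cg_add_0)

lemma kills_scale: "kills u \<Longrightarrow> kills (g * u)"
  using cg_mult_0(1)[of "x * u" g] cg_mult_0(1)[of "y * u" g]
  by (simp add: kills_def M_scale mult.left_commute)

lemma kills_prod: "kills u \<Longrightarrow> kills v \<Longrightarrow> \<exists>q. u * v \<asymp> C q * x ^ s"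
  by (rule killed_by_x_y) (auto simp: kills_def M_mult cg_mult_0 simp flip: mult.assoc)

text \<open>The element \<open>x\<^sup>t\<^sup>-\<^sup>1 y\<close> is killed by \<open>x\<close>, and its product with \<open>y\<close> is \<open>Z(0) x\<^sup>s\<close>. As \<open>y z\<close> is a multiple of \<open>x\<^sup>s\<close>
for each \<open>z\<close> killed by \<open>x\<close>, subtracting a multiple of that element makes \<open>y z\<close> vanish.\<close>

lemma exists_killed_complement:
  "\<exists>S. finite S \<and> card S + 2 \<le> h \<and> (\<forall>z\<in>S. kills z) \<and> M \<subseteq> lspan (mp 2) ({x, y} \<union> S)"
proof -
  obtain S where S: "finite S" "card S + 2 \<le> h" "S \<subseteq> M" "M \<subseteq> lspan (mp 2) ({x, y} \<union> S)"
    and xS: "\<And>z. z \<in> S \<Longrightarrow> x * z \<asymp> 0"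
    using exists_complement by blast
  have xt: "x ^ t = x * x ^ (t - 1)" "x ^ s = x ^ (t - 1) * x ^ n"
  proof -
    show "x ^ t = x * x ^ (t - 1)" using t by (cases t) simp_all
    have "t - 1 + n = s" using n_t t by simp
    then show "x ^ s = x ^ (t - 1) * x ^ n" by (simp only: power_add[symmetric])
  qed
  have yxy: "y * (x ^ (t - 1) * y) \<asymp> C (Z $ 0) * x ^ s"
  proof -
    have "y * (x ^ (t - 1) * y) = x ^ (t - 1) * (y * y)" by (simp add: ac_simps)
    also have "\<dots> \<asymp> x ^ (t - 1) * (x * ev B * y + x ^ n * ev Z)" by (rule cg_mult_l[OF y_sq])
    also have "\<dots> = ev B * (x ^ t * y) + x ^ s * ev Z" unfolding xt by (simp add: algebra_simps)
    also have "\<dots> \<asymp> 0 + x ^ s * C (Z $ 0)" by (intro cg_add cg_mult_0(1) xty ev_top) simp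
    finally show ?thesis by (simp add: mult.commute)
  qed
  have "\<exists>q. y * z \<asymp> C q * x ^ s" if z: "z \<in> S" for z
  proof (rule killed_by_x_y)
    show "y * z \<in> mp 2" using y z S(3) by (intro M_mult) auto
    have "x * (y * z) = y * (x * z)" by (simp add: ac_simps)
    also have "\<dots> \<asymp> 0" by (rule cg_mult_0(1)[OF xS[OF z]])
    finally show "x * (y * z) \<asymp> 0" .
    have "y * (y * z) = y * y * z" by (simp add: ac_simps)
    also have "\<dots> \<asymp> (x * ev B * y + x ^ n * ev Z) * z" by (rule cg_mult_r[OF y_sq])
    also have "\<dots> = (ev B * y + x ^ (n - 1) * ev Z) * (x * z)"
    proof -
      have "x ^ n = x * x ^ (n - 1)" using n_t by (cases n) simp_all
      then show ?thesis by (simp add: algebra_simps)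
    qed
    also have "\<dots> \<asymp> 0" by (rule cg_mult_0(1)[OF xS[OF z]])
    finally show "y * (y * z) \<asymp> 0" .
  qed
  then obtain q where q: "\<And>z. z \<in> S \<Longrightarrow> y * z \<asymp> C (q z) * x ^ s" by metis
  define m where "m = (\<lambda>z. C (q z / Z $ 0) * (x ^ (t - 1) * y))"
  have m: "m z \<in> mp 2" for z
  proof -
    obtain j where "t = Suc (Suc j)" using t by (metis Suc_le_D numeral_2_eq_2 Suc_le_mono)
    then have "m z = (C (q z / Z $ 0) * x ^ j) * (x * y)" by (simp add: m_def ac_simps)
    then show ?thesis using idl_mult[OF mp_idl M_mult[OF x y]] by simp
  qed
  have "kills (z - m z)" if z: "z \<in> S" for z
    unfolding kills_def
  proof (intro conjI)
    show "z - m z \<in> M" using z S(3) m mp_2_M by (auto intro!: idl_diff[OF M_idl])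
    have "x * (z - m z) = x * z - C (q z / Z $ 0) * (x ^ t * y)" by (simp add: m_def xt algebra_simps)
    also have "\<dots> \<asymp> 0 - 0" by (intro cg_diff cg_mult_0(1) xty xS z)
    finally show "x * (z - m z) \<asymp> 0" by simp
    have "y * (z - m z) = y * z - C (q z / Z $ 0) * (y * (x ^ (t - 1) * y))" by (simp add: m_def algebra_simps)
    also have "\<dots> \<asymp> C (q z) * x ^ s - C (q z / Z $ 0) * (C (Z $ 0) * x ^ s)"
      by (intro cg_diff cg_mult_l q z yxy)
    also have "\<dots> = 0" using Z0 by (simp flip: mult.assoc C_mult)
    finally show "y * (z - m z) \<asymp> 0" .
  qed
  moreover have "M \<subseteq> lspan (mp 2) ({x, y} \<union> (\<lambda>z. z - m z) ` S)" (is "_ \<subseteq> ?L")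
  proof -
    have "{x, y} \<union> S \<subseteq> ?L"
    proof
      fix z assume "z \<in> {x, y} \<union> S"
      then consider "z \<in> {x, y}" | "z \<in> S" by blast
      then show "z \<in> ?L"
      proof cases
        case 1
        then show ?thesis using lspan_superset(2)[of "{x, y} \<union> (\<lambda>z. z - m z) ` S" "mp 2"] by blast
      next
        case 2
        then have "z - m z \<in> ?L" "m z \<in> ?L"
          using lspan_superset(2)[of "{x, y} \<union> (\<lambda>z. z - m z) ` S" "mp 2"]
            lspan_superset(1)[of "mp 2" "{x, y} \<union> (\<lambda>z. z - m z) ` S"] m by blast+
        then have "(z - m z) + m z \<in> ?L" by (rule lin_add[OF lspan_lin])
        then show ?thesis by simp
      qed
    qed
    then show ?thesis using S(4) lspan_mono by blast
  qed
  moreover have "finite ((\<lambda>z. z - m z) ` S)" "card ((\<lambda>z. z - m z) ` S) \<le> card S"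
    using S(1) by (auto intro: card_image_le)
  then have "finite ((\<lambda>z. z - m z) ` S)" "card ((\<lambda>z. z - m z) ` S) + 2 \<le> h"
    using S(2) by auto
  ultimately show ?thesis by (intro exI[of _ "(\<lambda>z. z - m z) ` S"]) auto
qed

text \<open>A stage of Gram-Schmidt for the form \<open>u v = q x\<^sup>s\<close>: the family \<open>os\<close> is already orthonormal, and \<open>W\<close> is the
remaining part of the coordinates, orthogonal to \<open>os\<close>.\<close>

definition onb :: "'r list \<Rightarrow> 'r set \<Rightarrow> bool" where
  "onb os W \<longleftrightarrow> finite W \<and> (\<forall>z\<in>W. kills z) \<and>
     (\<forall>e\<in>set os. kills e \<and> e * e \<asymp> x ^ s) \<and> sorted_wrt (\<lambda>a b. a * b \<asymp> 0) os \<and>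
     (\<forall>w\<in>W. \<forall>e\<in>set os. e * w \<asymp> 0) \<and>
     M \<subseteq> lspan (mp 2) ({x, y} \<union> set os \<union> W) \<and> length os + card W + 2 \<le> h"

text \<open>An anisotropic vector is normalised by a square root, and the others are projected to its complement.\<close>

lemma onb_normalise:
  assumes "onb os W" "v \<in> W" "v * v \<notin> I"
  shows "\<exists>os' W'. onb os' W' \<and> card W' < card W"
proof -
  have fin: "finite W" and kW: "\<And>w. w \<in> W \<Longrightarrow> kills w"
    and os: "\<And>e. e \<in> set os \<Longrightarrow> kills e" "\<And>e. e \<in> set os \<Longrightarrow> e * e \<asymp> x ^ s"
    and sorted: "sorted_wrt (\<lambda>a b. a * b \<asymp> 0) os" and orth: "\<And>w e. w \<in> W \<Longrightarrow> e \<in> set os \<Longrightarrow> e * w \<asymp> 0"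
    and span: "M \<subseteq> lspan (mp 2) ({x, y} \<union> set os \<union> W)" and len: "length os + card W + 2 \<le> h"
    using assms(1) unfolding onb_def by blast+
  obtain l where l: "\<And>w. w \<in> W \<Longrightarrow> v * w \<asymp> C (l w) * x ^ s"
    using kills_prod[OF kW[OF assms(2)] kW] by metis
  have q: "l v \<noteq> 0"
  proof
    assume "l v = 0"
    then show False using l[OF assms(2)] assms(3) by (simp add: cg_0_iff)
  qed
  obtain r where r: "r ^ 2 = inverse (l v)" using nth_root_exists[of 2 "inverse (l v)"] by auto
  then have r0: "r \<noteq> 0" using q by auto
  define e where "e = C r * v"
  define m where "m = (\<lambda>w. C (l w / l v) * v)"
  define W' where "W' = (\<lambda>w. w - m w) ` (W - {v})"
  have km: "kills (w - m w)" if "w \<in> W" for w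
    using kills_add[OF kW[OF that] kills_scale[OF kW[OF assms(2)], of "- C (l w / l v)"]]
    by (simp add: m_def)
  have ke: "kills e" unfolding e_def by (rule kills_scale[OF kW[OF assms(2)]])
  have ee: "e * e \<asymp> x ^ s"
  proof -
    have "e * e = C (r ^ 2) * (v * v)" by (simp add: e_def C_mult power2_eq_square ac_simps)
    also have "\<dots> \<asymp> C (inverse (l v)) * (C (l v) * x ^ s)" unfolding r by (rule cg_mult_l[OF l[OF assms(2)]])
    also have "\<dots> = x ^ s" using q by (simp flip: mult.assoc C_mult)
    finally show ?thesis .
  qed
  have ew: "e * (w - m w) \<asymp> 0" if w: "w \<in> W" for w
  proof -
    have "e * (w - m w) = C r * (v * w - C (l w / l v) * (v * v))" by (simp add: e_def m_def algebra_simps)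
    also have "\<dots> \<asymp> C r * (C (l w) * x ^ s - C (l w / l v) * (C (l v) * x ^ s))"
      by (intro cg_mult_l cg_diff l w assms(2))
    also have "\<dots> = 0" using q by (simp flip: mult.assoc C_mult)
    finally show ?thesis .
  qed
  have oe: "e' * e \<asymp> 0" "e * e' \<asymp> 0" if "e' \<in> set os" for e'
    using cg_mult_0(1)[OF orth[OF assms(2) that], of "C r"] by (simp_all add: e_def ac_simps)
  have ow: "e' * (w - m w) \<asymp> 0" if "e' \<in> set os" "w \<in> W" for e' w
  proof -
    have "e' * (w - m w) = e' * w - C (l w / l v) * (e' * v)" by (simp add: m_def algebra_simps)
    also have "\<dots> \<asymp> 0 - 0" by (intro cg_diff cg_mult_0(1) orth assms that)
    finally show ?thesis by simp
  qed
  let ?S = "{x, y} \<union> set (e # os) \<union> W'"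
  have "{x, y} \<union> set os \<union> W \<subseteq> lspan (mp 2) ?S"
  proof
    fix z assume z: "z \<in> {x, y} \<union> set os \<union> W"
    have e: "C c * e \<in> lspan (mp 2) ?S" for c
      using lspan_superset(2)[of ?S "mp 2"] by (intro lin_scale[OF lspan_lin]) auto
    have v: "C c * v \<in> lspan (mp 2) ?S" for c
    proof -
      have "C c * v = C (c / r) * e" using r0 by (simp add: e_def flip: mult.assoc C_mult)
      then show ?thesis using e by simp
    qed
    consider "z \<in> {x, y} \<union> set os" | "z = v" | "z \<in> W - {v}" using z by blast
    then show "z \<in> lspan (mp 2) ?S"
    proof cases
      case 1
      then show ?thesis using lspan_superset(2)[of ?S "mp 2"] by auto
    next
      case 2
      then show ?thesis using v[of 1] by simp
    next
      case 3
      then have "z - m z \<in> lspan (mp 2) ?S" using lspan_superset(2)[of ?S "mp 2"] by (auto simp: W'_def)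
      then have "(z - m z) + m z \<in> lspan (mp 2) ?S" unfolding m_def by (intro lin_add[OF lspan_lin] v)
      then show ?thesis by simp
    qed
  qed
  then have "M \<subseteq> lspan (mp 2) ?S" using subset_trans[OF span lspan_mono] by blast
  moreover have "card W' \<le> card (W - {v})" unfolding W'_def using fin by (intro card_image_le) simp
  then have "card W' < card W" using fin assms(2) by (metis card_Diff1_less le_less_trans)
  ultimately have "onb (e # os) W'"
    unfolding onb_def using fin km os ke ee sorted oe ow ew len by (auto simp: W'_def)
  then show ?thesis using \<open>card W' < card W\<close> by blast
qed

text \<open>If all \<open>v\<^sup>2\<close> vanish but some \<open>v w\<close> does not, then \<open>v + w\<close> is anisotropic. If the form vanishes on \<open>W\<close>, an
element of \<open>W\<close> lies in the socle and can be omitted from the coordinates.\<close>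

lemma onb_reduce:
  assumes "onb os W" "W \<noteq> {}"
  shows "\<exists>os' W'. onb os' W' \<and> card W' < card W"
proof -
  have fin: "finite W" and kW: "\<And>w. w \<in> W \<Longrightarrow> kills w"
    and os: "\<And>e. e \<in> set os \<Longrightarrow> kills e" "\<And>e. e \<in> set os \<Longrightarrow> e * e \<asymp> x ^ s"
    and sorted: "sorted_wrt (\<lambda>a b. a * b \<asymp> 0) os" and orth: "\<And>w e. w \<in> W \<Longrightarrow> e \<in> set os \<Longrightarrow> e * w \<asymp> 0"
    and span: "M \<subseteq> lspan (mp 2) ({x, y} \<union> set os \<union> W)" and len: "length os + card W + 2 \<le> h"
    using assms(1) unfolding onb_def by blast+
  consider (sq) v where "v \<in> W" "v * v \<notin> I"
    | (pair) v w where "v \<in> W" "w \<in> W" "v * w \<notin> I" "v * v \<in> I" "w * w \<in> I"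
    | (zero) "\<And>v w. v \<in> W \<Longrightarrow> w \<in> W \<Longrightarrow> v * w \<in> I" by metis
  then show ?thesis
  proof cases
    case sq
    then show ?thesis using onb_normalise[OF assms(1)] by blast
  next
    case pair
    then have vw: "v \<noteq> w" by auto
    define W1 where "W1 = insert (v + w) (W - {v})"
    have sq: "(v + w) * (v + w) \<notin> I"
    proof
      assume "(v + w) * (v + w) \<in> I"
      then have "(v + w) * (v + w) - v * v - w * w \<in> I" using pair by (intro I_diff)
      also have "(v + w) * (v + w) - v * v - w * w = C 2 * (v * w)" by (simp add: C_2 algebra_simps)
      finally show False using pair(3) by (simp add: C_mult_in_I_iff)
    qed
    have card: "card W1 \<le> card W"
      using card_insert_le_m1[of "card W" "W - {v}" "v + w"] fin pair(1) unfolding W1_def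
      by (metis card_Diff_singleton card_gt_0_iff empty_iff order_refl)
    let ?S = "{x, y} \<union> set os \<union> W1"
    have "{x, y} \<union> set os \<union> W \<subseteq> lspan (mp 2) ?S"
    proof
      fix z assume "z \<in> {x, y} \<union> set os \<union> W"
      then consider "z \<in> ?S" | "z = v" unfolding W1_def by blast
      then show "z \<in> lspan (mp 2) ?S"
      proof cases
        case 2
        have "(v + w) - w \<in> lspan (mp 2) ?S"
          using lspan_superset(2)[of ?S "mp 2"] vw pair(2) unfolding W1_def
          by (intro lin_diff[OF lspan_lin]) auto
        then show ?thesis using 2 by simp
      qed (use lspan_superset(2)[of ?S "mp 2"] in blast)
    qed
    then have "M \<subseteq> lspan (mp 2) ?S" using subset_trans[OF span lspan_mono] by blast
    moreover have "e * (v + w) \<asymp> 0" if "e \<in> set os" for e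
      using cg_add_0[OF orth[OF pair(1) that] orth[OF pair(2) that]] by (simp add: distrib_left)
    ultimately have "onb os W1"
      unfolding onb_def using fin kW os sorted orth len card pair kills_add
      by (auto simp: W1_def)
    moreover have "v + w \<in> W1" by (simp add: W1_def)
    ultimately obtain os' W' where "onb os' W'" "card W' < card W1"
      using onb_normalise sq by blast
    then show ?thesis using card by (meson less_le_trans)
  next
    case zero
    obtain w where w: "w \<in> W" using assms(2) by blast
    \<comment> \<open>\<open>w\<close> is orthogonal to all coordinates, hence lies in the socle\<close>
    have "lin {f. f * w \<in> I}"
      unfolding lin_def using I_0 I_add I_mult by (auto simp: distrib_right mult.assoc)
    then have "lspan (mp 2) ({x, y} \<union> set os \<union> W) \<subseteq> {f. f * w \<in> I}"
    proof (rule lspan_least)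
      show "mp 2 \<subseteq> {f. f * w \<in> I}"
      proof
        fix f assume "f \<in> mp 2"
        then obtain u v where "f \<asymp> x * (u * x + v * y)" using m2 by blast
        then have "f * w \<asymp> x * (u * x + v * y) * w" by (rule cg_mult_r)
        also have "\<dots> = (u * x + v * y) * (x * w)" by (simp add: ac_simps)
        also have "\<dots> \<asymp> 0" using kW[OF w] unfolding kills_def by (blast intro: cg_mult_0(1))
        finally show "f \<in> {f. f * w \<in> I}" by (simp add: cg_0_iff)
      qed
      show "{x, y} \<union> set os \<union> W \<subseteq> {f. f * w \<in> I}"
        using kW[OF w] orth[OF w] zero[OF _ w] by (auto simp: kills_def cg_0_iff)
    qed
    then have soc: "w \<in> {f. \<forall>g\<in>M. g * f \<in> I}" using span by blast
    have "x ^ s \<in> {f. \<forall>g\<in>M. g * f \<in> I}"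
      using mp_prod[OF _ M_power[OF x, of s]] nil by auto
    then obtain c where c: "w - C c * x ^ s \<in> I"
      using qdim_1_spans[OF dim_socle I_lin _ xs soc] by blast
    have "x ^ s \<in> mp 2" using M_power[OF x, of s] mp_antimono[of 2 s] st t by auto
    then have "(w - C c * x ^ s) + C c * x ^ s \<in> mp 2"
      using c I_mp by (intro idl_add[OF mp_idl] idl_mult[OF mp_idl]) auto
    then have w2: "w \<in> mp 2" by simp
    let ?S = "{x, y} \<union> set os \<union> (W - {w})"
    have "{x, y} \<union> set os \<union> W \<subseteq> lspan (mp 2) ?S"
      using lspan_superset(2)[of ?S "mp 2"] lspan_superset(1)[of "mp 2" ?S] w2 by blast
    then have "M \<subseteq> lspan (mp 2) ?S" using subset_trans[OF span lspan_mono] by blast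
    moreover have card: "card (W - {w}) < card W" using fin w by (rule card_Diff1_less)
    ultimately have "onb os (W - {w})"
      unfolding onb_def using fin kW os sorted orth len by auto
    then show ?thesis using card by blast
  qed
qed

lemma exists_onb: "\<exists>zs. onb zs {}"
proof -
  obtain S where "finite S" "card S + 2 \<le> h" "\<forall>z\<in>S. kills z" "M \<subseteq> lspan (mp 2) ({x, y} \<union> S)"
    using exists_killed_complement by blast
  then have "onb [] S" by (simp add: onb_def)
  moreover have "\<exists>zs. onb zs {}" if "onb os W" for os W
    using that
  proof (induction "card W" arbitrary: os W rule: less_induct)
    case less
    then show ?case using onb_reduce[OF less.prems] by blast
  qed
  ultimately show ?thesis by blast
qed

lemma onb_length: "onb zs {} \<Longrightarrow> length zs + 2 = h"
proof -
  assume zs: "onb zs {}"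
  have "set (x # y # zs) \<subseteq> mp 1" using zs x y by (auto simp: onb_def kills_def mp_1)
  moreover have "mp 1 \<subseteq> lspan (mp 2) (set (x # y # zs))" using zs by (simp add: onb_def mp_1)
  ultimately have "h \<le> length (x # y # zs)" by (rule qdim_le[OF dim_1])
  then show ?thesis using zs by (simp add: onb_def)
qed

end

section \<open>Normal forms of the quadratic relation\<close>

lemma fps_root:
  fixes F :: "'k::{alg_closed_field, field_char_0} fps"
  assumes "c ^ k = F $ 0" "F $ 0 \<noteq> 0" "0 < k"
  obtains a where "a ^ k = F" "a $ 0 = c"
proof -
  obtain m where m: "k = Suc m" using assms(3) by (cases k) auto
  let ?a = "fps_radical (\<lambda>_ _. c) (Suc m) F"
  have "?a ^ Suc m = F"
    using power_radical[of F "\<lambda>_ _. c" m] assms m by simp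
  moreover have "?a $ 0 = c" by simp
  ultimately show thesis using that m by blast
qed

lemma fps_unit_root:
  fixes F :: "'k::{alg_closed_field, field_char_0} fps"
  assumes "F $ 0 \<noteq> 0" "0 < k"
  obtains a where "a ^ k = F" "a $ 0 \<noteq> 0"
proof -
  obtain c where c: "c ^ k = F $ 0" using nth_root_exists[OF assms(2)] by blast
  then have "c \<noteq> 0" using assms by (auto simp: zero_power)
  then show thesis using fps_root[OF c assms] that by metis
qed

text \<open>The label stands for \<open>z = c + d x\<^sup>j\<close>. Only for \<open>n = 2 (p + 1)\<close> is \<open>c\<close> a modulus; the bound \<open>p + 2 \<le> t\<close> excludes
\<open>p = t - 1\<close>, where \<open>x\<^sup>p\<^sup>+\<^sup>1 y\<close> vanishes and the coefficient of \<open>x\<^sup>n\<close> can always be normalised.\<close>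

definition normal_label :: "nat \<Rightarrow> nat \<Rightarrow> nat \<Rightarrow> 'k::field_char_0 \<Rightarrow> 'k \<Rightarrow> nat \<Rightarrow> bool" where
  "normal_label n t p c d j \<longleftrightarrow> p < t \<and>
     (if p + 2 \<le> t \<and> n = 2 * Suc p then c \<noteq> 0 \<and> (d = 0 \<or> d = 1 \<and> 1 \<le> j \<and> j + p + 2 \<le> t)
      else c = 1 \<and> d = 0)"

text \<open>The substitution \<open>x \<mapsto> a x, y \<mapsto> v y\<close> has to satisfy \<open>v U = a\<^sup>p\<^sup>+\<^sup>1\<close>, to the order visible in the coefficient of \<open>y\<close>,
and \<open>v\<^sup>2 Z = a\<^sup>n z(a x)\<close>. Eliminating \<open>v\<close> leaves \<open>a\<^sup>2\<^sup>(\<^sup>p\<^sup>+\<^sup>1\<^sup>) Z = a\<^sup>n U\<^sup>2 z(a x)\<close>. For \<open>n \<noteq> 2 (p + 1)\<close> a root of a unit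
solves this with \<open>z = 1\<close>. For \<open>n = 2 (p + 1)\<close> the series \<open>Q = Z / U\<^sup>2\<close> must equal \<open>z(a x)\<close>: its first non-constant
term below the visible order determines \<open>j\<close>, and a \<open>j\<close>-th root gives \<open>a\<close>.\<close>

lemma normal_form_choice:
  fixes U Z :: "'k::{alg_closed_field, field_char_0} fps"
  assumes "U $ 0 \<noteq> 0" "Z $ 0 \<noteq> 0" "p < t" "2 \<le> t"
  shows "\<exists>a v c d j. a $ 0 \<noteq> 0 \<and> v $ 0 \<noteq> 0 \<and> normal_label n t p c d j \<and>
    (\<forall>i<t - 1 - p. (v * U) $ i = (a ^ Suc p) $ i) \<and>
    v\<^sup>2 * Z = a ^ n * (fps_const c + fps_const d * (fps_X * a) ^ j)"
proof -
  have iU: "inverse U * U = 1" and iZ: "inverse Z * Z = 1"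
    using assms(1,2) by (auto intro: inverse_mult_eq_1)
  have i0: "inverse U $ 0 \<noteq> 0" "inverse Z $ 0 \<noteq> 0" using assms(1,2) by auto
  consider (last) "\<not> p + 2 \<le> t" | (generic) "p + 2 \<le> t" "n \<noteq> 2 * Suc p"
    | (special) "p + 2 \<le> t" "n = 2 * Suc p" by blast
  then show ?thesis
  proof cases
    case last
    obtain v where v: "v ^ 2 = inverse Z" "v $ 0 \<noteq> 0" using fps_unit_root[OF i0(2), of 2] by auto
    have "v\<^sup>2 * Z = 1 ^ n * (fps_const 1 + fps_const 0 * (fps_X * 1) ^ 0)" by (simp add: v iZ)
    moreover have "\<forall>i<t - 1 - p. (v * U) $ i = (1 ^ Suc p) $ i" using last assms(3) by simp
    moreover have "normal_label n t p 1 0 0" using last assms(3) by (simp add: normal_label_def)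
    moreover have "(1 :: 'k fps) $ 0 \<noteq> 0" by simp
    ultimately show ?thesis using v(2) by blast
  next
    case generic
    have "\<exists>a. a $ 0 \<noteq> 0 \<and> a ^ (2 * Suc p) * Z = a ^ n * U\<^sup>2"
    proof (cases "n < 2 * Suc p")
      case True
      obtain a where a: "a ^ (2 * Suc p - n) = U\<^sup>2 * inverse Z" "a $ 0 \<noteq> 0"
        by (rule fps_unit_root[of "U\<^sup>2 * inverse Z" "2 * Suc p - n"]) (use assms i0 True in auto)
      have "a ^ (2 * Suc p) = a ^ n * a ^ (2 * Suc p - n)" using True by (simp flip: power_add)
      then have "a ^ (2 * Suc p) * Z = a ^ n * U\<^sup>2 * (inverse Z * Z)" by (simp only: a mult.assoc)
      then show ?thesis using a(2) iZ by auto
    next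
      case False
      obtain a where a: "a ^ (n - 2 * Suc p) = Z * (inverse U)\<^sup>2" "a $ 0 \<noteq> 0"
        by (rule fps_unit_root[of "Z * (inverse U)\<^sup>2" "n - 2 * Suc p"]) (use assms i0 False generic in auto)
      have "2 * Suc p + (n - 2 * Suc p) = n" using False by simp
      then have "a ^ n = a ^ (2 * Suc p) * a ^ (n - 2 * Suc p)" by (simp only: power_add[symmetric])
      then have "a ^ n * U\<^sup>2 = a ^ (2 * Suc p) * Z * (inverse U * U)\<^sup>2"
        by (simp only: a power_mult_distrib mult.assoc)
      then show ?thesis using a(2) iU by auto
    qed
    then obtain a where a: "a $ 0 \<noteq> 0" "a ^ (2 * Suc p) * Z = a ^ n * U\<^sup>2" by blast
    define v where "v = a ^ Suc p * inverse U"
    have vU: "v * U = a ^ Suc p" by (simp only: v_def mult.assoc iU mult_1_right)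
    have "v\<^sup>2 * Z = (a ^ (2 * Suc p) * Z) * (inverse U)\<^sup>2"
    proof -
      have "a ^ (2 * Suc p) = (a ^ Suc p)\<^sup>2" by (simp only: power_mult[symmetric] mult.commute)
      then show ?thesis by (simp only: v_def power_mult_distrib ac_simps)
    qed
    also have "\<dots> = a ^ n * (inverse U * U)\<^sup>2" unfolding a(2) by (simp only: power_mult_distrib ac_simps)
    finally have "v\<^sup>2 * Z = a ^ n * (fps_const 1 + fps_const 0 * (fps_X * a) ^ 0)" by (simp add: iU)
    moreover have "v $ 0 \<noteq> 0" using a(1) i0 by (simp add: v_def fps_nth_power_0)
    moreover have "normal_label n t p 1 0 0" using generic assms(3) by (simp add: normal_label_def)
    ultimately show ?thesis using a(1) vU by metis
  next
    case special
    define m where "m = t - 1 - p"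
    have m: "1 \<le> m" using special by (simp add: m_def)
    define Q where "Q = Z * (inverse U)\<^sup>2"
    define c where "c = Q $ 0"
    have c: "c \<noteq> 0" using assms(2) i0 by (simp add: c_def Q_def)
    show ?thesis
    proof (cases "\<forall>i<m. (Q - fps_const c) $ i = 0")
      case True
      obtain H where H: "Q - fps_const c = fps_X ^ m * H" using fps_factor[of m "Q - fps_const c"] True by blast
      have iQ: "inverse Q * Q = 1" using c by (intro inverse_mult_eq_1) (simp add: c_def)
      obtain r where r: "r ^ 2 = fps_const c * inverse Q" "r $ 0 = 1"
        by (rule fps_root[of 1 2 "fps_const c * inverse Q"]) (use c in \<open>auto simp: c_def\<close>)
      have "(r + 1) $ 0 \<noteq> 0" using r(2) by simp
      then have ir: "inverse (r + 1) * (r + 1) = 1" by (rule inverse_mult_eq_1)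
      have "(r + 1) * (r - 1) = r ^ 2 - inverse Q * Q"
        unfolding iQ by (simp add: power2_eq_square algebra_simps)
      also have "\<dots> = - (inverse Q * (Q - fps_const c))" by (simp only: r) (simp add: algebra_simps)
      also have "\<dots> = fps_X ^ m * (- (inverse Q * H))" unfolding H by (simp add: ac_simps)
      finally have "inverse (r + 1) * ((r + 1) * (r - 1)) = fps_X ^ m * (inverse (r + 1) * (- (inverse Q * H)))"
        by (simp only: mult.left_commute)
      then have "r - 1 = fps_X ^ m * (inverse (r + 1) * (- (inverse Q * H)))"
        by (simp only: mult.assoc[symmetric] ir mult_1_left)
      then have r1: "(r - 1) $ i = 0" if "i < m" for i
        using that by (simp only: fps_X_power_mult_nth) simp
      define v where "v = r * inverse U"
      have "v * U = r" by (simp only: v_def mult.assoc iU mult_1_right)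
      then have "\<forall>i<t - 1 - p. (v * U) $ i = (1 ^ Suc p) $ i" using r1 by (simp add: m_def)
      moreover have "v\<^sup>2 * Z = 1 ^ n * (fps_const c + fps_const 0 * (fps_X * 1) ^ 0)"
      proof -
        have "v\<^sup>2 * Z = r\<^sup>2 * Q" by (simp only: v_def Q_def power_mult_distrib ac_simps)
        also have "\<dots> = fps_const c * (inverse Q * Q)" by (simp only: r mult.assoc)
        finally show ?thesis by (simp add: iQ)
      qed
      moreover have "v $ 0 \<noteq> 0" using r(2) i0 by (simp add: v_def)
      moreover have "normal_label n t p c 0 0" using special assms(3) c by (simp add: normal_label_def)
      moreover have "(1 :: 'k fps) $ 0 \<noteq> 0" by simp
      ultimately show ?thesis by blast
    next
      case False
      then obtain j H where j: "j < m" and H: "Q - fps_const c = fps_X ^ j * H" "H $ 0 \<noteq> 0"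
        by (rule fps_least_nonzero)
      have j1: "1 \<le> j"
      proof (rule ccontr)
        assume "\<not> 1 \<le> j"
        then have "(Q - fps_const c) $ 0 = H $ 0" using H(1) by simp
        then show False using H(2) by (simp add: c_def)
      qed
      obtain a where a: "a ^ j = H" "a $ 0 \<noteq> 0"
        using fps_unit_root[OF H(2), of j] j1 by auto
      define v where "v = a ^ Suc p * inverse U"
      have vU: "v * U = a ^ Suc p" by (simp only: v_def mult.assoc iU mult_1_right)
      have "Q = fps_const c + fps_const 1 * (fps_X * a) ^ j"
        using H(1) by (simp add: power_mult_distrib a algebra_simps)
      moreover have "v\<^sup>2 * Z = a ^ n * Q"
      proof -
        have "a ^ n = (a ^ Suc p)\<^sup>2" unfolding special(2) by (simp only: power_mult[symmetric] mult.commute)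
        then show ?thesis by (simp only: v_def Q_def power_mult_distrib ac_simps)
      qed
      ultimately have "v\<^sup>2 * Z = a ^ n * (fps_const c + fps_const 1 * (fps_X * a) ^ j)" by simp
      moreover have "v $ 0 \<noteq> 0" using a(2) i0 by (simp add: v_def fps_nth_power_0)
      moreover have "normal_label n t p c 1 j" using special assms(3) c j j1 by (simp add: normal_label_def m_def)
      ultimately show ?thesis using a(2) vU by metis
    qed
  qed
qed

context asg
begin

text \<open>Coordinates \<open>X\<close> of the algebra that satisfy the defining relations of the ideal with label \<open>(p, c, d, j)\<close>.\<close>

definition system :: "nat \<Rightarrow> 'k \<Rightarrow> 'k \<Rightarrow> nat \<Rightarrow> (nat \<Rightarrow> 'r) \<Rightarrow> bool" where
  "system p c d j X \<longleftrightarrow>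
     (\<forall>i k. 1 \<le> i \<and> i < k \<and> k \<le> h \<and> (i, k) \<noteq> (1, 2) \<longrightarrow> X i * X k \<asymp> 0) \<and>
     (\<forall>k. 3 \<le> k \<and> k \<le> h \<longrightarrow> X k ^ 2 \<asymp> X 1 ^ s) \<and>
     X 2 ^ 2 \<asymp> X 1 ^ (p + 1) * X 2 + (C c + C d * X 1 ^ j) * X 1 ^ n \<and>
     X 1 ^ t * X 2 \<asymp> 0 \<and>
     (\<forall>i\<in>{1..h}. X i \<in> M) \<and> M \<subseteq> lspan (mp 2) (X ` {1..h})"

end

context asg_plane
begin

text \<open>The orthonormal family is rescaled by \<open>\<kappa>\<close> since the new \<open>x\<close> has \<open>s\<close>-th power \<open>a(0)\<^sup>s x\<^sup>s\<close>. If \<open>B\<close> vanishes to order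
\<open>t - 1\<close>, then \<open>x B y = 0\<close>, and \<open>p = t - 1\<close> is taken with \<open>U = 1\<close>.\<close>

lemma exists_system: "\<exists>p c d j X. normal_label n t p c d j \<and> system p c d j X"
proof -
  obtain zs where zs: "onb zs {}" using exists_onb by blast
  have len: "length zs + 2 = h" by (rule onb_length[OF zs])
  have kz: "kills z" "z * z \<asymp> x ^ s" if "z \<in> set zs" for z using zs that by (auto simp: onb_def)
  have "\<exists>p U B'. p < t \<and> U $ 0 \<noteq> 0 \<and> B = fps_X ^ p * U + fps_X ^ (t - 1) * B'"
  proof (cases "\<forall>i<t - 1. B $ i = 0")
    case True
    then obtain B' where "B = fps_X ^ (t - 1) * B'" using fps_factor[of "t - 1" B] by blast
    then have "B = fps_X ^ (t - 1) * 1 + fps_X ^ (t - 1) * (B' - 1)" by (simp add: algebra_simps)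
    moreover have "t - 1 < t" "(1 :: 'k fps) $ 0 \<noteq> 0" using t by auto
    ultimately show ?thesis by blast
  next
    case False
    then obtain p U where "p < t - 1" "B = fps_X ^ p * U" "U $ 0 \<noteq> 0" by (rule fps_least_nonzero)
    then have "p < t \<and> U $ 0 \<noteq> 0 \<and> B = fps_X ^ p * U + fps_X ^ (t - 1) * 0" by simp
    then show ?thesis by blast
  qed
  then obtain p U B' where p: "p < t" and U: "U $ 0 \<noteq> 0" and BU: "B = fps_X ^ p * U + fps_X ^ (t - 1) * B'"
    by blast
  obtain a v c d j where a: "a $ 0 \<noteq> 0" and v: "v $ 0 \<noteq> 0" and label: "normal_label n t p c d j"
    and vU: "\<And>i. i < t - 1 - p \<Longrightarrow> (v * U) $ i = (a ^ Suc p) $ i"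
    and vZ: "v\<^sup>2 * Z = a ^ n * (fps_const c + fps_const d * (fps_X * a) ^ j)"
    using normal_form_choice[OF U Z0 p t, of n] by blast
  obtain \<kappa> where \<kappa>: "\<kappa> ^ 2 = (a $ 0) ^ s" using nth_root_exists[of 2 "(a $ 0) ^ s"] by auto
  then have k0: "\<kappa> \<noteq> 0" using a by auto
  define X1 where "X1 = ev (fps_X * a)"
  define X2 where "X2 = ev v * y"
  define X where "X = (\<lambda>i. if i = 1 then X1 else if i = 2 then X2 else C \<kappa> * zs ! (i - 3))"
  have X: "X 1 = X1" "X 2 = X2" "X (Suc 0) = X1" by (simp_all add: X_def)
  have Xk: "\<exists>z\<in>set zs. X k = C \<kappa> * z" if "3 \<le> k" "k \<le> h" for k
    using that len by (auto simp: X_def intro!: bexI[of _ "zs ! (k - 3)"])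
  have X1pr: "X1 = pr (fps_X * a) 0" by (simp add: X1_def pr_ev)
  have X2pr: "X2 = pr 0 v" by (simp add: X2_def pr_def)
  have X1p: "X1 ^ m \<asymp> pr (fps_X ^ m * a ^ m) 0" for m
    using cg_sym[OF ev_power[of "fps_X * a" m]] by (simp add: X1_def pr_ev power_mult_distrib)
  have X1x: "X1 \<asymp> x * ev a" using ev_shift[of 1 a] by (simp add: X1_def)
  have X1M: "X1 \<in> M" by (rule cg_idl[OF M_idl I_M X1x idl_mult2[OF M_idl x]])
  have X2M: "X2 \<in> M" unfolding X2_def by (rule M_scale[OF y])
  have kill: "X1 * z \<asymp> 0" "X2 * z \<asymp> 0" if "kills z" for z
  proof -
    have "X1 * z \<asymp> x * ev a * z" by (rule cg_mult_r[OF X1x])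
    also have "\<dots> = ev a * (x * z)" by (simp add: ac_simps)
    also have "\<dots> \<asymp> 0" using that unfolding kills_def by (blast intro: cg_mult_0(1))
    finally show "X1 * z \<asymp> 0" .
    have "X2 * z = ev v * (y * z)" by (simp add: X2_def ac_simps)
    also have "\<dots> \<asymp> 0" using that unfolding kills_def by (blast intro: cg_mult_0(1))
    finally show "X2 * z \<asymp> 0" .
  qed
  have X1s: "X1 ^ s \<asymp> C ((a $ 0) ^ s) * x ^ s"
  proof -
    have "X1 ^ s \<asymp> ev (fps_X ^ s * a ^ s)" using X1p by (simp add: pr_ev)
    also have "\<dots> \<asymp> x ^ s * ev (a ^ s)" by (rule ev_shift)
    also have "\<dots> \<asymp> x ^ s * C ((a ^ s) $ 0)" by (rule ev_top) simp
    finally show ?thesis by (simp add: fps_nth_power_0 mult.commute)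
  qed
  have "X i * X k \<asymp> 0" if ik: "1 \<le> i" "i < k" "k \<le> h" "(i, k) \<noteq> (1, 2)" for i k
  proof -
    have k3: "3 \<le> k" using ik by (cases "k = 2") auto
    then obtain z where z: "z \<in> set zs" "X k = C \<kappa> * z" using Xk ik by blast
    consider "i = 1" | "i = 2" | "3 \<le> i" using ik by linarith
    then have "X i * z \<asymp> 0"
    proof cases
      case 3
      have "sorted_wrt (\<lambda>a b. a * b \<asymp> 0) zs" using zs by (simp add: onb_def)
      moreover have "i - 3 < k - 3" "k - 3 < length zs" using 3 ik len by auto
      ultimately have "zs ! (i - 3) * zs ! (k - 3) \<asymp> 0" by (rule sorted_wrt_nth_less)
      then have "C \<kappa> * (zs ! (i - 3) * zs ! (k - 3)) \<asymp> 0" by (rule cg_mult_0(1))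
      then have "C \<kappa> * (C \<kappa> * (zs ! (i - 3) * zs ! (k - 3))) \<asymp> 0" by (rule cg_mult_0(1))
      then have "X i * X k \<asymp> 0" using 3 k3 by (simp add: X_def ac_simps)
      then have "C \<kappa> * (X i * z) \<asymp> 0" by (simp add: z(2) ac_simps)
      then show ?thesis using k0 C_mult_cg_0_iff by blast
    qed (use kill kz z X in auto)
    then show ?thesis using cg_mult_0(1)[of "X i * z" "C \<kappa>"] by (simp add: z(2) ac_simps)
  qed
  moreover have "X k ^ 2 \<asymp> X 1 ^ s" if k: "3 \<le> k" "k \<le> h" for k
  proof -
    obtain z where z: "z \<in> set zs" "X k = C \<kappa> * z" using Xk k by blast
    have "X k ^ 2 = C (\<kappa> ^ 2) * (z * z)" by (simp add: z(2) power2_eq_square C_mult ac_simps)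
    also have "\<dots> \<asymp> C ((a $ 0) ^ s) * x ^ s" unfolding \<kappa> by (intro cg_mult_l kz z)
    also have "\<dots> \<asymp> X 1 ^ s" unfolding X by (rule cg_sym[OF X1s])
    finally show ?thesis .
  qed
  moreover have "X 2 ^ 2 \<asymp> X 1 ^ (p + 1) * X 2 + (C c + C d * X 1 ^ j) * X 1 ^ n"
  proof -
    let ?Z = "fps_const c + fps_const d * (fps_X ^ j * a ^ j)"
    have "X1 ^ (p + 1) * X2 \<asymp> pr (fps_X ^ (p + 1) * a ^ (p + 1)) 0 * pr 0 v"
      unfolding X2pr by (rule cg_mult_r[OF X1p])
    also have "\<dots> \<asymp> pr 0 (fps_X ^ (p + 1) * a ^ (p + 1) * v)"
      using pr_mult[of "fps_X ^ (p + 1) * a ^ (p + 1)" 0 0 v] by simp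
    finally have 1: "X1 ^ (p + 1) * X2 \<asymp> pr 0 (fps_X ^ (p + 1) * a ^ (p + 1) * v)" .
    have "(C c + C d * X1 ^ j) * X1 ^ n
        \<asymp> (ev (fps_const c) + ev (fps_const d) * ev (fps_X ^ j * a ^ j)) * ev (fps_X ^ n * a ^ n)"
      using X1p by (intro cg_mult cg_add cg_sym[OF ev_const]) (simp_all add: pr_ev)
    also have "\<dots> \<asymp> ev ?Z * ev (fps_X ^ n * a ^ n)"
      unfolding ev_add by (intro cg_mult_r cg_add cg_refl cg_sym[OF ev_mult])
    also have "\<dots> \<asymp> pr (?Z * (fps_X ^ n * a ^ n)) 0" unfolding pr_ev by (rule cg_sym[OF ev_mult])
    finally have 2: "(C c + C d * X1 ^ j) * X1 ^ n \<asymp> pr (?Z * (fps_X ^ n * a ^ n)) 0" .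
    have "X2 ^ 2 = pr 0 v * pr 0 v" by (simp add: X2pr power2_eq_square)
    also note pr_mult
    also have "pr (0 * 0 + fps_X ^ n * (v * v * Z)) (0 * v + 0 * v + fps_X * (v * v * B))
        \<asymp> pr (?Z * (fps_X ^ n * a ^ n)) (fps_X ^ (p + 1) * a ^ (p + 1) * v)"
    proof (rule pr_cong)
      fix i assume "i < Suc s"
      have "fps_X ^ n * (v * v * Z) = ?Z * (fps_X ^ n * a ^ n)"
        using vZ by (simp add: power2_eq_square power_mult_distrib ac_simps)
      then show "(0 * 0 + fps_X ^ n * (v * v * Z)) $ i = (?Z * (fps_X ^ n * a ^ n)) $ i"
        by (simp only: mult_zero_left add_0_left)
    next
      fix i assume i: "i < t"
      have t1: "fps_X ^ t = fps_X * (fps_X :: 'k fps) ^ (t - 1)" using t by (cases t) auto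
      obtain H where H: "v * U - a ^ Suc p = fps_X ^ (t - 1 - p) * H"
        using fps_factor[of "t - 1 - p" "v * U - a ^ Suc p"] vU by auto
      have "p + 1 + (t - 1 - p) = t" using p by simp
      then have pt: "fps_X ^ t = fps_X ^ (p + 1) * (fps_X :: 'k fps) ^ (t - 1 - p)"
        by (simp only: power_add[symmetric])
      have "fps_X * (v * v * B) - fps_X ^ (p + 1) * a ^ (p + 1) * v
          = fps_X ^ (p + 1) * v * (v * U - a ^ Suc p) + fps_X ^ t * (v * v * B')"
        unfolding BU t1 by (simp add: algebra_simps)
      also have "\<dots> = fps_X ^ t * (v * H + v * v * B')" unfolding H pt by (simp add: algebra_simps)
      finally have "(fps_X * (v * v * B) - fps_X ^ (p + 1) * a ^ (p + 1) * v) $ i = 0"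
        using i by (simp only: fps_X_power_mult_nth) simp
      then show "(0 * v + 0 * v + fps_X * (v * v * B)) $ i = (fps_X ^ (p + 1) * a ^ (p + 1) * v) $ i"
        by simp
    qed
    also have "\<dots> = pr 0 (fps_X ^ (p + 1) * a ^ (p + 1) * v) + pr (?Z * (fps_X ^ n * a ^ n)) 0"
      by (simp add: pr_add)
    also have "\<dots> \<asymp> X1 ^ (p + 1) * X2 + (C c + C d * X1 ^ j) * X1 ^ n"
      by (intro cg_add cg_sym[OF 1] cg_sym[OF 2])
    finally show ?thesis by (simp only: X)
  qed
  moreover have "X 1 ^ t * X 2 \<asymp> 0"
  proof -
    have "X1 ^ t * X2 \<asymp> ev (fps_X ^ t * a ^ t) * X2" using cg_mult_r[OF X1p] by (simp add: pr_ev)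
    also have "\<dots> \<asymp> x ^ t * ev (a ^ t) * X2" by (intro cg_mult_r ev_shift)
    also have "\<dots> = ev (a ^ t) * ev v * (x ^ t * y)" by (simp add: X2_def ac_simps)
    also have "\<dots> \<asymp> 0" by (rule cg_mult_0(1)[OF xty])
    finally show ?thesis by (simp only: X)
  qed
  moreover have XM: "X i \<in> M" if i: "i \<in> {1..h}" for i
  proof -
    have "i = 1 \<or> i = 2 \<or> 3 \<le> i" using i by (auto simp del: One_nat_def)
    then consider "i = 1" | "i = 2" | "3 \<le> i" by blast
    then show ?thesis
    proof cases
      case 3
      then obtain z where "z \<in> set zs" "X i = C \<kappa> * z" using Xk i by auto
      then show ?thesis using kz(1)[of z] by (simp add: kills_def M_scale)
    qed (use X X1M X2M in auto)
  qed
  moreover have "M \<subseteq> lspan (mp 2) (X ` {1..h})"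
  proof -
    let ?L = "lspan (mp 2) (X ` {1..h})"
    have L: "X i \<in> ?L" if "i \<in> {1..h}" for i using lspan_superset(2)[of "X ` {1..h}" "mp 2"] that by blast
    have m2L: "mp 2 \<subseteq> ?L" by (rule lspan_superset(1))
    have unscale: "w \<in> ?L" if "c \<noteq> 0" "C c * w - u \<in> mp 2" "u \<in> ?L" for c w u
    proof -
      have "(C c * w - u) + u \<in> ?L" using that m2L by (intro lin_add[OF lspan_lin]) auto
      then have "C (inverse c) * (C c * w) \<in> ?L" using lin_scale[OF lspan_lin] by simp
      then show ?thesis using C_inverse[OF that(1)] by (simp only: mult.assoc[symmetric] mult_1_left)
    qed
    have ev_diff: "ev F * w - C (F $ 0) * w \<in> mp 2" if "w \<in> M" for F w
    proof -
      obtain G where "ev F \<asymp> C (F $ 0) + x * ev G" using ev_decomp by blast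
      then have "ev F * w - C (F $ 0) * w \<asymp> (C (F $ 0) + x * ev G) * w - C (F $ 0) * w"
        by (intro cg_diff cg_mult_r cg_refl)
      also have "\<dots> = ev G * (x * w)" by (simp add: algebra_simps)
      finally show ?thesis using idl_mult[OF mp_idl M_mult[OF x that]] by (rule mp_cg)
    qed
    have "x \<in> ?L"
    proof (rule unscale[OF a])
      have "C (a $ 0) * x - X1 = - ((X1 - x * ev a) + (ev a * x - C (a $ 0) * x))" by (simp add: algebra_simps)
      also have "\<dots> \<in> mp 2" using X1x I_mp ev_diff[OF x]
        by (intro idl_minus[OF mp_idl] idl_add[OF mp_idl]) (auto simp: cg_def)
      finally show "C (a $ 0) * x - X 1 \<in> mp 2" by (simp only: X)
      show "X 1 \<in> ?L" by (rule L) (use h in auto)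
    qed
    moreover have "y \<in> ?L"
    proof (rule unscale[OF v])
      show "C (v $ 0) * y - X 2 \<in> mp 2"
        using idl_minus[OF mp_idl ev_diff[OF y, of v]] by (simp add: X X2_def)
      show "X 2 \<in> ?L" by (rule L) (use h in auto)
    qed
    moreover have "z \<in> ?L" if z: "z \<in> set zs" for z
    proof -
      obtain i where i: "i < length zs" "z = zs ! i" using z by (metis in_set_conv_nth)
      show ?thesis
      proof (rule unscale[OF k0])
        show "C \<kappa> * z - X (i + 3) \<in> mp 2" using idl_0[OF mp_idl] by (simp add: X_def i)
        show "X (i + 3) \<in> ?L" by (rule L) (use i len in auto)
      qed
    qed
    ultimately have "{x, y} \<union> set zs \<union> {} \<subseteq> ?L" by blast
    then have "lspan (mp 2) ({x, y} \<union> set zs \<union> {}) \<subseteq> ?L" by (rule lspan_mono)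
    moreover have "M \<subseteq> lspan (mp 2) ({x, y} \<union> set zs \<union> {})" using zs by (simp add: onb_def)
    ultimately show ?thesis by blast
  qed
  ultimately have "system p c d j X" unfolding system_def by blast
  then show ?thesis using label by blast
qed

end

lemma (in asg) system_exists: "\<exists>p c d j X. normal_label n t p c d j \<and> system p c d j X"
proof -
  obtain x y where "coords C I M h s t x y" using exists_coords by blast
  then interpret coords C I M h s t x y .
  obtain B Z where "y * y \<asymp> x * ev B * y + x ^ n * ev Z" using y_square by blast
  then interpret asg_plane C I M h s t x y B Z by unfold_locales
  show ?thesis by (rule exists_system)
qed

section \<open>Uniqueness of the normal form\<close>

context asg
begin

lemma top_not_in_I: "\<not> mp s \<subseteq> I"
proof
  assume "mp s \<subseteq> I"
  then have "mp s \<subseteq> lspan I (set [])" by (simp add: lspan_empty I_lin)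
  then show False using qdim_le[OF dim_top, of "[]"] by simp
qed

lemma lin_mult_set:
  assumes "lin L"
  shows "lin {f. f * w \<in> L}"
  unfolding lin_def
  using lin_0[OF assms] lin_add[OF assms] lin_scale[OF assms] by (auto simp: distrib_right mult.assoc)

text \<open>The relations express every product of two coordinates in terms of \<open>x\<^sup>2\<close> and \<open>x y\<close>, and \<open>x\<^sup>s = 0\<close> would make the
top power of the maximal ideal vanish.\<close>

lemma system_coords:
  assumes sys: "system p c d j X"
  shows "coords C I M h s t (X 1) (X 2)"
proof -
  let ?x = "X 1" and ?y = "X 2"
  let ?J = "{f. \<exists>u v. f \<asymp> ?x * (u * ?x + v * ?y)}"
  have prod: "X i * X k \<asymp> 0" if "1 \<le> i" "i < k" "k \<le> h" "(i, k) \<noteq> (1, 2)" for i k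
    using sys that unfolding system_def by blast
  have sq: "X k ^ 2 \<asymp> ?x ^ s" if "3 \<le> k" "k \<le> h" for k
    using sys that unfolding system_def by blast
  have XM: "X i \<in> M" if "i \<in> {1..h}" for i using sys that unfolding system_def by blast
  have y2: "?y ^ 2 \<asymp> ?x ^ (p + 1) * ?y + (C c + C d * ?x ^ j) * ?x ^ n"
    and xty: "?x ^ t * ?y \<asymp> 0" and span: "M \<subseteq> lspan (mp 2) (X ` {1..h})"
    using sys unfolding system_def by blast+
  have idlJ: "idl ?J" and IJ: "I \<subseteq> ?J" by (rule idl_two, rule I_idl_two)
  have XX: "X i * X k \<in> ?J" if "i \<in> {1..h}" "k \<in> {1..h}" for i k
  proof -
    have *: "X i * X k \<in> ?J" if ik: "1 \<le> i" "i \<le> k" "k \<le> h" for i k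
    proof (cases "i = k")
      case False
      show ?thesis
      proof (cases "(i, k) = (1, 2)")
        case True
        then have "X i * X k \<asymp> ?x * (0 * ?x + 1 * ?y)" by simp
        then show ?thesis by blast
      next
        case False
        then have "X i * X k \<asymp> 0" using ik \<open>i \<noteq> k\<close> by (intro prod) auto
        then show ?thesis using IJ by (auto simp: cg_0_iff)
      qed
    next
      case True
      have "i = 1 \<or> i = 2 \<or> 3 \<le> i" using ik by (auto simp del: One_nat_def)
      then consider "i = 1" | "i = 2" | "3 \<le> i" by blast
      then show ?thesis
      proof cases
        case 1
        then have "X i * X k \<asymp> ?x * (1 * ?x + 0 * ?y)" using True by simp
        then show ?thesis by blast
      next
        case 2
        obtain m where m: "n = Suc (Suc m)" using n_t t by (metis Suc_le_D less_imp_le numeral_2_eq_2 order_trans Suc_le_mono)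
        have "X i * X k = ?y ^ 2" using 2 True by (simp add: power2_eq_square)
        also note y2
        also have "?x ^ (p + 1) * ?y + (C c + C d * ?x ^ j) * ?x ^ n
            = ?x * (((C c + C d * ?x ^ j) * ?x ^ m) * ?x + ?x ^ p * ?y)"
          by (simp add: m algebra_simps)
        finally show ?thesis by blast
      next
        case 3
        obtain m where m: "s = Suc (Suc m)" using st t by (cases s; cases "s - 1") auto
        have "X i * X k = X k ^ 2" using True by (simp add: power2_eq_square)
        also have "\<dots> \<asymp> ?x ^ s" using 3 ik True by (intro sq) auto
        also have "?x ^ s = ?x * (?x ^ m * ?x + 0 * ?y)" by (simp add: m ac_simps)
        finally show ?thesis by blast
      qed
    qed
    show ?thesis using *[of i k] *[of k i] that by (cases "i \<le> k") (auto simp: mult.commute)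
  qed
  have "mp 2 \<subseteq> ?J"
  proof (rule nakayama[OF idlJ IJ])
    fix f assume f: "f \<in> mp 2"
    let ?L = "{f. \<exists>g\<in>?J. f - g \<in> mp (Suc 2)}"
    have L: "idl ?L" by (rule idl_sumset[OF idlJ mp_idl])
    have JL: "?J \<subseteq> ?L"
    proof
      fix g assume "g \<in> ?J"
      moreover have "g - g \<in> mp (Suc 2)" using idl_0[OF mp_idl] by simp
      ultimately show "g \<in> ?L" by blast
    qed
    have m3L: "mp (Suc 2) \<subseteq> ?L"
    proof
      fix g assume "g \<in> mp (Suc 2)"
      then have "g - 0 \<in> mp (Suc 2)" by simp
      moreover have "0 \<in> ?J" by (rule idl_0[OF idlJ])
      ultimately show "g \<in> ?L" by blast
    qed
    have m2M: "a * b \<in> ?L" if "a \<in> M" "b \<in> mp 2" for a b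
      using mp_prod[OF that] m3L by auto
    have XM': "M \<subseteq> {a. a * X k \<in> ?L}" if k: "k \<in> {1..h}" for k
    proof (rule subset_trans[OF span lspan_least[OF lin_mult_set[OF idl_lin[OF L]]]])
      show "mp 2 \<subseteq> {a. a * X k \<in> ?L}"
        using m2M[OF XM[OF k]] by (auto simp: mult.commute)
      show "X ` {1..h} \<subseteq> {a. a * X k \<in> ?L}" using XX k JL by blast
    qed
    have "M \<subseteq> {b. b * a \<in> ?L}" if a: "a \<in> M" for a
    proof (rule subset_trans[OF span lspan_least[OF lin_mult_set[OF idl_lin[OF L]]]])
      show "mp 2 \<subseteq> {b. b * a \<in> ?L}" using m2M[OF a] by (auto simp: mult.commute)
      show "X ` {1..h} \<subseteq> {b. b * a \<in> ?L}"
      proof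
        fix b assume "b \<in> X ` {1..h}"
        then obtain k where "k \<in> {1..h}" "b = X k" by blast
        have "a * X k \<in> ?L" using XM'[OF \<open>k \<in> {1..h}\<close>] a by blast
        moreover have "a * X k = b * a" unfolding \<open>b = X k\<close> by (rule mult.commute)
        ultimately show "b \<in> {b. b * a \<in> ?L}" by (simp only: mem_Collect_eq)
      qed
    qed
    then have MM: "a * b \<in> ?L" if "a \<in> M" "b \<in> M" for a b using that by blast
    have "mp (Suc (Suc 0)) \<subseteq> ?L"
      by (rule mp_least[OF L]) (use IJ JL MM mp_1 in auto)
    then show "\<exists>g\<in>?J. f - g \<in> mp (Suc 2)" using f by (auto simp: numeral_2_eq_2)
  qed
  then have m2: "\<exists>u v. f \<asymp> ?x * (u * ?x + v * ?y)" if "f \<in> mp 2" for f using that by blast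
  have xM: "?x \<in> M" and yM: "?y \<in> M" using XM h by auto
  have "?x ^ s \<notin> I"
  proof
    assume xs: "?x ^ s \<in> I"
    obtain m where m: "s = Suc (Suc m)" using st t by (cases s; cases "s - 1") auto
    have "mp s \<subseteq> I"
    proof
      fix f assume "f \<in> mp s"
      then obtain u v where uv: "f \<asymp> ?x ^ Suc m * (u * ?x + v * ?y)"
        using m2_powers[OF xM yM m2] unfolding m by blast
      have "Suc m = (s - 1 - t) + t" using m st t by simp
      then have "?x ^ Suc m * ?y = ?x ^ (s - 1 - t) * (?x ^ t * ?y)" by (simp only: power_add mult.assoc)
      then have 1: "?x ^ Suc m * ?y \<asymp> 0" using cg_mult_0(1)[OF xty] by simp
      have "?x ^ Suc m * (u * ?x + v * ?y) = u * ?x ^ s + v * (?x ^ Suc m * ?y)"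
        by (simp add: m algebra_simps)
      also have "\<dots> \<asymp> 0" using xs by (intro cg_add_0 cg_mult_0(1) 1) (simp add: cg_0_iff)
      finally have "?x ^ Suc m * (u * ?x + v * ?y) \<asymp> 0" .
      from cg_trans[OF uv this] show "f \<in> I" by (simp only: cg_0_iff)
    qed
    then show False using top_not_in_I by blast
  qed
  then show ?thesis using xM yM xty m2 by unfold_locales
qed

end

declare One_nat_def [simp del]

text \<open>The relations are separated from the dimension hypotheses, so that they serve both for an algebra
with given coordinates and for the model ideals themselves.\<close>

locale rel_alg = plane C I "X 1" "Suc s" "X 2" t n "fps_X ^ p" Z
  for C :: "'k::field_char_0 \<Rightarrow> 'r::comm_ring_1" and I and X :: "nat \<Rightarrow> 'r" and s t n p Z +
  fixes h :: nat
  assumes X_prod: "1 \<le> i \<Longrightarrow> i < k \<Longrightarrow> k \<le> h \<Longrightarrow> (i, k) \<noteq> (1, 2) \<Longrightarrow> X i * X k \<asymp> 0"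
    and X_sq: "3 \<le> k \<Longrightarrow> k \<le> h \<Longrightarrow> X k ^ 2 \<asymp> X 1 ^ s"
begin

abbreviation K :: "nat set" where "K \<equiv> {3..h}"

definition sz :: "(nat \<Rightarrow> 'k) \<Rightarrow> 'r" where
  "sz l = (\<Sum>k\<in>K. C (l k) * X k)"

lemma sz_add: "sz l + sz l' = sz (\<lambda>k. l k + l' k)"
  by (simp add: sz_def C_add algebra_simps sum.distrib)

lemma sz_scale: "C a * sz l = sz (\<lambda>k. a * l k)"
  by (simp add: sz_def C_mult sum_distrib_left ac_simps)

lemma sz_0: "sz (\<lambda>_. 0) = 0"
  by (simp add: sz_def)

lemma sz_unit: "k \<in> K \<Longrightarrow> sz (\<lambda>i. if i = k then 1 else 0) = X k"
proof -
  assume "k \<in> K"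
  have "sz (\<lambda>i. if i = k then 1 else 0) = (\<Sum>i\<in>K. if i = k then X k else 0)"
    unfolding sz_def by (rule sum.cong) auto
  then show ?thesis using \<open>k \<in> K\<close> by simp
qed

lemma X12_K: "k \<in> K \<Longrightarrow> X 1 * X k \<asymp> 0" "k \<in> K \<Longrightarrow> X 2 * X k \<asymp> 0"
  by (rule X_prod; simp)+

lemma x_sz: "X 1 * sz l \<asymp> 0"
proof -
  have "X 1 * sz l = (\<Sum>k\<in>K. C (l k) * (X 1 * X k))" by (simp add: sz_def sum_distrib_left ac_simps)
  also have "\<dots> \<asymp> (\<Sum>k\<in>K. 0)" by (intro cg_sum cg_mult_0(1) X12_K)
  finally show ?thesis by simp
qed

lemma y_sz: "X 2 * sz l \<asymp> 0"
proof -
  have "X 2 * sz l = (\<Sum>k\<in>K. C (l k) * (X 2 * X k))" by (simp add: sz_def sum_distrib_left ac_simps)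
  also have "\<dots> \<asymp> (\<Sum>k\<in>K. 0)" by (intro cg_sum cg_mult_0(1) X12_K)
  finally show ?thesis by simp
qed

lemma X_sz: "k \<in> K \<Longrightarrow> X k * sz l \<asymp> C (l k) * X 1 ^ s"
proof -
  assume k: "k \<in> K"
  have "X k * sz l = (\<Sum>i\<in>K. C (l i) * (X k * X i))" by (simp add: sz_def sum_distrib_left ac_simps)
  also have "\<dots> \<asymp> (\<Sum>i\<in>K. if i = k then C (l k) * X 1 ^ s else 0)"
  proof (rule cg_sum)
    fix i assume i: "i \<in> K"
    consider "i = k" | "i < k" | "k < i" by linarith
    then show "C (l i) * (X k * X i) \<asymp> (if i = k then C (l k) * X 1 ^ s else 0)"
    proof cases
      case 1
      then show ?thesis using cg_mult_l[OF X_sq[of k]] k by (simp add: power2_eq_square)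
    next
      case 2
      then show ?thesis using cg_mult_0(1)[OF X_prod[of i k]] i k by (simp add: mult.commute)
    next
      case 3
      then show ?thesis using cg_mult_0(1)[OF X_prod[of k i]] i k by simp
    qed
  qed
  finally show ?thesis using k by simp
qed

lemma sz_sz: "sz l' * sz l \<asymp> C (\<Sum>k\<in>K. l' k * l k) * X 1 ^ s"
proof -
  have "sz l' * sz l = (\<Sum>k\<in>K. C (l' k) * (X k * sz l))"
    unfolding sz_def[of l'] by (simp only: sum_distrib_right mult.assoc)
  also have "\<dots> \<asymp> (\<Sum>k\<in>K. C (l' k) * (C (l k) * X 1 ^ s))"
    by (intro cg_sum cg_mult_l X_sz)
  also have "\<dots> = C (\<Sum>k\<in>K. l' k * l k) * X 1 ^ s"
    by (simp add: C_sum C_mult sum_distrib_left ac_simps)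
  finally show ?thesis .
qed

end

locale asg_system = asg C I M h s t
  for C :: "'k::{alg_closed_field, field_char_0} \<Rightarrow> 'r::comm_ring_1" and I M h s t +
  fixes p :: nat and c d :: 'k and j :: nat and X :: "nat \<Rightarrow> 'r"
  assumes sys: "system p c d j X"
begin

sublocale coords C I M h s t "X 1" "X 2"
  by (rule system_coords[OF sys])

lemma X_M: "i \<in> {1..h} \<Longrightarrow> X i \<in> M"
  and X_y2: "X 2 ^ 2 \<asymp> X 1 ^ (p + 1) * X 2 + (C c + C d * X 1 ^ j) * X 1 ^ n"
  and X_span: "M \<subseteq> lspan (mp 2) (X ` {1..h})"
  using sys unfolding system_def by blast+

definition Zp :: "'k fps" where "Zp = fps_const c + fps_const d * fps_X ^ j"

lemma ev_Zp: "ev Zp \<asymp> C c + C d * X 1 ^ j"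
  unfolding Zp_def ev_add
  by (intro cg_add ev_const cg_trans[OF ev_mult] cg_mult ev_X_power)

sublocale asg_plane C I M h s t "X 1" "X 2" "fps_X ^ p" Zp
proof unfold_locales
  have "X 2 * X 2 = X 2 ^ 2" by (simp add: power2_eq_square)
  also note X_y2
  also have "X 1 ^ (p + 1) * X 2 + (C c + C d * X 1 ^ j) * X 1 ^ n
      = X 1 * X 1 ^ p * X 2 + X 1 ^ n * (C c + C d * X 1 ^ j)" by (simp add: power_add ac_simps)
  also have "\<dots> \<asymp> X 1 * ev (fps_X ^ p) * X 2 + X 1 ^ n * ev Zp"
    by (intro cg_add cg_mult_r cg_mult_l cg_sym[OF ev_X_power] cg_sym[OF ev_Zp])
  finally show "X 2 * X 2 \<asymp> X 1 * ev (fps_X ^ p) * X 2 + X 1 ^ n * ev Zp" .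
qed

sublocale rel_alg C I X s t n p Zp h
  by unfold_locales (use sys in \<open>unfold system_def, blast\<close>)+

lemma M_xs: "f \<in> M \<Longrightarrow> f * X 1 ^ s \<asymp> 0"
  using mp_prod[OF _ M_power[OF x, of s]] mp_top by (auto simp: cg_0_iff)

lemma pr_sz: "F $ 0 = 0 \<Longrightarrow> pr F G * sz l \<asymp> 0"
proof -
  assume F: "F $ 0 = 0"
  obtain H where "ev F \<asymp> C (F $ 0) + X 1 * ev H" using ev_decomp by blast
  then have "ev F * sz l \<asymp> X 1 * ev H * sz l" using F by (simp add: cg_mult_r)
  then have "ev F * sz l + ev G * (X 2 * sz l) \<asymp> ev H * (X 1 * sz l) + ev G * (X 2 * sz l)"
    by (intro cg_add) (simp_all add: ac_simps)
  also have "\<dots> \<asymp> 0" by (intro cg_add_0 cg_mult_0(1) x_sz y_sz)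
  finally show ?thesis by (simp add: pr_def algebra_simps)
qed

lemma lin_sz_pr: "lin {f. \<exists>F G l. F $ 0 = 0 \<and> f \<asymp> pr F G + sz l}" (is "lin ?L")
  unfolding lin_def
proof (intro conjI ballI allI)
  have "(0 :: 'k fps) $ 0 = 0 \<and> 0 \<asymp> pr 0 0 + sz (\<lambda>_. 0)" by (simp add: pr_0 sz_0)
  then show "0 \<in> ?L" by blast
next
  fix f g assume "f \<in> ?L" "g \<in> ?L"
  then obtain F G l F' G' l' where *: "F $ 0 = 0" "f \<asymp> pr F G + sz l" "F' $ 0 = 0" "g \<asymp> pr F' G' + sz l'"
    by blast
  have "f + g \<asymp> (pr F G + sz l) + (pr F' G' + sz l')" by (rule cg_add[OF *(2,4)])
  also have "\<dots> = (pr F G + pr F' G') + (sz l + sz l')" by simp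
  also have "\<dots> = pr (F + F') (G + G') + sz (\<lambda>k. l k + l' k)" by (simp only: pr_add sz_add)
  finally have "(F + F') $ 0 = 0 \<and> f + g \<asymp> pr (F + F') (G + G') + sz (\<lambda>k. l k + l' k)" using * by simp
  then show "f + g \<in> ?L" by blast
next
  fix f a assume "f \<in> ?L"
  then obtain F G l where *: "F $ 0 = 0" "f \<asymp> pr F G + sz l" by blast
  have "C a * pr F G \<asymp> pr (fps_const a * F) (fps_const a * G)"
  proof -
    have "C a * pr F G \<asymp> pr (fps_const a) 0 * pr F G"
      using cg_mult_r[OF cg_sym[OF ev_const[of a]], of "pr F G"] by (simp add: pr_ev)
    also have "\<dots> \<asymp> pr (fps_const a * F) (fps_const a * G)"
      using pr_mult[of "fps_const a" 0 F G] by simp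
    finally show ?thesis .
  qed
  then have "C a * pr F G + C a * sz l \<asymp> pr (fps_const a * F) (fps_const a * G) + sz (\<lambda>k. a * l k)"
    unfolding sz_scale by (rule cg_add) simp
  then have "C a * f \<asymp> pr (fps_const a * F) (fps_const a * G) + sz (\<lambda>k. a * l k)"
    using cg_trans[OF cg_mult_l[OF *(2), of "C a"]] by (simp only: distrib_left)
  moreover have "(fps_const a * F) $ 0 = 0" using * by simp
  ultimately show "C a * f \<in> ?L" by blast
qed

lemma M_rep: "f \<in> M \<Longrightarrow> \<exists>F G l. F $ 0 = 0 \<and> f \<asymp> pr F G + sz l"
proof -
  let ?L = "{f. \<exists>F G l. F $ 0 = 0 \<and> f \<asymp> pr F G + sz l}"
  have "lspan (mp 2) (X ` {1..h}) \<subseteq> ?L"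
  proof (rule lspan_least[OF lin_sz_pr])
    show "mp 2 \<subseteq> ?L"
    proof
      fix f assume "f \<in> mp 2"
      then obtain F G where "f \<asymp> X 1 ^ 2 * ev F + X 1 * ev G * X 2" using m2_ev by blast
      then have FG: "f \<asymp> X 1 ^ 2 * ev F + X 1 ^ 1 * ev G * X 2" by simp
      note FG
      also have "X 1 ^ 2 * ev F + X 1 ^ 1 * ev G * X 2 \<asymp> pr (fps_X ^ 2 * F) (fps_X ^ 1 * G)"
        unfolding pr_def by (intro cg_add cg_mult_r cg_sym[OF ev_shift])
      finally have "(fps_X ^ 2 * F) $ 0 = 0 \<and> f \<asymp> pr (fps_X ^ 2 * F) (fps_X ^ 1 * G) + sz (\<lambda>_. 0)"
        by (simp add: sz_0)
      then show "f \<in> ?L" by blast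
    qed
    show "X ` {1..h} \<subseteq> ?L"
    proof
      fix f assume "f \<in> X ` {1..h}"
      then obtain i where i: "i \<in> {1..h}" "f = X i" by blast
      have "i = 1 \<or> i = 2 \<or> i \<in> K" using i by (auto simp del: One_nat_def)
      then consider "i = 1" | "i = 2" | "i \<in> K" by blast
      then show "f \<in> ?L"
      proof cases
        case 1
        have "f \<asymp> pr fps_X 0 + sz (\<lambda>_. 0)" using cg_sym[OF ev_X] 1 i by (simp add: sz_0 pr_ev)
        moreover have "(fps_X :: 'k fps) $ 0 = 0" by simp
        ultimately show ?thesis by blast
      next
        case 2
        have "f \<asymp> pr 0 1 + sz (\<lambda>_. 0)" using cg_sym[OF pr_0_1] 2 i by (simp add: sz_0)
        moreover have "(0 :: 'k fps) $ 0 = 0" by simp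
        ultimately show ?thesis by blast
      next
        case 3
        have "f \<asymp> pr 0 0 + sz (\<lambda>k. if k = i then 1 else 0)" using sz_unit[OF 3] i by (simp add: pr_0)
        moreover have "(0 :: 'k fps) $ 0 = 0" by simp
        ultimately show ?thesis by blast
      qed
    qed
  qed
  then show "f \<in> M \<Longrightarrow> ?thesis" using X_span by blast
qed

text \<open>Modulo the socle and the coordinates of index at least three the algebra is a plane algebra, in which two
systems can be compared.\<close>

definition I2 :: "'r set" where
  "I2 = {f. \<exists>a l. f \<asymp> C a * X 1 ^ s + sz l}"

lemma I2_idl: "idl I2"
proof (rule idlI)
  have "0 \<asymp> C 0 * X 1 ^ s + sz (\<lambda>_. 0)" by (simp add: sz_0)
  then show "0 \<in> I2" unfolding I2_def by blast
next
  fix f g assume "f \<in> I2" "g \<in> I2"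
  then obtain a l b l' where *: "f \<asymp> C a * X 1 ^ s + sz l" "g \<asymp> C b * X 1 ^ s + sz l'"
    unfolding I2_def by blast
  have "f + g \<asymp> (C a * X 1 ^ s + sz l) + (C b * X 1 ^ s + sz l')" by (rule cg_add[OF *])
  also have "\<dots> = C (a + b) * X 1 ^ s + (sz l + sz l')" by (simp add: C_add algebra_simps)
  finally show "f + g \<in> I2" unfolding I2_def sz_add by blast
next
  fix f g assume "f \<in> I2"
  then obtain a l where f: "f \<asymp> C a * X 1 ^ s + sz l" unfolding I2_def by blast
  obtain b where b: "g - C b \<in> M" using decomp by blast
  obtain F G l' where F: "F $ 0 = 0" and g: "g - C b \<asymp> pr F G + sz l'" using M_rep[OF b] by blast
  have szsz: "sz l' * sz l \<asymp> C (\<Sum>k\<in>K. l' k * l k) * X 1 ^ s" by (rule sz_sz)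
  have "(g - C b) * sz l \<asymp> (pr F G + sz l') * sz l" by (rule cg_mult_r[OF g])
  also have "\<dots> = pr F G * sz l + sz l' * sz l" by (rule distrib_right)
  also have "\<dots> \<asymp> 0 + C (\<Sum>k\<in>K. l' k * l k) * X 1 ^ s" by (rule cg_add[OF pr_sz[OF F] szsz])
  finally have gsz: "(g - C b) * sz l \<asymp> C (\<Sum>k\<in>K. l' k * l k) * X 1 ^ s" by simp
  have "g * f \<asymp> g * (C a * X 1 ^ s + sz l)" by (rule cg_mult_l[OF f])
  also have "\<dots> = C a * ((g - C b) * X 1 ^ s) + (g - C b) * sz l + C b * (C a * X 1 ^ s + sz l)"
    by (simp add: algebra_simps)
  also have "\<dots> \<asymp> 0 + C (\<Sum>k\<in>K. l' k * l k) * X 1 ^ s + C b * (C a * X 1 ^ s + sz l)"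
    by (intro cg_add cg_mult_0(1) M_xs b gsz cg_refl)
  also have "\<dots> = C ((\<Sum>k\<in>K. l' k * l k) + b * a) * X 1 ^ s + sz (\<lambda>k. b * l k)"
    by (simp add: C_add C_mult algebra_simps flip: sz_scale)
  finally show "g * f \<in> I2" unfolding I2_def by blast
qed

lemma I_I2: "I \<subseteq> I2"
proof
  fix f assume "f \<in> I"
  then have "f \<asymp> C 0 * X 1 ^ s + sz (\<lambda>_. 0)" by (simp add: sz_0 cg_0_iff)
  then show "f \<in> I2" unfolding I2_def by blast
qed

lemma rep_indep_sz:
  assumes "pr F G \<asymp> C a * X 1 ^ s + sz l"
  shows "k \<in> K \<Longrightarrow> l k = 0"
proof -
  have F0: "C (F $ 0) * X k \<asymp> C (l k) * X 1 ^ s" if k: "k \<in> K" for k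
  proof -
    obtain H where H: "ev F \<asymp> C (F $ 0) + X 1 * ev H" using ev_decomp by blast
    have "X k * pr F G = ev F * X k + ev G * (X 2 * X k)" by (simp add: pr_def algebra_simps)
    also have "\<dots> \<asymp> (C (F $ 0) + X 1 * ev H) * X k + 0"
      by (intro cg_add cg_mult_r H cg_mult_0(1) X12_K k)
    also have "\<dots> = C (F $ 0) * X k + ev H * (X 1 * X k)" by (simp add: algebra_simps)
    also have "\<dots> \<asymp> C (F $ 0) * X k + 0" by (intro cg_add cg_refl cg_mult_0(1) X12_K k)
    finally have 1: "X k * pr F G \<asymp> C (F $ 0) * X k" by simp
    have kM: "X k \<in> M" using k by (intro X_M) auto
    have "X k * pr F G \<asymp> X k * (C a * X 1 ^ s + sz l)" by (rule cg_mult_l[OF assms])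
    also have "\<dots> = C a * (X k * X 1 ^ s) + X k * sz l" by (simp add: algebra_simps)
    also have "\<dots> \<asymp> 0 + C (l k) * X 1 ^ s" by (intro cg_add cg_mult_0(1) M_xs kM X_sz k)
    finally show ?thesis using cg_trans[OF cg_sym[OF 1]] by simp
  qed
  have l: "l k = 0" if k: "k \<in> K" for k
  proof (rule ccontr)
    assume lk: "l k \<noteq> 0"
    have kM: "X k \<in> M" using k by (intro X_M) auto
    have "C (F $ 0) * X 1 ^ s \<asymp> C (F $ 0) * X k ^ 2"
      using k by (intro cg_mult_l cg_sym[OF X_sq]) auto
    also have "C (F $ 0) * X k ^ 2 = X k * (C (F $ 0) * X k)" by (simp add: power2_eq_square ac_simps)
    also have "\<dots> \<asymp> X k * (C (l k) * X 1 ^ s)" by (rule cg_mult_l[OF F0[OF k]])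
    also have "\<dots> = C (l k) * (X k * X 1 ^ s)" by (simp add: ac_simps)
    also have "\<dots> \<asymp> 0" by (intro cg_mult_0(1) M_xs kM)
    finally have "C (F $ 0) * X 1 ^ s \<in> I" by (simp add: cg_0_iff)
    then have "F $ 0 = 0" using xs C_mult_in_I_iff by blast
    then have "C (l k) * X 1 ^ s \<in> I" using cg_sym[OF F0[OF k]] by (simp add: cg_0_iff)
    then show False using lk xs C_mult_in_I_iff by blast
  qed
  then show "k \<in> K \<Longrightarrow> l k = 0" by blast
qed

lemma indep_I2:
  assumes "pr F G \<in> I2"
  shows "\<forall>i<s. F $ i = 0" "\<forall>i<t. G $ i = 0"
proof -
  obtain a l where FG: "pr F G \<asymp> C a * X 1 ^ s + sz l" using assms unfolding I2_def by blast
  have l: "l k = 0" if "k \<in> K" for k by (rule rep_indep_sz[OF FG that])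
  have "sz l = 0" unfolding sz_def using l by simp
  have "pr (F - fps_const a * fps_X ^ s) G = pr F G - ev (fps_const a * fps_X ^ s)"
    by (simp add: pr_def ev_diff)
  also have "\<dots> \<asymp> C a * X 1 ^ s - C a * X 1 ^ s"
    using FG \<open>sz l = 0\<close>
    by (intro cg_diff cg_trans[OF ev_mult] cg_mult ev_const ev_X_power) simp
  finally have 0: "pr (F - fps_const a * fps_X ^ s) G \<asymp> 0" by simp
  show "\<forall>i<t. G $ i = 0" using pr_eq_0(2)[OF 0] by blast
  show "\<forall>i<s. F $ i = 0"
  proof (intro allI impI)
    fix i assume "i < s"
    then show "F $ i = 0" using pr_eq_0(1)[OF 0, of i] by (simp add: fps_X_power_nth)
  qed
qed

text \<open>A vanishing combination is multiplied by the coordinates of index at least three to isolate \<open>l\<close>; the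
rest is the independence statement for the plane algebra generated by the first two coordinates.\<close>

lemma rep_indep:
  assumes "pr F G + sz l \<asymp> 0"
  shows "i < Suc s \<Longrightarrow> F $ i = 0" "i < t \<Longrightarrow> G $ i = 0" "k \<in> K \<Longrightarrow> l k = 0"
proof -
  have "pr F G = (pr F G + sz l) + C (- 1) * sz l" by (simp add: C_minus)
  also have "\<dots> \<asymp> 0 + C (- 1) * sz l" by (intro cg_add assms cg_refl)
  also have "\<dots> = C 0 * X 1 ^ s + sz (\<lambda>k. - 1 * l k)" by (simp only: sz_scale) simp
  finally have "pr F G \<asymp> C 0 * X 1 ^ s + sz (\<lambda>k. - 1 * l k)" .
  from rep_indep_sz[OF this] have l: "l k = 0" if "k \<in> K" for k using that by auto
  then show "k \<in> K \<Longrightarrow> l k = 0" .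
  have "sz l = 0" unfolding sz_def using l by simp
  then have "pr F G \<asymp> 0" using assms by simp
  note pr0 = this
  show "i < Suc s \<Longrightarrow> F $ i = 0" by (rule pr_eq_0(1)[OF pr0])
  show "i < t \<Longrightarrow> G $ i = 0" by (rule pr_eq_0(2)[OF pr0])
qed

lemma pr_M: "F $ 0 = 0 \<Longrightarrow> pr F G \<in> M"
proof -
  assume F: "F $ 0 = 0"
  obtain H where "ev F \<asymp> C (F $ 0) + X 1 * ev H" using ev_decomp by blast
  then have "ev F \<asymp> X 1 * ev H" using F by simp
  then have "ev F \<in> M" by (rule cg_idl[OF M_idl I_M _ idl_mult2[OF M_idl x]])
  then show ?thesis unfolding pr_def by (intro M_add M_scale y)
qed

text \<open>The product of a linear form in the coordinates of index at least three with itself lies in the socle, and its product with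
the first two coordinates is zero.\<close>

lemma power_rep:
  assumes "f \<asymp> pr F G + sz e" "F $ 0 = 0"
  shows "f ^ Suc (Suc (Suc m)) \<asymp> pr F G ^ Suc (Suc (Suc m))"
proof (induction m)
  case 0
  let ?P = "pr F G" and ?q = "C (\<Sum>k\<in>K. e k * e k) * X 1 ^ s"
  have Pe: "?P * sz e \<asymp> 0" by (rule pr_sz[OF assms(2)])
  have PM: "?P \<in> M" by (rule pr_M[OF assms(2)])
  have "sz e \<in> M" unfolding sz_def by (intro idl_sum[OF M_idl] M_scale X_M) auto
  then have fM: "?P + sz e \<in> M" using PM by (rule M_add[rotated])
  have "f ^ Suc (Suc (Suc 0)) \<asymp> (?P + sz e) ^ Suc (Suc (Suc 0))" by (rule cg_power[OF assms(1)])
  also have "(?P + sz e) ^ Suc (Suc (Suc 0))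
      = ?P ^ Suc (Suc (Suc 0)) + (3 * ?P + 2 * sz e) * (?P * sz e) + (?P + sz e) * (sz e * sz e)"
    by (simp add: algebra_simps)
  also have "\<dots> \<asymp> ?P ^ Suc (Suc (Suc 0)) + 0 + (?P + sz e) * ?q"
    by (intro cg_add cg_refl cg_mult_0(1) Pe cg_mult_l sz_sz)
  also have "\<dots> = ?P ^ Suc (Suc (Suc 0)) + C (\<Sum>k\<in>K. e k * e k) * ((?P + sz e) * X 1 ^ s)"
    by (simp add: algebra_simps)
  also have "\<dots> \<asymp> ?P ^ Suc (Suc (Suc 0)) + 0" by (intro cg_add cg_refl cg_mult_0(1) M_xs fM)
  finally show ?case by simp
next
  case (Suc m)
  let ?P = "pr F G"
  have "f ^ Suc (Suc (Suc (Suc m))) = f * f ^ Suc (Suc (Suc m))" by simp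
  also have "\<dots> \<asymp> (?P + sz e) * ?P ^ Suc (Suc (Suc m))" by (rule cg_mult[OF assms(1) Suc])
  also have "\<dots> = ?P ^ Suc (Suc (Suc (Suc m))) + ?P ^ Suc (Suc m) * (?P * sz e)" by (simp add: algebra_simps)
  also have "\<dots> \<asymp> ?P ^ Suc (Suc (Suc (Suc m))) + 0"
    by (intro cg_add cg_refl cg_mult_0(1) pr_sz assms)
  finally show ?case by simp
qed

text \<open>The leading coefficient \<open>a(0)\<close> cannot vanish, as \<open>x'\<^sup>s \<noteq> 0\<close>; likewise \<open>V(0)\<close>, as otherwise \<open>x'\<^sup>t\<^sup>-\<^sup>1 y'\<close> would lie in
\<open>\<mm>\<^sup>t\<^sup>+\<^sup>1\<close>. The comparison for plane algebras then applies modulo \<open>I2\<close>.\<close>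

lemma system_unique:
  assumes sys': "system p' c' d' j' X'" and p: "p < t" "p' < t"
  shows "p = p'"
    and "n = 2 * Suc p \<Longrightarrow> \<exists>a. a $ 0 \<noteq> 0 \<and>
      (\<forall>i<t - 1 - p. Zp $ i = (fps_const c' + fps_const d' * (fps_X * a) ^ j') $ i)"
proof -
  interpret S': asg_system C I M h s t p' c' d' j' X' by unfold_locales (rule sys')
  obtain F b e where F: "F $ 0 = 0" and x': "X' 1 \<asymp> pr F b + sz e" using M_rep[OF S'.x] by blast
  obtain W V f where W: "W $ 0 = 0" and y': "X' 2 \<asymp> pr W V + sz f" using M_rep[OF S'.y] by blast
  obtain a where a: "F = fps_X * a" using fps_factor[of 1 F] F by auto
  have a0: "a $ 0 \<noteq> 0"
  proof
    assume "a $ 0 = 0"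
    obtain m where m: "s = Suc (Suc (Suc m))"
      using st t by (cases s; cases "s - 1"; cases "s - 2") auto
    have "X' 1 ^ s \<asymp> pr F b ^ s" using power_rep[OF x' F, of m] by (simp only: m[symmetric])
    also obtain f g where fg: "pr F b ^ s \<asymp>
        pr (fps_X ^ s * a ^ s + fps_X ^ (s - 1 + n - 1) * f) (fps_X ^ (s - 1) * g)"
      using power_of_linear[OF n_t(2), of a b "s - 1"] m unfolding a by auto
    note fg
    also have "pr (fps_X ^ s * a ^ s + fps_X ^ (s - 1 + n - 1) * f) (fps_X ^ (s - 1) * g) \<asymp> pr 0 0"
    proof (rule pr_cong)
      fix i assume i: "i < Suc s"
      have "(fps_X ^ (s - 1 + n - 1) * f) $ i = 0"
        using i n_t(2) t m by (subst fps_X_power_mult_nth) simp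
      moreover have "(fps_X ^ s * a ^ s) $ i = 0"
        using i \<open>a $ 0 = 0\<close> m by (subst fps_X_power_mult_nth) (auto simp: fps_nth_power_0 not_less)
      ultimately show "(fps_X ^ s * a ^ s + fps_X ^ (s - 1 + n - 1) * f) $ i = 0 $ i" by simp
    next
      fix i assume "i < t"
      then have "i < s - 1" using st t by simp
      then show "(fps_X ^ (s - 1) * g) $ i = 0 $ i" by (simp only: fps_X_power_mult_nth) simp
    qed
    finally show False using S'.xs by (simp add: pr_0 cg_0_iff)
  qed
  interpret A2: alg_mod C I2 by unfold_locales (auto simp: C_add C_mult I2_idl)
  have cg2: "A2.cg f g" if "f \<asymp> g" for f g using that I_I2 unfolding cg_def A2.cg_def by blast
  have xs2: "X 1 ^ s \<in> I2"
  proof -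
    have "X 1 ^ s \<asymp> C 1 * X 1 ^ s + sz (\<lambda>_. 0)" by (simp add: sz_0)
    then show ?thesis unfolding I2_def by blast
  qed
  interpret N2: nil_elt C I2 "X 1" s by unfold_locales (rule xs2)
  have evN2: "ev F - N2.ev F \<in> I2" for F
    unfolding ev_def N2.ev_def using idl_mult[OF I2_idl xs2] by simp
  then have evN: "A2.cg (ev F) (N2.ev F)" for F by (simp add: A2.cg_def)
  interpret P2: plane C I2 "X 1" s "X 2" t n "fps_X ^ p" Zp
  proof unfold_locales
    show "A2.cg (X 1 ^ t * X 2) 0" by (rule cg2[OF xty])
    have "A2.cg (X 2 * X 2) (X 1 * ev (fps_X ^ p) * X 2 + X 1 ^ n * ev Zp)" by (rule cg2[OF y_sq])
    also have "A2.cg \<dots> (X 1 * N2.ev (fps_X ^ p) * X 2 + X 1 ^ n * N2.ev Zp)"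
      by (intro A2.cg_add A2.cg_mult_r A2.cg_mult_l evN)
    finally show "A2.cg (X 2 * X 2) (X 1 * N2.ev (fps_X ^ p) * X 2 + X 1 ^ n * N2.ev Zp)" .
  qed
  have prN: "A2.cg (pr F G) (P2.pr F G)" for F G
    unfolding pr_def P2.pr_def by (intro A2.cg_add A2.cg_mult_r evN)
  have szI2: "A2.cg (sz l) 0" for l
  proof -
    have "sz l \<asymp> C 0 * X 1 ^ s + sz l" by simp
    then have "sz l \<in> I2" unfolding I2_def by blast
    then show ?thesis by (simp only: A2.cg_0_iff)
  qed
  have rep2: "A2.cg f (P2.pr F G)" if "f \<asymp> pr F G + sz l" for f F G l
    using A2.cg_trans[OF cg2[OF that] A2.cg_add[OF prN szI2]] by simp
  interpret PC: plane_change C I2 "X 1" s "X 2" t n "fps_X ^ p" Zp p p' j' c' d' a b W V "X' 1" "X' 2"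
  proof unfold_locales
    show "s + 1 = n + t" "t < n" "2 \<le> t" "p < t" "p' < t" "fps_X ^ p = fps_X ^ p" "Zp $ 0 \<noteq> 0"
      "a $ 0 \<noteq> 0" "W $ 0 = 0"
      using n_t t p Z0 a0 W by auto
    show "A2.cg (X' 1) (P2.pr (fps_X * a) b)" using rep2[OF x'] by (simp only: a)
    show "A2.cg (X' 2) (P2.pr W V)" by (rule rep2[OF y'])
    show "A2.cg (X' 1 ^ t * X' 2) 0" by (rule cg2[OF S'.xty])
    have "X' 2 * X' 2 \<asymp> X' 1 ^ Suc p' * X' 2 + (C c' + C d' * X' 1 ^ j') * X' 1 ^ n"
      using S'.X_y2 by (simp only: power2_eq_square Suc_eq_plus1)
    then show "A2.cg (X' 2 * X' 2) (X' 1 ^ Suc p' * X' 2 + (C c' + C d' * X' 1 ^ j') * X' 1 ^ n)"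
      by (rule cg2)
    fix F G assume "A2.cg (P2.pr F G) 0"
    then have "A2.cg (pr F G) 0" by (rule A2.cg_trans[OF prN])
    then have "pr F G \<in> I2" by (simp only: A2.cg_0_iff)
    then show "(\<forall>i<s. F $ i = 0) \<and> (\<forall>i<t. G $ i = 0)" using indep_I2 by blast
  qed
  have V0: "V $ 0 \<noteq> 0"
  proof
    assume V: "V $ 0 = 0"
    obtain w where w: "W = fps_X ^ (n - 1) * w" using PC.W_low by blast
    have prWV: "pr W V \<in> mp 2"
    proof -
      have "X 1 ^ (n - 1) * ev w \<in> mp (n - 1)" by (intro idl_mult2[OF mp_idl] M_power x)
      moreover have "2 \<le> n - 1" using n_t(2) t by linarith
      ultimately have "X 1 ^ (n - 1) * ev w \<in> mp 2" using mp_antimono by blast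
      then have 1: "ev W \<in> mp 2" unfolding w by (rule mp_cg[OF ev_shift])
      obtain H where "ev V \<asymp> C (V $ 0) + X 1 * ev H" using ev_decomp by blast
      then have "ev V \<asymp> X 1 * ev H" using V by simp
      then have "ev V * X 2 \<asymp> X 1 * ev H * X 2" by (rule cg_mult_r)
      also have "X 1 * ev H * X 2 = ev H * (X 1 * X 2)" by (simp add: ac_simps)
      finally have "ev V * X 2 \<asymp> ev H * (X 1 * X 2)" .
      then have "ev V * X 2 \<in> mp 2" by (rule mp_cg) (intro idl_mult[OF mp_idl] M_mult x y)
      with 1 show ?thesis unfolding pr_def by (rule idl_add[OF mp_idl])
    qed
    obtain m where m: "t - 1 = Suc m" using t by (cases "t - 1") auto
    have "X' 1 ^ (t - 1) * pr W V \<in> mp (t - 1 + 2)" by (intro mp_mult M_power S'.x prWV)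
    moreover have "t - 1 + 2 = Suc t" using t by simp
    ultimately have 1: "X' 1 ^ (t - 1) * pr W V \<in> mp (Suc t)" by (simp only:)
    have "X' 1 * sz f \<asymp> (pr F b + sz e) * sz f" by (rule cg_mult_r[OF x'])
    also have "\<dots> = pr F b * sz f + sz e * sz f" by (rule distrib_right)
    also have "\<dots> \<asymp> 0 + C (\<Sum>k\<in>K. e k * f k) * X 1 ^ s" by (intro cg_add pr_sz F sz_sz)
    finally have "X' 1 * sz f \<asymp> C (\<Sum>k\<in>K. e k * f k) * X 1 ^ s" by simp
    then have "X' 1 * sz f \<in> mp s" by (rule mp_cg[OF _ idl_mult[OF mp_idl M_power[OF x]]])
    then have "X' 1 ^ m * (X' 1 * sz f) \<in> mp s" by (rule idl_mult[OF mp_idl])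
    moreover have "X' 1 ^ m * (X' 1 * sz f) = X' 1 ^ (t - 1) * sz f" unfolding m by (simp add: ac_simps)
    moreover have "Suc t \<le> s" using st t by simp
    ultimately have 2: "X' 1 ^ (t - 1) * sz f \<in> mp (Suc t)" using mp_antimono by auto
    have "X' 1 ^ (t - 1) * X' 2 \<asymp> X' 1 ^ (t - 1) * pr W V + X' 1 ^ (t - 1) * sz f"
      using cg_mult_l[OF y'] by (simp only: distrib_left)
    then have "X' 1 ^ (t - 1) * X' 2 \<in> mp (Suc t)"
      by (rule mp_cg) (rule idl_add[OF mp_idl 1 2])
    then show False using S'.xy_top[of 0] by simp
  qed
  show "p = p'" by (rule PC.p_eq[OF V0])
  assume "n = 2 * Suc p"
  then show "\<exists>a. a $ 0 \<noteq> 0 \<and> (\<forall>i<t - 1 - p. Zp $ i = (fps_const c' + fps_const d' * (fps_X * a) ^ j') $ i)"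
    using PC.Z_eq[OF V0] a0 by blast
qed

end

declare One_nat_def [simp]

text \<open>The reparametrisation \<open>x \<mapsto> a x\<close> preserves the constant term \<open>c\<close> and the order \<open>j\<close> of the first non-constant term
of \<open>c + x\<^sup>j\<close>. For \<open>d = 0\<close> the labels with different \<open>j\<close> name the same series.\<close>

lemma (in asg) normal_label_unique:
  assumes "system p c d j X" "normal_label n t p c d j"
    and "system p' c' d' j' X'" "normal_label n t p' c' d' j'"
  shows "p = p' \<and> c = c' \<and> d = d' \<and> (d \<noteq> 0 \<longrightarrow> j = j')"
proof -
  interpret asg_system C I M h s t p c d j X by unfold_locales (rule assms(1))
  have p: "p < t" "p' < t" using assms(2,4) by (auto simp: normal_label_def)
  have pp: "p = p'" by (rule system_unique(1)[OF assms(3) p])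
  show ?thesis
  proof (cases "p + 2 \<le> t \<and> n = 2 * Suc p")
    case False
    then show ?thesis using assms(2,4) pp by (auto simp: normal_label_def)
  next
    case True
    then have l: "c \<noteq> 0" "d = 0 \<or> d = 1 \<and> 1 \<le> j \<and> j + p + 2 \<le> t"
      "c' \<noteq> 0" "d' = 0 \<or> d' = 1 \<and> 1 \<le> j' \<and> j' + p + 2 \<le> t"
      using assms(2,4) pp by (auto simp: normal_label_def)
    obtain a where a: "a $ 0 \<noteq> 0"
      and eq: "\<And>i. i < t - 1 - p \<Longrightarrow> Zp $ i = (fps_const c' + fps_const d' * (fps_X * a) ^ j') $ i"
      using system_unique(2)[OF assms(3) p] True by blast
    have co: "(fps_const c' + fps_const d' * (fps_X * a) ^ j') $ i
        = (if i = 0 then c' else 0) + d' * (if i < j' then 0 else (a ^ j') $ (i - j'))" for i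
      by (simp add: power_mult_distrib fps_X_power_mult_nth)
    have co0: "Zp $ i = (if i = 0 then c else 0) + d * (if i = j then 1 else 0)" for i
      by (simp add: Zp_def fps_X_power_nth)
    have e: "(if i = 0 then c else 0) + d * (if i = j then 1 else 0)
        = (if i = 0 then c' else 0) + d' * (if i < j' then 0 else (a ^ j') $ (i - j'))" if "i < t - 1 - p" for i
      using eq[OF that] unfolding co co0 .
    have a': "(a ^ j') $ 0 \<noteq> 0" using a by (simp add: fps_nth_power_0)
    have cc: "c = c'" using e[of 0] True l by auto
    have "d = d' \<and> (d \<noteq> 0 \<longrightarrow> j = j')"
    proof (cases "d = 0")
      case d0: True
      show ?thesis
      proof (rule ccontr)
        assume "\<not> ?thesis"
        then have "d' = 1" "1 \<le> j'" "j' + p + 2 \<le> t" using d0 l by auto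
        then show False using e[of j'] d0 a' by auto
      qed
    next
      case False
      then have d1: "d = 1" "1 \<le> j" "j + p + 2 \<le> t" using l by auto
      have ej: "1 = d' * (if j < j' then 0 else (a ^ j') $ (j - j'))" using e[of j] d1 by auto
      then have "d' \<noteq> 0" "\<not> j < j'" by (auto split: if_splits)
      then have d'1: "d' = 1" "1 \<le> j'" "j' + p + 2 \<le> t" using l by auto
      have "j' < t - 1 - p" using d'1 by simp
      from e[OF this] have "\<not> j' < j" using d'1 d1 a' by auto
      then show ?thesis using d1 d'1 \<open>\<not> j < j'\<close> by auto
    qed
    then show ?thesis using pp cc by blast
  qed
qed

section \<open>Power series in finitely many variables\<close>

definition cut :: "nat \<Rightarrow> 'k::comm_ring_1 ser \<Rightarrow> 'k ser" where
  "cut h f = Ser (\<lambda>m. if Poly_Mapping.keys m \<subseteq> {1..h} then cf f m else 0)"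

lemma cf_cut: "cf (cut h f) m = (if Poly_Mapping.keys m \<subseteq> {1..h} then cf f m else 0)"
  by (simp add: cut_def)

lemma keys_add_nat: "Poly_Mapping.keys (a + b) = Poly_Mapping.keys a \<union> Poly_Mapping.keys (b :: nat \<Rightarrow>\<^sub>0 nat)"
  by (auto simp: in_keys_iff lookup_add)

lemma cut_add: "cut h (f + g) = cut h f + cut h g"
  by (rule ser_eqI) (simp add: cf_cut)

lemma cut_0 [simp]: "cut h 0 = 0"
  by (rule ser_eqI) (simp add: cf_cut)

lemma cut_const [simp]: "cut h (ser_const c) = ser_const c"
  by (rule ser_eqI) (simp add: cf_cut cf_const)

lemma cut_1 [simp]: "cut h 1 = 1"
  using cut_const[of h 1] by simp

lemma cut_mult: "cut h (f * g) = cut h f * cut h g"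
proof (rule ser_eqI)
  fix m
  show "cf (cut h (f * g)) m = cf (cut h f * cut h g) m"
  proof (cases "Poly_Mapping.keys m \<subseteq> {1..h}")
    case True
    have "cf (f * g) m = cf (cut h f * cut h g) m"
      unfolding cf_mult
    proof (rule sum.cong[OF refl])
      fix p assume "p \<in> {(a, b). a + b = m}"
      then show "(case p of (a, b) \<Rightarrow> cf f a * cf g b) = (case p of (a, b) \<Rightarrow> cf (cut h f) a * cf (cut h g) b)"
        using True by (auto simp: cf_cut keys_add_nat)
    qed
    then show ?thesis using True by (simp add: cf_cut)
  next
    case False
    have "cf (cut h f * cut h g) m = 0"
      unfolding cf_mult
    proof (rule sum.neutral, rule ballI)
      fix p assume "p \<in> {(a, b). a + b = m}"
      then have "m = fst p + snd p" by auto
      then have "\<not> Poly_Mapping.keys (fst p) \<subseteq> {1..h} \<or> \<not> Poly_Mapping.keys (snd p) \<subseteq> {1..h}"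
        using False by (simp add: keys_add_nat)
      then show "(case p of (a, b) \<Rightarrow> cf (cut h f) a * cf (cut h g) b) = 0"
        unfolding case_prod_unfold cf_cut by (elim disjE) (simp_all only: if_False mult_zero_left mult_zero_right)
    qed
    then show ?thesis using False by (simp add: cf_cut)
  qed
qed

lemma cut_cut [simp]: "cut h (cut h f) = cut h f"
  by (rule ser_eqI) (simp add: cf_cut)

lemma cut_var: "i \<in> {1..h} \<Longrightarrow> cut h (ser_var i) = ser_var i"
  by (rule ser_eqI) (auto simp: cf_cut cf_var)

text \<open>Sorting the monomials by their smallest variable exhibits a series without constant term as a
combination of the variables.\<close>

definition dser :: "nat \<Rightarrow> nat \<Rightarrow> 'k::comm_ring_1 ser \<Rightarrow> 'k ser" where
  "dser h i f = Ser (\<lambda>m. if (\<forall>k\<in>Poly_Mapping.keys m. i \<le> k) \<and> Poly_Mapping.keys m \<subseteq> {1..h}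
     then cf f (m + Poly_Mapping.single i 1) else 0)"

lemma cut_decomp: "cut h f = ser_const (cf f 0) + (\<Sum>i\<in>{1..h}. ser_var i * dser h i f)"
proof (rule ser_eqI)
  fix m :: "nat \<Rightarrow>\<^sub>0 nat"
  let ?K = "Poly_Mapping.keys m" and ?e = "\<lambda>i. Poly_Mapping.single i (1 :: nat)"
  have sum: "cf (\<Sum>i\<in>{1..h}. ser_var i * dser h i f) m
      = (\<Sum>i\<in>{1..h}. if i \<in> ?K \<and> (\<forall>k\<in>?K. i \<le> k) \<and> ?K \<subseteq> {1..h} then cf f m else 0)"
    unfolding cf_sum
  proof (rule sum.cong[OF refl])
    fix i assume i: "i \<in> {1..h}"
    show "cf (ser_var i * dser h i f) m
        = (if i \<in> ?K \<and> (\<forall>k\<in>?K. i \<le> k) \<and> ?K \<subseteq> {1..h} then cf f m else 0)"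
    proof (cases "i \<in> ?K")
      case True
      have m: "m - ?e i + ?e i = m"
        using True by (intro poly_mapping_eqI) (auto simp: lookup_add lookup_minus lookup_single when_def in_keys_iff)
      have "Poly_Mapping.keys (?e i) = {i}" by simp
      then have K: "?K = Poly_Mapping.keys (m - ?e i) \<union> {i}"
        using keys_add_nat[of "m - ?e i" "?e i"] by (simp only: m)
      have "((\<forall>k\<in>Poly_Mapping.keys (m - ?e i). i \<le> k) \<and> Poly_Mapping.keys (m - ?e i) \<subseteq> {1..h})
          = ((\<forall>k\<in>?K. i \<le> k) \<and> ?K \<subseteq> {1..h})"
        unfolding K using i by auto
      then show ?thesis using True by (simp only: cf_var_mult dser_def cf_Ser m if_True simp_thms)
    qed (simp add: cf_var_mult)
  qed
  show "cf (cut h f) m = cf (ser_const (cf f 0) + (\<Sum>i\<in>{1..h}. ser_var i * dser h i f)) m"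
  proof (cases "m = 0")
    case True
    then show ?thesis unfolding cf_add sum by (simp add: cf_cut cf_const)
  next
    case False
    then have ne: "?K \<noteq> {}" by simp
    define \<mu> where "\<mu> = Min ?K"
    have mu: "\<mu> \<in> ?K" unfolding \<mu>_def using ne by (intro Min_in) simp_all
    have min: "i \<in> ?K \<and> (\<forall>k\<in>?K. i \<le> k) \<longleftrightarrow> i = \<mu>" for i
      using ne Min_in[of ?K] Min_le[of ?K] unfolding \<mu>_def by (auto intro: antisym)
    have "(\<Sum>i\<in>{1..h}. if i \<in> ?K \<and> (\<forall>k\<in>?K. i \<le> k) \<and> ?K \<subseteq> {1..h} then cf f m else 0)
        = (\<Sum>i\<in>{1..h}. if i = \<mu> then (if ?K \<subseteq> {1..h} then cf f m else 0) else 0)"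
    proof (rule sum.cong[OF refl])
      fix i
      have "(i \<in> ?K \<and> (\<forall>k\<in>?K. i \<le> k) \<and> ?K \<subseteq> {1..h}) = (i = \<mu> \<and> ?K \<subseteq> {1..h})"
        using min[of i] by blast
      note cond = this
      show "(if i \<in> ?K \<and> (\<forall>k\<in>?K. i \<le> k) \<and> ?K \<subseteq> {1..h} then cf f m else 0)
          = (if i = \<mu> then (if ?K \<subseteq> {1..h} then cf f m else 0) else 0)"
        by (subst cond) (rule if_if_eq_conj[symmetric])
    qed
    also have "\<dots> = (if ?K \<subseteq> {1..h} then cf f m else 0)"
    proof (cases "?K \<subseteq> {1..h}")
      case True
      then have "\<mu> \<in> {1..h}" using mu by blast
      then show ?thesis by (simp add: sum.delta)
    qed simp
    finally show ?thesis unfolding cf_add sum using False by (simp add: cf_cut cf_const)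
  qed
qed

definition tdeg :: "(nat \<Rightarrow>\<^sub>0 nat) \<Rightarrow> nat" where
  "tdeg m = (\<Sum>i\<in>Poly_Mapping.keys m. Poly_Mapping.lookup m i)"

lemma tdeg_superset:
  assumes "finite S" "Poly_Mapping.keys m \<subseteq> S"
  shows "tdeg m = (\<Sum>i\<in>S. Poly_Mapping.lookup m i)"
  unfolding tdeg_def using assms by (intro sum.mono_neutral_left) (auto simp: in_keys_iff)

lemma tdeg_add: "tdeg (a + b) = tdeg a + tdeg b"
proof -
  let ?S = "Poly_Mapping.keys a \<union> Poly_Mapping.keys b"
  have "tdeg (a + b) = (\<Sum>i\<in>?S. Poly_Mapping.lookup (a + b) i)"
    by (rule tdeg_superset) (auto simp: keys_add_nat)
  also have "\<dots> = (\<Sum>i\<in>?S. Poly_Mapping.lookup a i) + (\<Sum>i\<in>?S. Poly_Mapping.lookup b i)"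
    by (simp add: lookup_add sum.distrib)
  also have "(\<Sum>i\<in>?S. Poly_Mapping.lookup a i) = tdeg a"
    by (rule tdeg_superset[symmetric]) auto
  also have "(\<Sum>i\<in>?S. Poly_Mapping.lookup b i) = tdeg b"
    by (rule tdeg_superset[symmetric]) auto
  finally show ?thesis .
qed

lemma tdeg_0 [simp]: "tdeg 0 = 0"
  by (simp add: tdeg_def)

lemma tdeg_pos: "a \<noteq> 0 \<Longrightarrow> 0 < tdeg a"
proof -
  assume "a \<noteq> 0"
  then obtain i where "i \<in> Poly_Mapping.keys a" by (metis equals0I keys_eq_empty)
  then show ?thesis unfolding tdeg_def by (intro sum_pos) (auto simp: in_keys_iff)
qed

lemma cf_mult_cong_deg:
  assumes "\<And>b. tdeg b \<le> N \<Longrightarrow> cf u b = cf v b" "tdeg m \<le> N"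
  shows "cf (f * u) m = cf (f * v) m"
  unfolding cf_mult
proof (rule sum.cong[OF refl])
  fix p assume "p \<in> {(a, b). a + b = m}"
  then have "tdeg (snd p) \<le> N" using assms(2) tdeg_add[of "fst p" "snd p"] by auto
  then show "(case p of (a, b) \<Rightarrow> cf f a * cf u b) = (case p of (a, b) \<Rightarrow> cf f a * cf v b)"
    using assms(1) by (simp add: case_prod_unfold)
qed

lemma cf_power_low: "cf g 0 = 0 \<Longrightarrow> tdeg m < k \<Longrightarrow> cf (g ^ k) m = 0"
proof (induction k arbitrary: m)
  case (Suc k)
  show ?case
    unfolding power_Suc cf_mult
  proof (rule sum.neutral, rule ballI)
    fix p assume p: "p \<in> {(a, b). a + b = m}"
    show "(case p of (a, b) \<Rightarrow> cf g a * cf (g ^ k) b) = 0"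
    proof (cases "fst p = 0")
      case True
      then show ?thesis using Suc.prems(1) by (simp add: case_prod_unfold)
    next
      case False
      then have "tdeg (snd p) < k"
        using p tdeg_add[of "fst p" "snd p"] tdeg_pos[OF False] Suc.prems(2) by auto
      then show ?thesis using Suc by (simp add: case_prod_unfold)
    qed
  qed
qed simp

text \<open>The geometric series converges coefficientwise because \<open>g\<^sup>k\<close> has no terms of degree below \<open>k\<close>.\<close>

lemma ser_geometric: "cf g 0 = 0 \<Longrightarrow> \<exists>e. (1 - g) * e = 1"
proof -
  assume g: "cf g 0 = 0"
  define S where "S = (\<lambda>N. \<Sum>k<Suc N. g ^ k)"
  define e where "e = Ser (\<lambda>m. cf (S (tdeg m)) m)"
  have S_ext: "cf (S M) m = cf (S N) m" if "N \<le> M" "tdeg m \<le> N" for M N m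
  proof -
    have "cf (S M) m = (\<Sum>k<Suc M. cf (g ^ k) m)" by (simp add: S_def)
    also have "\<dots> = (\<Sum>k<Suc N. cf (g ^ k) m)"
      using that cf_power_low[OF g, of m] by (intro sum.mono_neutral_right) auto
    finally show ?thesis by (simp add: S_def)
  qed
  have "(1 - g) * e = 1"
  proof (rule ser_eqI)
    fix m
    have "cf ((1 - g) * e) m = cf ((1 - g) * S (tdeg m)) m"
    proof (rule cf_mult_cong_deg[OF _ order_refl])
      fix b assume "tdeg b \<le> tdeg m"
      then show "cf e b = cf (S (tdeg m)) b" using S_ext[of "tdeg b" "tdeg m" b] by (simp add: e_def)
    qed
    also have "(1 - g) * S (tdeg m) = 1 - g ^ Suc (tdeg m)"
      unfolding S_def by (rule one_diff_power_eq[symmetric])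
    finally show "cf ((1 - g) * e) m = cf 1 m" using cf_power_low[OF g, of m "Suc (tdeg m)"] by simp
  qed
  then show ?thesis by blast
qed

lemma ser_unit:
  fixes f :: "'k::field_char_0 ser"
  assumes "cf f 0 \<noteq> 0"
  shows "\<exists>e. e * f = 1"
proof -
  let ?c = "inverse (cf f 0)"
  have "cf (1 - ser_const ?c * f) 0 = 0" using assms by (simp add: cf_const cf_one)
  then obtain e where "(1 - (1 - ser_const ?c * f)) * e = 1" using ser_geometric by blast
  then have "(e * ser_const ?c) * f = 1" by (simp add: ac_simps)
  then show ?thesis by blast
qed

text \<open>The surjection onto the ring of series in the variables \<open>1..h\<close> sets all other variables to zero.\<close>

definition rho :: "nat \<Rightarrow> 'k::comm_ring_1 ser \<Rightarrow> 'k mps" where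
  "rho h f = cf (cut h f)"

lemma rho_eq_iff: "rho h f = rho h g \<longleftrightarrow> cut h f = cut h g"
  by (simp add: rho_def cf_inject)

lemma range_rho: "range (rho h :: 'a::comm_ring_1 ser \<Rightarrow> 'a mps) = carrier (mps_ring h)"
proof
  show "range (rho h :: 'a ser \<Rightarrow> 'a mps) \<subseteq> carrier (mps_ring h)"
  proof
    fix g assume "g \<in> range (rho h)"
    then obtain f where "g = cf (cut h f)" unfolding rho_def by blast
    then show "g \<in> carrier (mps_ring h)" by (simp add: mps_ring_def cf_cut)
  qed
  show "carrier (mps_ring h) \<subseteq> range (rho h :: 'a ser \<Rightarrow> 'a mps)"
  proof
    fix f :: "'a mps" assume "f \<in> carrier (mps_ring h)"
    then have "rho h (Ser f) = f" by (auto simp: rho_def mps_ring_def cf_cut fun_eq_iff)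
    then show "f \<in> range (rho h)" by (metis rangeI)
  qed
qed

lemma rho_const: "rho h (ser_const c) = mps_const c"
  by (simp add: rho_def) (simp add: ser_const_def)

lemma rho_var: "i \<in> {1..h} \<Longrightarrow> rho h (ser_var i) = mps_var i"
  by (simp only: rho_def cut_var) (simp add: ser_var_def)

section \<open>Rings presented as images of a ring type\<close>

text \<open>Rings given by records are presented as images of a ring type, so that their ideals and quotients
correspond to ideals of the type containing the kernel.\<close>

locale type_hom =
  fixes Q :: "('a, 'b) ring_scheme" (structure) and \<pi> :: "'r::comm_ring_1 \<Rightarrow> 'a"
  assumes hom_add: "\<pi> (f + g) = \<pi> f \<oplus> \<pi> g"
    and hom_mult: "\<pi> (f * g) = \<pi> f \<otimes> \<pi> g"
    and hom_one: "\<pi> 1 = \<one>"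
    and hom_zero: "\<pi> 0 = \<zero>"
    and hom_range: "range \<pi> = carrier Q"
begin

lemma hom_closed [simp]: "\<pi> f \<in> carrier Q"
  using hom_range by blast

lemma hom_surj: "a \<in> carrier Q \<Longrightarrow> \<exists>f. a = \<pi> f"
  using hom_range by blast

lemma cring: "cring Q"
proof (rule cringI)
  show "abelian_group Q"
  proof (rule abelian_groupI)
    fix x assume "x \<in> carrier Q"
    then obtain f where "x = \<pi> f" using hom_surj by blast
    then have "\<pi> (- f) \<oplus> x = \<zero>" by (simp flip: hom_add hom_zero)
    then show "\<exists>y\<in>carrier Q. y \<oplus> x = \<zero>" using hom_closed by blast
  next
    fix x y z assume "x \<in> carrier Q" "y \<in> carrier Q" "z \<in> carrier Q"
    then obtain f g e where "x = \<pi> f" "y = \<pi> g" "z = \<pi> e" using hom_surj by metis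
    then show "x \<oplus> y \<oplus> z = x \<oplus> (y \<oplus> z)" by (simp add: add.assoc flip: hom_add)
  next
    fix x y assume "x \<in> carrier Q" "y \<in> carrier Q"
    then obtain f g where "x = \<pi> f" "y = \<pi> g" using hom_surj by metis
    then show "x \<oplus> y = y \<oplus> x" "x \<oplus> y \<in> carrier Q" by (simp_all add: add.commute flip: hom_add)
  next
    fix x assume "x \<in> carrier Q"
    then obtain f where "x = \<pi> f" using hom_surj by metis
    then show "\<zero> \<oplus> x = x" by (simp flip: hom_add hom_zero)
  qed (simp flip: hom_zero)
  show "comm_monoid Q"
  proof (rule comm_monoidI)
    fix x y z assume "x \<in> carrier Q" "y \<in> carrier Q" "z \<in> carrier Q"
    then obtain f g e where "x = \<pi> f" "y = \<pi> g" "z = \<pi> e" using hom_surj by metis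
    then show "x \<otimes> y \<otimes> z = x \<otimes> (y \<otimes> z)" by (simp add: mult.assoc flip: hom_mult)
  next
    fix x y assume "x \<in> carrier Q" "y \<in> carrier Q"
    then obtain f g where "x = \<pi> f" "y = \<pi> g" using hom_surj by metis
    then show "x \<otimes> y = y \<otimes> x" "x \<otimes> y \<in> carrier Q" by (simp_all add: mult.commute flip: hom_mult)
  next
    fix x assume "x \<in> carrier Q"
    then obtain f where "x = \<pi> f" using hom_surj by metis
    then show "\<one> \<otimes> x = x" by (simp flip: hom_mult hom_one)
  qed (simp flip: hom_one)
  fix x y z assume "x \<in> carrier Q" "y \<in> carrier Q" "z \<in> carrier Q"
  then obtain f g e where "x = \<pi> f" "y = \<pi> g" "z = \<pi> e" using hom_surj by metis
  then show "(x \<oplus> y) \<otimes> z = x \<otimes> z \<oplus> y \<otimes> z" by (simp add: distrib_right flip: hom_add hom_mult)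
qed

sublocale cring Q by (rule cring)

lemma hom_minus: "\<pi> (- f) = \<ominus> \<pi> f"
proof -
  have "\<pi> (- f) \<oplus> \<pi> f = \<zero>" by (simp flip: hom_add hom_zero)
  then show ?thesis by (simp add: minus_equality)
qed

lemma hom_diff: "\<pi> (f - g) = \<pi> f \<ominus> \<pi> g"
  using hom_add[of f "- g"] by (simp add: hom_minus a_minus_def)

lemma hom_power: "\<pi> (f ^ n) = \<pi> f [^] n"
  by (induction n) (simp_all add: hom_one hom_mult m_comm)

definition ker :: "'r set" where "ker = {f. \<pi> f = \<zero>}"

lemma hom_eq_iff: "\<pi> f = \<pi> g \<longleftrightarrow> f - g \<in> ker"
  by (simp add: ker_def hom_diff)

lemma ker_idl: "idl ker"
  by (rule idlI) (auto simp: ker_def hom_zero hom_add hom_mult)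

lemma vimage_idl: "ideal J Q \<Longrightarrow> idl (\<pi> -` J) \<and> ker \<subseteq> \<pi> -` J"
proof -
  assume "ideal J Q"
  then interpret ideal J Q .
  have "idl (\<pi> -` J)"
    by (rule idlI) (auto simp: hom_zero hom_add hom_mult I_l_closed)
  then show ?thesis by (auto simp: ker_def)
qed

lemma image_ideal: "idl J \<Longrightarrow> ideal (\<pi> ` J) Q"
proof (rule idealI)
  assume J: "idl J"
  show "ring Q" by (rule ring_axioms)
  show "subgroup (\<pi> ` J) (add_monoid Q)"
  proof (rule add.subgroupI)
    show "\<pi> ` J \<subseteq> carrier Q" by auto
    show "\<pi> ` J \<noteq> {}" using idl_0[OF J] by blast
    show "\<ominus> a \<in> \<pi> ` J" if "a \<in> \<pi> ` J" for a
      using that idl_minus[OF J] by (auto simp flip: hom_minus)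
    show "a \<oplus> b \<in> \<pi> ` J" if "a \<in> \<pi> ` J" "b \<in> \<pi> ` J" for a b
      using that idl_add[OF J] by (auto simp flip: hom_add)
  qed
  fix a x assume "a \<in> \<pi> ` J" "x \<in> carrier Q"
  then obtain f g where "f \<in> J" "a = \<pi> f" "x = \<pi> g" using hom_surj by blast
  then show "x \<otimes> a \<in> \<pi> ` J" "a \<otimes> x \<in> \<pi> ` J"
    using idl_mult[OF J] idl_mult2[OF J] by (auto simp flip: hom_mult)
qed

lemma image_vimage: "ideal J Q \<Longrightarrow> \<pi> ` (\<pi> -` J) = J"
proof
  assume J: "ideal J Q"
  show "J \<subseteq> \<pi> ` (\<pi> -` J)"
  proof
    fix a assume a: "a \<in> J"
    then obtain f where "a = \<pi> f" using hom_surj ideal.Icarr[OF J] by blast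
    then show "a \<in> \<pi> ` (\<pi> -` J)" using a by blast
  qed
qed blast

lemma in_image_iff: "idl J \<Longrightarrow> ker \<subseteq> J \<Longrightarrow> \<pi> f \<in> \<pi> ` J \<longleftrightarrow> f \<in> J"
proof
  assume J: "idl J" "ker \<subseteq> J" and "\<pi> f \<in> \<pi> ` J"
  then obtain g where g: "g \<in> J" "\<pi> f = \<pi> g" by blast
  then have "f - g \<in> J" using J(2) hom_eq_iff by blast
  then show "f \<in> J" using idl_add[OF J(1) _ g(1), of "f - g"] by simp
qed auto

lemma quot_hom: "ideal P Q \<Longrightarrow> type_hom (Q Quot P) (\<lambda>f. P +>\<^bsub>Q\<^esub> \<pi> f)"
proof -
  assume "ideal P Q"
  then interpret P: ideal P Q .
  have hom: "(+>) P \<in> ring_hom Q (Q Quot P)" by (rule P.rcos_ring_hom)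
  show ?thesis
  proof
    show "P +> \<pi> 0 = \<zero>\<^bsub>Q Quot P\<^esub>"
      by (simp add: hom_zero FactRing_def P.a_rcos_const)
    show "range (\<lambda>f. P +> \<pi> f) = carrier (Q Quot P)"
    proof -
      have "range (\<lambda>f. P +> \<pi> f) = (+>) P ` carrier Q" by (simp only: image_image hom_range[symmetric])
      also have "\<dots> = carrier (Q Quot P)" by (auto simp: FactRing_def A_RCOSETS_def')
      finally show ?thesis .
    qed
  qed (simp_all add: hom_add hom_mult hom_one ring_hom_add[OF hom] ring_hom_mult[OF hom] ring_hom_one[OF hom])
qed

lemma quot_ker: "ideal P Q \<Longrightarrow> type_hom.ker (Q Quot P) (\<lambda>f. P +>\<^bsub>Q\<^esub> \<pi> f) = \<pi> -` P"
proof -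
  assume P: "ideal P Q"
  interpret P: ideal P Q by (rule P)
  interpret q: type_hom "Q Quot P" "\<lambda>f. P +> \<pi> f" by (rule quot_hom[OF P])
  have "P +> \<pi> f = P \<longleftrightarrow> \<pi> f \<in> P" for f
    using P.a_rcos_const[of "\<pi> f"] P.a_rcos_self[of "\<pi> f"] by auto
  then show ?thesis unfolding q.ker_def by (auto simp: FactRing_def)
qed

end

lemma rho_hom: "type_hom (mps_ring h) (rho h :: 'k::comm_ring_1 ser \<Rightarrow> 'k mps)"
proof
  fix f g :: "'k ser"
  show "rho h (f + g) = rho h f \<oplus>\<^bsub>mps_ring h\<^esub> rho h g"
    by (simp add: rho_def cut_add mps_ring_def fun_eq_iff)
  show "rho h (f * g) = rho h f \<otimes>\<^bsub>mps_ring h\<^esub> rho h g"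
    by (simp add: rho_def cut_mult mps_ring_def fun_eq_iff cf_mult)
  show "rho h (1 :: 'k ser) = \<one>\<^bsub>mps_ring h\<^esub>"
    by (simp add: rho_def mps_ring_def fun_eq_iff cf_one)
  show "rho h (0 :: 'k ser) = \<zero>\<^bsub>mps_ring h\<^esub>"
    by (simp add: rho_def mps_ring_def fun_eq_iff)
qed (rule range_rho)

section \<open>Dimensions, powers and nilpotency of the maximal ideal\<close>

locale type_hom_alg = type_hom Q \<pi> for Q :: "('a, 'b) ring_scheme" (structure) and \<pi> :: "'r::comm_ring_1 \<Rightarrow> 'a" +
  fixes C :: "'k::field_char_0 \<Rightarrow> 'r"
  assumes C_add': "C (a + b) = C a + C b"
    and C_mult': "C (a * b) = C a * C b"
    and C_1': "C 1 = 1"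
    and nontrivial: "\<one> \<noteq> \<zero>"
begin

sublocale alg_mod C ker
  by unfold_locales (simp_all add: C_add' C_mult' C_1' ker_idl)

definition K :: "'a set" where "K = range (\<lambda>c. \<pi> (C c))"

lemma K_subfield: "subfield K Q"
proof (rule subfieldI)
  have "subring K Q"
  proof (rule subringI)
    show "K \<subseteq> carrier Q" by (auto simp: K_def)
    have "\<one> = \<pi> (C 1)" by (simp add: hom_one)
    then show "\<one> \<in> K" unfolding K_def by blast
    fix a b assume "a \<in> K" "b \<in> K"
    then obtain c d where cd: "a = \<pi> (C c)" "b = \<pi> (C d)" unfolding K_def by blast
    have "\<ominus> a = \<pi> (C (- c))" "a \<otimes> b = \<pi> (C (c * d))" "a \<oplus> b = \<pi> (C (c + d))"
      by (simp_all add: cd C_minus hom_minus C_mult hom_mult C_add hom_add)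
    then show "\<ominus> a \<in> K" "a \<otimes> b \<in> K" "a \<oplus> b \<in> K" unfolding K_def by blast+
  qed
  then show "subcring K Q"
    by (rule subcringI) (auto simp: K_def m_comm)
  show "Units (Q\<lparr>carrier := K\<rparr>) = K - {\<zero>}"
  proof (intro equalityI subsetI)
    fix a assume "a \<in> Units (Q\<lparr>carrier := K\<rparr>)"
    then obtain b where "a \<in> K" "b \<in> K" "b \<otimes> a = \<one>" by (auto simp: Units_def)
    moreover have "b \<in> carrier Q" using \<open>b \<in> K\<close> by (auto simp: K_def)
    ultimately show "a \<in> K - {\<zero>}" using nontrivial by auto
  next
    fix a assume "a \<in> K - {\<zero>}"
    then obtain c where c: "a = \<pi> (C c)" "a \<in> K" "a \<noteq> \<zero>" unfolding K_def by blast
    then have "c \<noteq> 0" by (auto simp: hom_zero)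
    then have "\<pi> (C (inverse c)) \<otimes> a = \<one>" "a \<otimes> \<pi> (C (inverse c)) = \<one>"
      by (simp_all add: c(1) hom_one flip: hom_mult C_mult)
    moreover have "\<pi> (C (inverse c)) \<in> K" unfolding K_def by blast
    ultimately show "a \<in> Units (Q\<lparr>carrier := K\<rparr>)" using c(2) by (auto simp: Units_def)
  qed
qed

lemma Span_vimage: "\<pi> f \<in> Span K (map \<pi> us) \<longleftrightarrow> f \<in> lspan ker (set us)"
proof
  assume "\<pi> f \<in> Span K (map \<pi> us)"
  then show "f \<in> lspan ker (set us)"
  proof (induction us arbitrary: f)
    case Nil
    then show ?case using lspan_superset(1)[of ker "{}"] by (auto simp: ker_def)
  next
    case (Cons u us)
    then have "\<pi> f \<in> line_extension K (\<pi> u) (Span K (map \<pi> us))" by simp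
    then obtain k v where kv: "k \<in> K" "v \<in> Span K (map \<pi> us)" "\<pi> f = k \<otimes> \<pi> u \<oplus> v"
      using line_extension_mem_iff by auto
    obtain c where c: "k = \<pi> (C c)" using kv(1) unfolding K_def by blast
    have "set (map \<pi> us) \<subseteq> carrier Q" by auto
    then have "v \<in> carrier Q" using kv(2) Span_subgroup_props(1)[OF K_subfield] by blast
    then obtain w where w: "v = \<pi> w" using hom_surj by blast
    have "\<pi> f = \<pi> (C c * u + w)" using kv(3) by (simp add: c w hom_add hom_mult)
    then have "f - (C c * u + w) \<in> lspan ker (set (u # us))"
      using hom_eq_iff lspan_superset(1) by blast
    moreover have "w \<in> lspan ker (set us)" using Cons.IH kv(2) w by blast
    then have "w \<in> lspan ker (set (u # us))"
      using lspan_mono[of "set us" ker "set (u # us)"] lspan_superset(2)[of "set (u # us)" ker] by auto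
    moreover have "u \<in> lspan ker (set (u # us))" using lspan_superset(2)[of "set (u # us)" ker] by auto
    ultimately have "(f - (C c * u + w)) + (C c * u + w) \<in> lspan ker (set (u # us))"
      by (intro lin_add[OF lspan_lin] lin_scale[OF lspan_lin])
    then show ?case by simp
  qed
next
  have sub: "set (map \<pi> us) \<subseteq> carrier Q" by auto
  note props = Span_subgroup_props[OF K_subfield sub] Span_smult_closed[OF K_subfield sub]
  have "lin {f. \<pi> f \<in> Span K (map \<pi> us)}"
    unfolding lin_def
  proof (intro conjI ballI allI)
    show "0 \<in> {f. \<pi> f \<in> Span K (map \<pi> us)}" using props(2) by (simp add: hom_zero)
    fix f assume f: "f \<in> {f. \<pi> f \<in> Span K (map \<pi> us)}"
    show "f + g \<in> {f. \<pi> f \<in> Span K (map \<pi> us)}" if "g \<in> {f. \<pi> f \<in> Span K (map \<pi> us)}" for g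
      using f that props(3) by (simp add: hom_add)
    show "C c * f \<in> {f. \<pi> f \<in> Span K (map \<pi> us)}" for c
      using f props(5)[of "\<pi> (C c)"] by (simp add: hom_mult K_def)
  qed
  then have "lspan ker (set us) \<subseteq> {f. \<pi> f \<in> Span K (map \<pi> us)}"
    by (rule lspan_least) (use props(2) Span_base_incl[OF K_subfield sub] in \<open>auto simp: ker_def\<close>)
  then show "f \<in> lspan ker (set us) \<Longrightarrow> \<pi> f \<in> Span K (map \<pi> us)" by blast
qed

lemma independent_map: "indep ker us \<Longrightarrow> independent K (map \<pi> us)"
proof (induction us)
  case (Cons u us)
  then have "\<pi> u \<notin> Span K (map \<pi> us)" using Span_vimage by simp
  then show ?case using Cons li_Cons[of "\<pi> u" K "map \<pi> us"] by simp
qed simp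

lemma Span_dimension_le:
  assumes "set Us \<subseteq> carrier Q"
  shows "\<exists>m\<le>length Us. dimension m K (Span K Us)"
  using assms
proof (induction Us)
  case Nil
  then show ?case by auto
next
  case (Cons u Us)
  then obtain m where m: "m \<le> length Us" "dimension m K (Span K Us)" by auto
  have sub: "set Us \<subseteq> carrier Q" and u: "u \<in> carrier Q" using Cons.prems by auto
  note props = Span_subgroup_props[OF K_subfield sub] Span_smult_closed[OF K_subfield sub]
  show ?case
  proof (cases "u \<in> Span K Us")
    case True
    have "line_extension K u (Span K Us) = Span K Us"
    proof
      show "line_extension K u (Span K Us) \<subseteq> Span K Us"
        using props(3,5) True by (auto simp: line_extension_mem_iff)
      show "Span K Us \<subseteq> line_extension K u (Span K Us)"
        using mono_Span[OF K_subfield sub u] by simp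
    qed
    then show ?thesis using m by (intro exI[of _ m]) simp
  next
    case False
    then show ?thesis using m Suc_dim[OF u False m(2)] by (intro exI[of _ "Suc m"]) simp
  qed
qed

text \<open>Independent families and spanning families lift along the surjection, and \<open>qdim\<close> records their
exchange properties.\<close>

lemma dimension_qdim:
  assumes "dimension d K (\<pi> ` P)"
  shows "qdim P ker d"
  unfolding qdim_def
proof (intro conjI allI impI)
  fix us assume us: "set us \<subseteq> P" "indep ker us"
  have "set (map \<pi> us) \<subseteq> \<pi> ` P" using us(1) by auto
  then obtain Vs where Vs: "length (Vs @ map \<pi> us) = d" "Span K (Vs @ map \<pi> us) = \<pi> ` P"
      "independent K (Vs @ map \<pi> us)"
    using complete_base[OF K_subfield assms independent_map[OF us(2)]] by blast
  have "set (Vs @ map \<pi> us) \<subseteq> \<pi> ` P"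
    using Span_base_incl[OF K_subfield independent_in_carrier[OF Vs(3)]] Vs(2) by simp
  then have "\<exists>vs. set vs \<subseteq> P \<and> Vs = map \<pi> vs"
  proof (induction Vs)
    case (Cons v Vs)
    then obtain vs w where "set vs \<subseteq> P" "Vs = map \<pi> vs" "w \<in> P" "v = \<pi> w" by auto
    then have "set (w # vs) \<subseteq> P \<and> v # Vs = map \<pi> (w # vs)" by simp
    then show ?case by (rule exI[of _ "w # vs"])
  qed simp
  then obtain vs where vs: "set vs \<subseteq> P" "Vs = map \<pi> vs" by blast
  have "P \<subseteq> lspan ker (set (vs @ us))"
  proof
    fix f assume "f \<in> P"
    then have "\<pi> f \<in> Span K (map \<pi> (vs @ us))" using Vs(2) vs(2) by simp
    then show "f \<in> lspan ker (set (vs @ us))" using Span_vimage by blast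
  qed
  then show "\<exists>vs. set vs \<subseteq> P \<and> length (vs @ us) = d \<and> P \<subseteq> lspan ker (set (vs @ us))"
    using vs Vs(1) by auto
next
  fix us assume us: "set us \<subseteq> P" "P \<subseteq> lspan ker (set us)"
  obtain Vs where Vs: "set Vs \<subseteq> carrier Q" "Span K Vs = \<pi> ` P"
    using exists_base[OF K_subfield assms] by blast
  have "Span K (map \<pi> us) = \<pi> ` P"
  proof
    show "Span K (map \<pi> us) \<subseteq> \<pi> ` P"
      using mono_Span_subset[OF K_subfield, of "map \<pi> us" Vs] us(1) Vs by auto
    show "\<pi> ` P \<subseteq> Span K (map \<pi> us)" using us(2) Span_vimage by blast
  qed
  moreover have "set (map \<pi> us) \<subseteq> carrier Q" by auto
  then obtain m where "m \<le> length (map \<pi> us)" "dimension m K (Span K (map \<pi> us))"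
    using Span_dimension_le by blast
  ultimately show "d \<le> length us" using dimension_is_inj[OF K_subfield assms, of m] by simp
qed

end

definition ser_max :: "'k::comm_ring_1 ser set" where
  "ser_max = {f. cf f 0 = 0}"

lemma ser_max_idl: "idl ser_max"
  by (rule idlI) (auto simp: ser_max_def)

text \<open>\<open>I'\<close> is the preimage of the ideal in the ring type, and \<open>q\<close> is the projection onto the quotient ring.\<close>

locale ser_quot =
  fixes h :: nat and I :: "'k::field_char_0 mps set"
  assumes I_ideal: "ideal I (mps_ring h)"
begin

abbreviation A :: "'k mps set ring" where "A \<equiv> mps_ring h Quot I"

definition q :: "'k ser \<Rightarrow> 'k mps set" where "q f = I +>\<^bsub>mps_ring h\<^esub> rho h f"

definition I' :: "'k ser set" where "I' = {f. rho h f \<in> I}"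

sublocale R: type_hom "mps_ring h" "rho h :: 'k ser \<Rightarrow> 'k mps"
  by (rule rho_hom)

sublocale A: type_hom A q
  unfolding q_def[abs_def] by (rule R.quot_hom[OF I_ideal])

lemma ker_q: "A.ker = I'"
  using R.quot_ker[OF I_ideal] unfolding q_def[abs_def] I'_def by auto

sublocale alg_mod ser_const I'
  by unfold_locales (use A.ker_idl in \<open>simp_all add: ser_const_add ser_const_mult ker_q\<close>)

notation cg (infix "\<asymp>" 50)

lemma q_eq_iff: "q f = q g \<longleftrightarrow> f \<asymp> g"
  by (simp add: A.hom_eq_iff ker_q cg_def)

lemma q_const: "quot_const h I c = q (ser_const c)"
  by (simp add: quot_const_def q_def rho_const)

lemma cut_cg: "cut h f \<asymp> f"
proof -
  have "rho h (cut h f) = rho h f" by (simp add: rho_eq_iff)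
  then show ?thesis unfolding q_eq_iff[symmetric] by (simp add: q_def)
qed

lemma ser_decomp: "f \<asymp> ser_const (cf f 0) + (\<Sum>i\<in>{1..h}. ser_var i * dser h i f)"
  using cg_sym[OF cut_cg[of f]] by (simp only: cut_decomp)

end

locale artin_quot = ser_quot h I for h and I :: "'k::field_char_0 mps set" +
  assumes art: "artinian_local_ring (mps_ring h Quot I)"
begin

lemma max_vimage: "q -` max_ideal A = ser_max" and I'_max: "I' \<subseteq> ser_max"
  and nontrivial_A: "\<one>\<^bsub>A\<^esub> \<noteq> \<zero>\<^bsub>A\<^esub>" and max_ideal_A: "ideal (max_ideal A) A"
proof -
  have "maximalideal (max_ideal A) A"
    unfolding max_ideal_def using artinian_local_ring.unique_maximal[OF art] by (rule theI')
  then interpret N: maximalideal "max_ideal A" A .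
  show ideal: "ideal (max_ideal A) A" by (rule N.is_ideal)
  let ?L = "q -` max_ideal A"
  have L: "idl ?L" "I' \<subseteq> ?L" using A.vimage_idl[OF ideal] ker_q by auto
  have "1 \<notin> ?L"
  proof
    assume "1 \<in> ?L"
    then have "\<one>\<^bsub>A\<^esub> \<in> max_ideal A" by (simp add: A.hom_one)
    then show False using N.one_imp_carrier N.I_notcarr by simp
  qed
  have LM: "?L \<subseteq> ser_max"
  proof
    fix f assume f: "f \<in> ?L"
    show "f \<in> ser_max"
    proof (rule ccontr)
      assume "f \<notin> ser_max"
      then obtain e where "e * f = 1" using ser_unit[of f] by (auto simp: ser_max_def)
      then show False using idl_mult[OF L(1) f, of e] \<open>1 \<notin> ?L\<close> by simp
    qed
  qed
  then show IM: "I' \<subseteq> ser_max" using L(2) by blast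
  have "ideal (q ` ser_max) A" by (rule A.image_ideal[OF ser_max_idl])
  moreover have "max_ideal A \<subseteq> q ` ser_max" using A.image_vimage[OF ideal] LM by blast
  moreover have "q ` ser_max \<subseteq> carrier A" by auto
  moreover have "q ` ser_max \<noteq> carrier A"
  proof
    assume "q ` ser_max = carrier A"
    then have "q 1 \<in> q ` ser_max" by auto
    then have "1 \<in> (ser_max :: 'k ser set)"
      using A.in_image_iff[OF ser_max_idl] IM ker_q by simp
    then show False by (simp add: ser_max_def cf_one)
  qed
  ultimately have eq: "max_ideal A = q ` ser_max" using N.I_maximal by metis
  show "?L = ser_max"
    unfolding eq using A.in_image_iff[OF ser_max_idl] IM ker_q by auto
  show "\<one>\<^bsub>A\<^esub> \<noteq> \<zero>\<^bsub>A\<^esub>"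
  proof
    assume "\<one>\<^bsub>A\<^esub> = \<zero>\<^bsub>A\<^esub>"
    then have "1 \<in> A.ker" by (simp add: A.ker_def A.hom_one)
    then show False using IM ker_q by (auto simp: ser_max_def cf_one)
  qed
qed

lemma max_ideal_eq: "max_ideal A = q ` ser_max"
  using A.image_vimage[OF max_ideal_A] by (simp add: max_vimage)

sublocale local_alg ser_const I' ser_max
proof unfold_locales
  show "idl ser_max" by (rule ser_max_idl)
  show "I' \<subseteq> ser_max" by (rule I'_max)
  show "1 \<notin> (ser_max :: 'k ser set)" by (simp add: ser_max_def cf_one)
  fix f :: "'k ser"
  have "f - ser_const (cf f 0) \<in> ser_max" by (simp add: ser_max_def cf_const)
  then show "\<exists>c. f - ser_const c \<in> ser_max" by blast
qed

lemma ideal_power_eq: "ideal (ideal_power A (max_ideal A) j) A \<and> ideal_power A (max_ideal A) j = q ` mp j"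
proof (induction j)
  case 0
  have "ideal_power A (max_ideal A) 0 = carrier A"
    by (simp add: ideal_power_def ideals_set_def)
  then show ?case using A.hom_range A.oneideal by simp
next
  case (Suc j)
  let ?P = "ideal_power A (max_ideal A) j"
  have eq: "ideal_power A (max_ideal A) (Suc j) = ideal_prod A ?P (max_ideal A)"
    by (simp add: ideal_power_def ideals_set_def)
  have ideal: "ideal (ideal_prod A ?P (max_ideal A)) A"
    using Suc by (blast intro: A.ideal_prod_is_ideal max_ideal_A)
  have sub: "mp (Suc j) \<subseteq> q -` ideal_prod A ?P (max_ideal A)"
  proof (rule mp_least)
    show "idl (q -` ideal_prod A ?P (max_ideal A))" "I' \<subseteq> q -` ideal_prod A ?P (max_ideal A)"
      using A.vimage_idl[OF ideal] ker_q by auto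
    fix a b :: "'k ser" assume "a \<in> ser_max" "b \<in> mp j"
    then have "q b \<otimes>\<^bsub>A\<^esub> q a \<in> ideal_prod A ?P (max_ideal A)"
      using Suc by (intro ideal_prod.prod) (auto simp: max_ideal_eq)
    then show "a * b \<in> q -` ideal_prod A ?P (max_ideal A)"
      by (simp add: mult.commute[of a b] A.hom_mult)
  qed
  have "ideal_prod A ?P (max_ideal A) \<subseteq> q ` mp (Suc j)"
  proof
    fix a assume "a \<in> ideal_prod A ?P (max_ideal A)"
    then show "a \<in> q ` mp (Suc j)"
    proof (induction rule: ideal_prod.induct)
      case (prod u v)
      then obtain f g where "f \<in> mp j" "u = q f" "g \<in> ser_max" "v = q g"
        using Suc by (auto simp: max_ideal_eq)
      note fg = this
      have "u \<otimes>\<^bsub>A\<^esub> v = q (f * g)" by (simp add: fg A.hom_mult)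
      also have "f * g = g * f" by (rule mult.commute)
      finally show ?case using mp_prod[OF fg(3,1)] by blast
    next
      case (sum u v)
      then obtain f g where "f \<in> mp (Suc j)" "u = q f" "g \<in> mp (Suc j)" "v = q g" by blast
      then have "u \<oplus>\<^bsub>A\<^esub> v = q (f + g)" "f + g \<in> mp (Suc j)"
        using idl_add[OF mp_idl] by (simp_all add: A.hom_add)
      then show ?case by blast
    qed
  qed
  with sub have "ideal_prod A ?P (max_ideal A) = q ` mp (Suc j)" by blast
  then show ?case using ideal by (simp only: eq)
qed

lemma hilbert_qdim:
  assumes "hilbert_function A (quot_const h I) j d"
  shows "qdim (mp j) (mp (Suc j)) d"
proof -
  let ?P = "ideal_power A (max_ideal A) (Suc j)"
  have P: "ideal ?P A" and Pq: "?P = q ` mp (Suc j)" and Pj: "ideal_power A (max_ideal A) j = q ` mp j"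
    using ideal_power_eq by blast+
  interpret B: type_hom "A Quot ?P" "\<lambda>f. ?P +>\<^bsub>A\<^esub> q f" by (rule A.quot_hom[OF P])
  have ker: "B.ker = mp (Suc j)"
  proof -
    have "B.ker = q -` ?P" by (rule A.quot_ker[OF P])
    also have "\<dots> = q -` (q ` mp (Suc j))" by (simp only: Pq)
    also have "\<dots> = mp (Suc j)" using A.in_image_iff[OF mp_idl, of "Suc j"] I_mp ker_q by auto
    finally show ?thesis .
  qed
  have "1 \<notin> mp (Suc j)" using mp_Suc_M[of j] one_M by blast
  then have "1 \<notin> B.ker" by (simp only: ker not_False_eq_True)
  then have nontriv: "\<one>\<^bsub>A Quot ?P\<^esub> \<noteq> \<zero>\<^bsub>A Quot ?P\<^esub>" by (simp add: B.ker_def B.hom_one[symmetric])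
  interpret B: type_hom_alg "A Quot ?P" "\<lambda>f. ?P +>\<^bsub>A\<^esub> q f" ser_const
    by unfold_locales (simp_all add: ser_const_add ser_const_mult nontriv)
  have "ring.dimension (A Quot ?P) d (range (\<lambda>c. ?P +>\<^bsub>A\<^esub> quot_const h I c))
       ((\<lambda>a. ?P +>\<^bsub>A\<^esub> a) ` ideal_power A (max_ideal A) j)"
    using assms by (simp add: hilbert_function_def Let_def)
  then have "ring.dimension (A Quot ?P) d B.K ((\<lambda>f. ?P +>\<^bsub>A\<^esub> q f) ` mp j)"
    by (simp add: q_const B.K_def Pj image_image)
  then have "alg_mod.qdim ser_const (mp j) B.ker d" by (rule B.dimension_qdim)
  then show ?thesis by (simp only: ker)
qed

lemma gorenstein_qdim:
  assumes "gorenstein A (quot_const h I)"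
  shows "qdim {f. \<forall>g\<in>ser_max. g * f \<in> I'} I' 1"
proof -
  interpret B: type_hom_alg A q ser_const
    by unfold_locales (simp_all add: ser_const_add ser_const_mult nontrivial_A)
  have "socle A = q ` {f. \<forall>g\<in>ser_max. g * f \<in> I'}"
  proof (intro equalityI subsetI)
    fix a assume a: "a \<in> socle A"
    then have "a \<in> carrier A" by (simp add: socle_def)
    then obtain f where f: "a = q f" using A.hom_surj by blast
    have "g * f \<in> I'" if "g \<in> ser_max" for g
    proof -
      have "q g \<in> max_ideal A" using that by (simp add: max_ideal_eq)
      then have "q g \<otimes>\<^bsub>A\<^esub> q f = \<zero>\<^bsub>A\<^esub>" using a f by (simp add: socle_def)
      then have "g * f \<in> A.ker" by (simp add: A.ker_def A.hom_mult)
      then show ?thesis by (simp only: ker_q)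
    qed
    then show "a \<in> q ` {f. \<forall>g\<in>ser_max. g * f \<in> I'}" using f by blast
  next
    fix a assume "a \<in> q ` {f. \<forall>g\<in>ser_max. g * f \<in> I'}"
    then obtain f where f: "a = q f" "\<And>g. g \<in> ser_max \<Longrightarrow> g * f \<in> A.ker" by (auto simp: ker_q)
    then show "a \<in> socle A" by (auto simp: socle_def max_ideal_eq A.ker_def A.hom_mult)
  qed
  moreover have "ring.dimension A 1 (range (quot_const h I)) (socle A)"
    using assms by (simp add: gorenstein_def)
  moreover have "range (quot_const h I) = B.K" by (simp add: q_const B.K_def)
  ultimately have "ring.dimension A 1 B.K (q ` {f. \<forall>g\<in>ser_max. g * f \<in> I'})" by simp
  then have "alg_mod.qdim ser_const {f. \<forall>g\<in>ser_max. g * f \<in> I'} A.ker 1" by (rule B.dimension_qdim)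
  then show ?thesis by (simp only: ker_q)
qed

text \<open>The descending chain condition makes strict inclusion well-founded on ideals containing \<open>I'\<close>.\<close>

lemma minimal_ideal:
  assumes "\<And>L. L \<in> \<L> \<Longrightarrow> idl L \<and> I' \<subseteq> L" "L0 \<in> \<L>"
  obtains L where "L \<in> \<L>" "\<And>L'. L' \<in> \<L> \<Longrightarrow> L' \<subseteq> L \<Longrightarrow> L' = L"
proof -
  let ?r = "{(L', L). L' \<in> \<L> \<and> L \<in> \<L> \<and> L' \<subset> L}"
  have "wf ?r"
    unfolding wf_iff_no_infinite_down_chain
  proof
    assume "\<exists>f. \<forall>i. (f (Suc i), f i) \<in> ?r"
    then obtain f where f: "\<And>i. f (Suc i) \<in> \<L>" "\<And>i. f i \<in> \<L>" "\<And>i. f (Suc i) \<subset> f i" by blast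
    have "ideal (q ` f n) A" "q ` f (Suc n) \<subseteq> q ` f n" for n
      using A.image_ideal assms(1) f by blast+
    then obtain N where N: "\<And>n. n \<ge> N \<Longrightarrow> q ` f n = q ` f N"
      using artinian_ring.descending_chain[OF artinian_local_ring.axioms(1)[OF art], of "\<lambda>n. q ` f n"] by blast
    have "f N \<subseteq> f (Suc N)"
    proof
      fix x assume "x \<in> f N"
      then have "q x \<in> q ` f (Suc N)" using N[of "Suc N"] by auto
      moreover have "idl (f (Suc N))" "A.ker \<subseteq> f (Suc N)" using assms(1)[OF f(1)] ker_q by auto
      ultimately show "x \<in> f (Suc N)" using A.in_image_iff by blast
    qed
    then show False using f(3)[of N] by blast
  qed
  then show thesis
  proof (rule wfE_min[OF _ assms(2)])
    fix L assume L: "L \<in> \<L>" "\<And>L'. (L', L) \<in> ?r \<Longrightarrow> L' \<notin> \<L>"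
    show thesis by (rule that[OF L(1)]) (use L in blast)
  qed
qed

text \<open>A minimal ideal \<open>L\<close> with \<open>L K \<noteq> 0\<close>, for the stable power \<open>K\<close>, contains an element \<open>a\<close> with \<open>a K \<noteq> 0\<close>. Then \<open>L = a K\<close>,
so \<open>a = a b\<close> with \<open>b \<in> K\<close>. As \<open>1 - b\<close> is a unit, \<open>a = 0\<close>.\<close>

lemma nilpotent:
  assumes N: "0 < N" and stable: "\<And>j. N \<le> j \<Longrightarrow> mp j = mp N"
  shows "mp N \<subseteq> I'"
proof (rule ccontr)
  assume ne: "\<not> mp N \<subseteq> I'"
  define \<L> where "\<L> = {L. idl L \<and> I' \<subseteq> L \<and> (\<exists>a\<in>L. \<exists>b\<in>mp N. a * b \<notin> I')}"
  obtain b0 where "b0 \<in> mp N" "b0 \<notin> I'" using ne by blast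
  then have "1 * b0 \<notin> I'" by simp
  then have "\<exists>a\<in>UNIV. \<exists>b\<in>mp N. a * b \<notin> I'" using \<open>b0 \<in> mp N\<close> by blast
  moreover have "idl (UNIV :: 'k ser set)" by (rule idlI) simp_all
  ultimately have "UNIV \<in> \<L>" unfolding \<L>_def by blast
  then obtain L where L: "L \<in> \<L>" and min: "\<And>L'. L' \<in> \<L> \<Longrightarrow> L' \<subseteq> L \<Longrightarrow> L' = L"
    by (rule minimal_ideal[rotated]) (auto simp: \<L>_def)
  then obtain a b1 where a: "a \<in> L" "b1 \<in> mp N" "a * b1 \<notin> I'" and Lidl: "idl L" "I' \<subseteq> L"
    unfolding \<L>_def by blast
  define L' where "L' = {f. \<exists>b\<in>mp N. f \<asymp> a * b}"
  have "idl L'"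
  proof (rule idlI)
    have "0 \<asymp> a * 0" by simp
    then show "0 \<in> L'" unfolding L'_def using idl_0[OF mp_idl] by blast
    fix f g assume "f \<in> L'"
    then obtain b where b: "b \<in> mp N" "f \<asymp> a * b" unfolding L'_def by blast
    have "g * f \<asymp> a * (g * b)" using cg_mult_l[OF b(2), of g] by (simp add: mult.left_commute)
    then show "g * f \<in> L'" unfolding L'_def using idl_mult[OF mp_idl b(1)] by blast
    assume "g \<in> L'"
    then obtain b' where b': "b' \<in> mp N" "g \<asymp> a * b'" unfolding L'_def by blast
    have "f + g \<asymp> a * (b + b')" using cg_add[OF b(2) b'(2)] by (simp add: distrib_left)
    then show "f + g \<in> L'" unfolding L'_def using idl_add[OF mp_idl b(1) b'(1)] by blast
  qed
  moreover have "I' \<subseteq> L'"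
  proof
    fix f assume "f \<in> I'"
    then have "f \<asymp> a * 0" by (simp add: cg_0_iff)
    then show "f \<in> L'" unfolding L'_def using idl_0[OF mp_idl] by blast
  qed
  moreover have "\<exists>f\<in>L'. \<exists>b\<in>mp N. f * b \<notin> I'"
  proof (rule ccontr)
    assume *: "\<not> ?thesis"
    have "mp (N + N) \<subseteq> {f. a * f \<in> I'}"
    proof (rule mp_add_least)
      show "idl {f. a * f \<in> I'}"
        using I_0 I_add I_mult by (intro idlI) (auto simp: distrib_left mult.left_commute)
      show "I' \<subseteq> {f. a * f \<in> I'}" using I_mult by blast
      fix u v assume uv: "u \<in> mp N" "v \<in> mp N"
      have "a * u \<in> L'" unfolding L'_def using uv(1) cg_refl by blast
      then have "a * u * v \<in> I'" using * uv(2) by blast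
      then show "u * v \<in> {f. a * f \<in> I'}" by (simp add: mult.assoc)
    qed
    then show False using stable[of "N + N"] a by auto
  qed
  ultimately have "L' \<in> \<L>" unfolding \<L>_def by blast
  moreover have "L' \<subseteq> L"
  proof
    fix f assume "f \<in> L'"
    then obtain b where "f \<asymp> a * b" unfolding L'_def by blast
    then show "f \<in> L" by (rule cg_idl[OF Lidl]) (rule idl_mult2[OF Lidl(1) a(1)])
  qed
  ultimately have "a \<in> L'" using min a(1) by blast
  then obtain b where b: "b \<in> mp N" "a \<asymp> a * b" unfolding L'_def by blast
  have "mp N \<subseteq> ser_max" using N mp_Suc_M[of "N - 1"] by simp
  then have "cf (1 - b) 0 \<noteq> 0" using b(1) by (auto simp: ser_max_def cf_one)
  then obtain e where e: "e * (1 - b) = 1" using ser_unit by blast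
  have "a = e * (1 - b) * a" by (simp only: e mult_1_left)
  also have "\<dots> = e * (a - a * b)" by (simp add: algebra_simps)
  also have "\<dots> \<in> I'" using b(2) by (intro I_mult) (simp add: cg_def)
  finally show False using a(3) I_mult2 by blast
qed

end

section \<open>Isomorphisms of quotients\<close>

text \<open>An isomorphism \<open>R / J \<cong> R / I\<close> described on representatives.\<close>

definition quot_map :: "nat \<Rightarrow> 'k::field_char_0 mps set \<Rightarrow> 'k mps set \<Rightarrow> ('k ser \<Rightarrow> 'k ser) \<Rightarrow> bool" where
  "quot_map h I J \<theta> \<longleftrightarrow>
     (\<forall>f g. rho h (\<theta> (f + g) - (\<theta> f + \<theta> g)) \<in> I) \<and>
     (\<forall>f g. rho h (\<theta> (f * g) - \<theta> f * \<theta> g) \<in> I) \<and>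
     (\<forall>c. rho h (\<theta> (ser_const c) - ser_const c) \<in> I) \<and>
     (\<forall>f. \<exists>g. rho h (\<theta> g - f) \<in> I) \<and>
     (\<forall>f. rho h (\<theta> f) \<in> I \<longleftrightarrow> rho h f \<in> J)"

locale ser_quot2 = I: ser_quot h I + J: ser_quot h J
  for h and I J :: "'k::field_char_0 mps set"
begin

lemma quot_map_iff:
  "quot_map h I J \<theta> \<longleftrightarrow>
     (\<forall>f g. I.q (\<theta> (f + g)) = I.q (\<theta> f + \<theta> g)) \<and> (\<forall>f g. I.q (\<theta> (f * g)) = I.q (\<theta> f * \<theta> g)) \<and>
     (\<forall>c. I.q (\<theta> (ser_const c)) = I.q (ser_const c)) \<and> (\<forall>f. \<exists>g. I.q (\<theta> g) = I.q f) \<and>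
     (\<forall>f. \<theta> f \<in> I.I' \<longleftrightarrow> f \<in> J.I')"
  unfolding quot_map_def I.A.hom_eq_iff I.ker_q unfolding I.I'_def J.I'_def by simp

lemma quot_map_eq:
  assumes "quot_map h I J \<theta>"
  shows "I.q (\<theta> f) = I.q (\<theta> g) \<longleftrightarrow> J.q f = J.q g"
proof -
  have \<theta>: "I.q (\<theta> (f + g)) = I.q (\<theta> f + \<theta> g)" "\<theta> f \<in> I.I' \<longleftrightarrow> f \<in> J.I'" for f g
    using assms unfolding quot_map_iff by blast+
  have "I.q (\<theta> ((f - g) + g)) = I.q (\<theta> (f - g) + \<theta> g)" by (rule \<theta>(1))
  then have "\<theta> f - (\<theta> (f - g) + \<theta> g) \<in> I.I'" by (simp add: I.A.hom_eq_iff I.ker_q)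
  then have "\<theta> f - \<theta> g \<in> I.I' \<longleftrightarrow> \<theta> (f - g) \<in> I.I'"
    using I.I_add[of "\<theta> f - (\<theta> (f - g) + \<theta> g)" "\<theta> (f - g)"]
      I.I_diff[of "\<theta> f - \<theta> g" "\<theta> f - (\<theta> (f - g) + \<theta> g)"] by (auto simp: algebra_simps)
  then show ?thesis by (simp add: I.A.hom_eq_iff J.A.hom_eq_iff I.ker_q J.ker_q \<theta>(2))
qed

lemma isomorphic_of_quot_map:
  assumes "quot_map h I J \<theta>"
  shows "isomorphic_ideals h I J"
proof -
  have \<theta>: "I.q (\<theta> (f + g)) = I.q (\<theta> f + \<theta> g)" "I.q (\<theta> (f * g)) = I.q (\<theta> f * \<theta> g)"
    "I.q (\<theta> (ser_const c)) = I.q (ser_const c)" "\<exists>g. I.q (\<theta> g) = I.q f" for f g c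
    using assms unfolding quot_map_iff by blast+
  note eq = quot_map_eq[OF assms]
  define \<phi> where "\<phi> = (\<lambda>a. J.q (SOME g. I.q (\<theta> g) = a))"
  have \<phi>: "\<phi> (I.q (\<theta> g)) = J.q g" for g
  proof -
    have "I.q (\<theta> (SOME g'. I.q (\<theta> g') = I.q (\<theta> g))) = I.q (\<theta> g)" by (rule someI) simp
    then show ?thesis unfolding \<phi>_def eq .
  qed
  have surj: "\<exists>g. a = I.q (\<theta> g)" if "a \<in> carrier I.A" for a
    using I.A.hom_surj[OF that] \<theta>(4) by metis
  have "\<phi> \<in> ring_iso I.A J.A"
  proof (rule ring_iso_memI)
    fix a b assume "a \<in> carrier I.A" "b \<in> carrier I.A"
    then obtain f g where ab: "a = I.q (\<theta> f)" "b = I.q (\<theta> g)" using surj by blast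
    show "\<phi> a \<in> carrier J.A" by (simp add: ab \<phi>)
    have "a \<otimes>\<^bsub>I.A\<^esub> b = I.q (\<theta> (f * g))" by (simp only: ab \<theta> I.A.hom_mult)
    then show "\<phi> (a \<otimes>\<^bsub>I.A\<^esub> b) = \<phi> a \<otimes>\<^bsub>J.A\<^esub> \<phi> b" by (simp only: ab \<phi> J.A.hom_mult)
    have "a \<oplus>\<^bsub>I.A\<^esub> b = I.q (\<theta> (f + g))" by (simp only: ab \<theta> I.A.hom_add)
    then show "\<phi> (a \<oplus>\<^bsub>I.A\<^esub> b) = \<phi> a \<oplus>\<^bsub>J.A\<^esub> \<phi> b" by (simp only: ab \<phi> J.A.hom_add)
  next
    have "\<one>\<^bsub>I.A\<^esub> = I.q (\<theta> (ser_const 1))" by (simp only: \<theta>(3)) (simp add: I.A.hom_one)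
    then show "\<phi> \<one>\<^bsub>I.A\<^esub> = \<one>\<^bsub>J.A\<^esub>" by (simp only: \<phi>) (simp add: J.A.hom_one)
    show "bij_betw \<phi> (carrier I.A) (carrier J.A)"
      unfolding bij_betw_def
    proof
      show "inj_on \<phi> (carrier I.A)"
      proof (rule inj_onI)
        fix a b assume "a \<in> carrier I.A" "b \<in> carrier I.A" "\<phi> a = \<phi> b"
        moreover then obtain f g where "a = I.q (\<theta> f)" "b = I.q (\<theta> g)" using surj by blast
        ultimately show "a = b" using eq by (simp only: \<phi>)
      qed
      show "\<phi> ` carrier I.A = carrier J.A"
      proof
        show "\<phi> ` carrier I.A \<subseteq> carrier J.A" using surj \<phi> by force
        show "carrier J.A \<subseteq> \<phi> ` carrier I.A"
        proof
          fix b assume "b \<in> carrier J.A"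
          then obtain g where "b = J.q g" using J.A.hom_surj by blast
          then have "b = \<phi> (I.q (\<theta> g))" by (simp only: \<phi>)
          then show "b \<in> \<phi> ` carrier I.A" using I.A.hom_closed by blast
        qed
      qed
    qed
  qed
  moreover have "\<phi> (quot_const h I c) = quot_const h J c" for c
    by (simp only: I.q_const J.q_const \<theta>(3)[symmetric] \<phi>)
  ultimately show ?thesis unfolding isomorphic_ideals_def by blast
qed

lemma quot_map_of_isomorphic:
  assumes "isomorphic_ideals h I J"
  shows "\<exists>\<theta>. quot_map h I J \<theta>"
proof -
  obtain \<phi> where iso: "\<phi> \<in> ring_iso I.A J.A" and const: "\<And>c. \<phi> (I.q (ser_const c)) = J.q (ser_const c)"
    using assms unfolding isomorphic_ideals_def I.q_const J.q_const by blast
  have bij: "bij_betw \<phi> (carrier I.A) (carrier J.A)" using iso by (simp add: ring_iso_def)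
  have hom: "\<phi> (I.q (f + g)) = \<phi> (I.q f) \<oplus>\<^bsub>J.A\<^esub> \<phi> (I.q g)" "\<phi> (I.q (f * g)) = \<phi> (I.q f) \<otimes>\<^bsub>J.A\<^esub> \<phi> (I.q g)" for f g
    using ring_iso_memE(2,3)[OF iso] by (simp_all add: I.A.hom_add I.A.hom_mult)
  have inj: "I.q f = I.q g" if "\<phi> (I.q f) = \<phi> (I.q g)" for f g
    using bij that I.A.hom_closed unfolding bij_betw_def by (auto dest: inj_onD)
  have "\<exists>f. \<phi> (I.q f) = J.q g" for g
  proof -
    have "J.q g \<in> \<phi> ` carrier I.A" using bij J.A.hom_closed by (auto simp: bij_betw_def)
    then show ?thesis using I.A.hom_surj by force
  qed
  then obtain \<theta> where \<theta>: "\<And>g. \<phi> (I.q (\<theta> g)) = J.q g" by metis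
  have zero: "\<phi> (I.q 0) = J.q 0" using const[of 0] by (simp add: J.C_0)
  have "quot_map h I J \<theta>"
    unfolding quot_map_iff
  proof (intro conjI allI)
    fix f g c
    show "I.q (\<theta> (f + g)) = I.q (\<theta> f + \<theta> g)" by (rule inj) (simp only: hom \<theta> J.A.hom_add)
    show "I.q (\<theta> (f * g)) = I.q (\<theta> f * \<theta> g)" by (rule inj) (simp only: hom \<theta> J.A.hom_mult)
    show "I.q (\<theta> (ser_const c)) = I.q (ser_const c)" by (rule inj) (simp only: \<theta> const)
    have "\<phi> (I.q f) \<in> carrier J.A" using bij I.A.hom_closed by (auto simp: bij_betw_def)
    then obtain g' where "\<phi> (I.q f) = J.q g'" using J.A.hom_surj by blast
    then have "I.q (\<theta> g') = I.q f" by (intro inj) (simp only: \<theta>)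
    then show "\<exists>g. I.q (\<theta> g) = I.q f" by blast
    have "\<theta> f \<in> I.I' \<longleftrightarrow> I.q (\<theta> f) = I.q 0" by (simp add: I.A.hom_eq_iff I.ker_q)
    also have "\<dots> \<longleftrightarrow> \<phi> (I.q (\<theta> f)) = \<phi> (I.q 0)" using inj by auto
    also have "\<dots> \<longleftrightarrow> J.q f = J.q 0" by (simp only: \<theta> zero)
    also have "\<dots> \<longleftrightarrow> f \<in> J.I'" by (simp add: J.A.hom_eq_iff J.ker_q)
    finally show "\<theta> f \<in> I.I' \<longleftrightarrow> f \<in> J.I'" .
  qed
  then show ?thesis by blast
qed

end

section \<open>The model ideals\<close>

definition gens :: "nat \<Rightarrow> nat \<Rightarrow> nat \<Rightarrow> nat \<Rightarrow> 'k::comm_ring_1 ser \<Rightarrow> 'k ser set" where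
  "gens h s t p z =
     {ser_var i * ser_var j | i j. 1 \<le> i \<and> i < j \<and> j \<le> h \<and> (i, j) \<noteq> (1, 2)} \<union>
     {ser_var j ^ 2 - ser_var 1 ^ s | j. 3 \<le> j \<and> j \<le> h} \<union>
     {ser_var 2 ^ 2 - ser_var 1 ^ (p + 1) * ser_var 2 - z * ser_var 1 ^ (s - t + 1)} \<union>
     {ser_var 1 ^ t * ser_var 2}"

lemma ideal_Ipz_eq:
  fixes z :: "'k::comm_ring_1 ser"
  assumes "2 \<le> h"
  shows "ideal_Ipz h s t p (rho h z) = genideal (mps_ring h) (rho h ` gens h s t p z)"
proof -
  interpret R: type_hom "mps_ring h" "rho h :: 'k ser \<Rightarrow> 'k mps" by (rule rho_hom)
  have v: "mps_var i = rho h (ser_var i :: 'k ser)" if "1 \<le> i" "i \<le> h" for i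
    by (rule rho_var[symmetric]) (use that in auto)
  have v1: "mps_var 1 = rho h (ser_var 1 :: 'k ser)" "mps_var 2 = rho h (ser_var 2 :: 'k ser)"
    using v assms by auto
  have 1: "{mps_var i \<otimes>\<^bsub>mps_ring h\<^esub> mps_var j | i j. 1 \<le> i \<and> i < j \<and> j \<le> h \<and> (i, j) \<noteq> (1, 2)}
      = rho h ` {ser_var i * ser_var j :: 'k ser | i j. 1 \<le> i \<and> i < j \<and> j \<le> h \<and> (i, j) \<noteq> (1, 2)}"
  proof -
    have "mps_var i \<otimes>\<^bsub>mps_ring h\<^esub> mps_var j = rho h (ser_var i * ser_var j :: 'k ser)"
      if "1 \<le> i \<and> i < j \<and> j \<le> h \<and> (i, j) \<noteq> (1, 2)" for i j
      using that by (simp add: v R.hom_mult)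
    then show ?thesis by (auto simp: image_iff) (metis prod.inject)+
  qed
  have 2: "{mps_var j [^]\<^bsub>mps_ring h\<^esub> (2::nat) \<ominus>\<^bsub>mps_ring h\<^esub> mps_var 1 [^]\<^bsub>mps_ring h\<^esub> s | j. 3 \<le> j \<and> j \<le> h}
      = rho h ` {ser_var j ^ 2 - ser_var 1 ^ s :: 'k ser | j. 3 \<le> j \<and> j \<le> h}"
  proof -
    have "mps_var j [^]\<^bsub>mps_ring h\<^esub> (2::nat) \<ominus>\<^bsub>mps_ring h\<^esub> mps_var 1 [^]\<^bsub>mps_ring h\<^esub> s
        = rho h (ser_var j ^ 2 - ser_var 1 ^ s :: 'k ser)" if "3 \<le> j \<and> j \<le> h" for j
      using that by (simp only: R.hom_diff R.hom_power v1) (simp add: v)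
    then show ?thesis by (auto simp: image_iff) metis+
  qed
  show ?thesis
    unfolding ideal_Ipz_def Let_def gens_def image_Un 1 2
    by (simp only: v1 R.hom_diff R.hom_mult R.hom_power image_insert image_empty)
qed

lemma cf_power_0 [simp]: "cf (f ^ n) 0 = cf f 0 ^ n"
  by (induction n) (simp_all add: cf_one)

lemma cf_var_0 [simp]: "cf (ser_var i) 0 = 0"
proof -
  have "0 \<noteq> Poly_Mapping.single i (1 :: nat)"
  proof
    assume "0 = Poly_Mapping.single i (1 :: nat)"
    then have "Poly_Mapping.lookup (Poly_Mapping.single i (1 :: nat)) i = Poly_Mapping.lookup 0 i" by (simp only:)
    then show False by simp
  qed
  then show ?thesis by (simp only: cf_var if_False)
qed

text \<open>The ideal of the normal form with label \<open>(p, c, d, j)\<close>, that is with \<open>z = c + d x\<^sub>1\<^sup>j\<close>.\<close>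

locale model = 
  fixes h s t p :: nat and c d :: "'k::field_char_0" and j :: nat and J :: "'k mps set"
  assumes h: "2 \<le> h" and t: "2 \<le> t" and st: "2 * t \<le> s" and c: "c \<noteq> 0" and j: "d = 0 \<or> 1 \<le> j"
    and J: "J = ideal_Ipz h s t p (rho h (ser_const c + ser_const d * ser_var 1 ^ j))"
begin

definition z :: "'k ser" where "z = ser_const c + ser_const d * ser_var 1 ^ j"

lemma J_eq: "J = genideal (mps_ring h) (rho h ` gens h s t p z)"
  unfolding J ideal_Ipz_eq[OF h] z_def ..

sublocale R: type_hom "mps_ring h" "rho h :: 'k ser \<Rightarrow> 'k mps"
  by (rule rho_hom)

lemma J_ideal: "ideal J (mps_ring h)"
  unfolding J_eq by (rule R.genideal_ideal) auto

sublocale ser_quot h J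
  by (rule ser_quot.intro[OF J_ideal])

notation cg (infix "\<asymp>" 50)

lemma gens_I': "gens h s t p z \<subseteq> I'"
proof
  fix f assume "f \<in> gens h s t p z"
  moreover have "rho h ` gens h s t p z \<subseteq> J" unfolding J_eq by (rule R.genideal_self) auto
  ultimately show "f \<in> I'" unfolding I'_def by blast
qed

lemma I'_least:
  assumes "idl L" "gens h s t p z \<subseteq> L" "\<And>f. cut h f = 0 \<Longrightarrow> f \<in> L"
  shows "I' \<subseteq> L"
proof
  have ker: "R.ker \<subseteq> L"
    using assms(3) unfolding R.ker_def R.hom_zero[symmetric] rho_eq_iff by auto
  have "J \<subseteq> rho h ` L"
    unfolding J_eq by (rule R.genideal_minimal[OF R.image_ideal[OF assms(1)]]) (use assms(2) in auto)
  fix f assume "f \<in> I'"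
  then have "rho h f \<in> rho h ` L" using \<open>J \<subseteq> rho h ` L\<close> by (auto simp: I'_def)
  then show "f \<in> L" using R.in_image_iff[OF assms(1) ker] by blast
qed

abbreviation x :: "nat \<Rightarrow> 'k ser" where "x \<equiv> ser_var"

lemma I'_max: "I' \<subseteq> ser_max"
proof (rule I'_least[OF ser_max_idl])
  show "gens h s t p z \<subseteq> ser_max"
    using t st by (auto simp: gens_def ser_max_def)
  fix f :: "'k ser" assume "cut h f = 0"
  then have "cf (cut h f) 0 = 0" by simp
  then show "f \<in> ser_max" by (simp add: cf_cut ser_max_def)
qed

sublocale local_alg ser_const I' ser_max
proof unfold_locales
  show "idl ser_max" by (rule ser_max_idl)
  show "I' \<subseteq> ser_max" by (rule I'_max)
  show "1 \<notin> (ser_max :: 'k ser set)" by (simp add: ser_max_def cf_one)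
  fix f :: "'k ser"
  have "f - ser_const (cf f 0) \<in> ser_max" by (simp add: ser_max_def cf_const)
  then show "\<exists>c. f - ser_const c \<in> ser_max" by blast
qed

abbreviation n :: nat where "n \<equiv> s - t + 1"

lemma n_t: "n + t = Suc s" "t < n"
  using st t by auto

lemma x_prod: "1 \<le> i \<Longrightarrow> i < k \<Longrightarrow> k \<le> h \<Longrightarrow> (i, k) \<noteq> (1, 2) \<Longrightarrow> x i * x k \<asymp> 0"
proof -
  assume "1 \<le> i" "i < k" "k \<le> h" "(i, k) \<noteq> (1, 2)"
  then have "x i * x k \<in> gens h s t p z" unfolding gens_def by blast
  then show ?thesis using gens_I' by (auto simp: cg_0_iff)
qed

lemma x_sq: "3 \<le> k \<Longrightarrow> k \<le> h \<Longrightarrow> x k ^ 2 \<asymp> x 1 ^ s"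
proof -
  assume "3 \<le> k" "k \<le> h"
  then have "x k ^ 2 - x 1 ^ s \<in> gens h s t p z" unfolding gens_def by blast
  then show ?thesis using gens_I' by (auto simp: cg_def)
qed

lemma x_y2: "x 2 ^ 2 \<asymp> x 1 ^ (p + 1) * x 2 + z * x 1 ^ n"
proof -
  have "x 2 ^ 2 - x 1 ^ (p + 1) * x 2 - z * x 1 ^ n \<in> gens h s t p z" unfolding gens_def by blast
  then have "x 2 ^ 2 - x 1 ^ (p + 1) * x 2 - z * x 1 ^ n \<in> I'" using gens_I' by blast
  then show ?thesis by (simp only: cg_def diff_diff_add)
qed

lemma x_xty: "x 1 ^ t * x 2 \<asymp> 0"
proof -
  have "x 1 ^ t * x 2 \<in> gens h s t p z" unfolding gens_def by blast
  then show ?thesis using gens_I' by (auto simp: cg_0_iff)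
qed

text \<open>Multiplying the relation for \<open>x\<^sub>2\<^sup>2\<close> by \<open>x\<^sub>1\<^sup>t\<close> leaves \<open>z x\<^sub>1\<^sup>s\<^sup>+\<^sup>1 = 0\<close>, and \<open>z\<close> is a unit.\<close>

lemma x_nil: "x 1 ^ Suc s \<in> I'"
proof -
  have "cf z 0 = c" using j unfolding z_def by (auto simp: cf_const zero_power)
  then obtain e where e: "e * z = 1" using ser_unit[of z] c by auto
  have st': "t + n = Suc s" using n_t by simp
  have "x 1 ^ Suc s = e * z * x 1 ^ Suc s" by (simp only: e mult_1_left)
  also have "\<dots> = e * (x 1 ^ t * (x 1 ^ (p + 1) * x 2 + z * x 1 ^ n) - x 1 ^ (p + 1) * (x 1 ^ t * x 2))"
    by (simp only: st'[symmetric] power_add[of _ t]) (simp add: algebra_simps)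
  also have "\<dots> \<asymp> e * (x 1 ^ t * x 2 ^ 2 - 0)"
    by (intro cg_mult_l cg_diff cg_sym[OF x_y2] cg_mult_0(1) x_xty)
  also have "\<dots> = e * x 2 * (x 1 ^ t * x 2)" by (simp add: power2_eq_square ac_simps)
  also have "\<dots> \<asymp> 0" by (rule cg_mult_0(1)[OF x_xty])
  finally show ?thesis by (simp only: cg_0_iff)
qed

sublocale nil_elt ser_const I' "x 1" "Suc s"
  by unfold_locales (rule x_nil)

definition Z :: "'k fps" where "Z = fps_const c + fps_const d * fps_X ^ j"

lemma ev_Z: "ev Z \<asymp> z"
  unfolding Z_def z_def ev_add
  by (intro cg_add ev_const cg_trans[OF ev_mult] cg_mult ev_X_power)

sublocale rel_alg ser_const I' x s t n p Z h
proof unfold_locales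
  show "x 1 ^ t * x 2 \<asymp> 0" by (rule x_xty)
  have "x 2 * x 2 = x 2 ^ 2" by (simp add: power2_eq_square)
  also note x_y2
  also have "x 1 ^ (p + 1) * x 2 + z * x 1 ^ n = x 1 * x 1 ^ p * x 2 + x 1 ^ n * z"
    by (simp add: power_add ac_simps)
  also have "\<dots> \<asymp> x 1 * ev (fps_X ^ p) * x 2 + x 1 ^ n * ev Z"
    by (intro cg_add cg_mult_r cg_mult_l cg_sym[OF ev_X_power] cg_sym[OF ev_Z])
  finally show "x 2 * x 2 \<asymp> x 1 * ev (fps_X ^ p) * x 2 + x 1 ^ n * ev Z" .
qed (rule x_prod x_sq; assumption)+

lemma max_decomp: "a \<in> ser_max \<Longrightarrow> a \<asymp> (\<Sum>i\<in>{1..h}. x i * dser h i a)"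
  using ser_decomp[of a] by (simp add: ser_max_def)

text \<open>Every product of two coordinates is a multiple of \<open>x\<^sub>1\<close> in the model, which makes its maximal ideal nilpotent.\<close>

lemma mp2_x: "mp 2 \<subseteq> {f. \<exists>g. f \<asymp> x 1 * g}" (is "_ \<subseteq> ?J")
proof -
  have idl: "idl ?J" and I: "I' \<subseteq> ?J" by (rule idl_principal, rule I_idl_principal)
  have xx: "x i * x k \<in> ?J" if ik: "i \<in> {1..h}" "k \<in> {1..h}" for i k
  proof -
    have 1: "x i * x k \<in> ?J" if "i = 1" for i k
    proof -
      have "x i * x k \<asymp> x 1 * x k" using that by simp
      then show ?thesis by blast
    qed
    have less: "x i * x k \<in> ?J" if "1 \<le> i" "i < k" "k \<le> h" for i k
    proof (cases "i = 1")
      case False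
      then have "x i * x k \<asymp> 0" using that by (intro x_prod) auto
      then have "x i * x k \<in> I'" by (simp only: cg_0_iff)
      then show ?thesis using I by blast
    qed (rule 1)
    consider "i < k" | "k < i" | "i = k" by linarith
    then show ?thesis
    proof cases
      case 1
      then show ?thesis using less[of i k] ik by simp
    next
      case 2
      then have "x k * x i \<in> ?J" using less[of k i] ik by simp
      then show ?thesis by (simp only: mult.commute[of "x i" "x k"])
    next
      case 3
      have "k = 1 \<or> k = 2 \<or> 3 \<le> k" using ik by (auto simp del: One_nat_def)
      then consider "k = 1" | "k = 2" | "3 \<le> k" by blast
      then show ?thesis
      proof cases
        case 2
        have "x i * x k = x 2 ^ 2" using 2 3 by (simp add: power2_eq_square)
        also note x_y2
        also have "x 1 ^ (p + 1) * x 2 + z * x 1 ^ n = x 1 * (x 1 ^ p * x 2 + z * x 1 ^ (s - t))"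
          by (simp add: algebra_simps)
        finally show ?thesis by blast
      next
        case k3: 3
        obtain m where m: "s = Suc m" using st t by (cases s) auto
        have "x i * x k = x k ^ 2" using 3 by (simp add: power2_eq_square)
        also have "\<dots> \<asymp> x 1 ^ s" using ik k3 by (intro x_sq) auto
        also have "x 1 ^ s = x 1 * x 1 ^ m" by (simp add: m)
        finally show ?thesis by blast
      qed (use 1 3 in auto)
    qed
  qed
  have "mp (Suc (Suc 0)) \<subseteq> ?J"
  proof (rule mp_least[OF idl I])
    fix a b :: "'k ser" assume "a \<in> ser_max" "b \<in> mp (Suc 0)"
    then have "a * b \<asymp> (\<Sum>i\<in>{1..h}. x i * dser h i a) * (\<Sum>k\<in>{1..h}. x k * dser h k b)"
      by (intro cg_mult max_decomp) (simp_all add: mp_1)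
    also have "\<dots> = (\<Sum>i\<in>{1..h}. \<Sum>k\<in>{1..h}. dser h i a * dser h k b * (x i * x k))"
      by (simp only: sum_product) (simp only: ac_simps)
    finally have "a * b \<asymp> (\<Sum>i\<in>{1..h}. \<Sum>k\<in>{1..h}. dser h i a * dser h k b * (x i * x k))" .
    then show "a * b \<in> ?J"
      by (rule cg_idl[OF idl I]) (intro idl_sum[OF idl] idl_mult[OF idl] xx)
  qed
  then show ?thesis by (simp only: numeral_2_eq_2)
qed

end

context model
begin

lemma mp_even: "mp (2 * k) \<subseteq> {f. \<exists>g. f \<asymp> x 1 ^ k * g}"
proof (induction k)
  case 0
  have "f \<asymp> x 1 ^ 0 * f" for f by simp
  then show ?case by blast
next
  case (Suc k)
  have "mp (2 + 2 * k) \<subseteq> {f. \<exists>g. f \<asymp> x 1 ^ Suc k * g}"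
  proof (rule mp_add_least[OF idl_principal I_idl_principal])
    fix a b assume "a \<in> mp 2" "b \<in> mp (2 * k)"
    then obtain u v where uv: "a \<asymp> x 1 * u" "b \<asymp> x 1 ^ k * v" using mp2_x Suc by blast
    have "a * b \<asymp> x 1 * u * (x 1 ^ k * v)" by (rule cg_mult[OF uv])
    also have "\<dots> = x 1 ^ Suc k * (u * v)" by (simp add: ac_simps)
    finally show "a * b \<in> {f. \<exists>g. f \<asymp> x 1 ^ Suc k * g}" by blast
  qed
  then show ?case by simp
qed

lemma mp_nil: "mp (2 * Suc s) \<subseteq> I'"
proof
  fix f assume "f \<in> mp (2 * Suc s)"
  then obtain g where "f \<asymp> x 1 ^ Suc s * g" using mp_even[of "Suc s"] by blast
  moreover have "x 1 ^ Suc s * g \<in> I'" by (rule I_mult2[OF x_nil])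
  ultimately show "f \<in> I'" using cg_in_I by blast
qed

definition normal_span :: "'k ser set" where
  "normal_span = {f. \<exists>F G l. f \<asymp> pr F G + sz l}"

lemma normal_span_cg: "f \<asymp> g \<Longrightarrow> g \<in> normal_span \<Longrightarrow> f \<in> normal_span"
  unfolding normal_span_def using cg_trans by blast

lemma normal_span_add: "f \<in> normal_span \<Longrightarrow> g \<in> normal_span \<Longrightarrow> f + g \<in> normal_span"
proof -
  assume "f \<in> normal_span" "g \<in> normal_span"
  then obtain F G l F' G' l' where *: "f \<asymp> pr F G + sz l" "g \<asymp> pr F' G' + sz l'" unfolding normal_span_def by blast
  have "f + g \<asymp> (pr F G + sz l) + (pr F' G' + sz l')" by (rule cg_add[OF *])
  also have "\<dots> = (pr F G + pr F' G') + (sz l + sz l')" by simp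
  also have "\<dots> = pr (F + F') (G + G') + sz (\<lambda>k. l k + l' k)" by (simp only: pr_add sz_add)
  finally show ?thesis unfolding normal_span_def by blast
qed

lemma normal_span_pr: "pr F G \<in> normal_span"
proof -
  have "pr F G \<asymp> pr F G + sz (\<lambda>_. 0)" by (simp add: sz_0)
  then show ?thesis unfolding normal_span_def by blast
qed

lemma normal_span_sz: "sz l \<in> normal_span"
proof -
  have "sz l \<asymp> pr 0 0 + sz l" by (simp only: pr_0 add_0_left cg_refl)
  then show ?thesis unfolding normal_span_def by blast
qed

lemma normal_span_const: "ser_const a \<in> normal_span"
  by (rule normal_span_cg[OF _ normal_span_pr[of "fps_const a" 0]]) (simp only: pr_ev cg_sym[OF ev_const])

lemma normal_span_var: "i \<in> {1..h} \<Longrightarrow> f \<in> normal_span \<Longrightarrow> x i * f \<in> normal_span"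
proof -
  assume i: "i \<in> {1..h}" and "f \<in> normal_span"
  then obtain F G l where f: "f \<asymp> pr F G + sz l" unfolding normal_span_def by blast
  have f': "x i * f \<asymp> x i * pr F G + x i * sz l"
    using cg_mult_l[OF f, of "x i"] by (simp only: distrib_left)
  have "i = 1 \<or> i = 2 \<or> i \<in> K" using i by (auto simp del: One_nat_def)
  then consider "i = 1" | "i = 2" | "i \<in> K" by blast
  then have "x i * pr F G \<in> normal_span \<and> x i * sz l \<in> normal_span"
  proof cases
    case 1
    have "x 1 * pr F G \<asymp> pr fps_X 0 * pr F G"
      by (rule cg_mult_r) (simp only: pr_ev cg_sym[OF ev_X])
    also note pr_mult
    finally have "x 1 * pr F G \<in> normal_span" by (rule normal_span_cg[OF _ normal_span_pr])
    moreover have "x 1 * sz l \<in> normal_span"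
      by (rule normal_span_cg[OF _ normal_span_pr[of 0 0]]) (simp only: pr_0 x_sz)
    ultimately show ?thesis unfolding 1 ..
  next
    case 2
    have "x 2 * pr F G \<asymp> pr 0 1 * pr F G"
      by (rule cg_mult_r[OF cg_sym[OF pr_0_1]])
    also note pr_mult
    finally have "x 2 * pr F G \<in> normal_span" by (rule normal_span_cg[OF _ normal_span_pr])
    moreover have "x 2 * sz l \<in> normal_span"
      by (rule normal_span_cg[OF _ normal_span_pr[of 0 0]]) (simp only: pr_0 y_sz)
    ultimately show ?thesis unfolding 2 ..
  next
    case 3
    obtain H where H: "ev F \<asymp> ser_const (F $ 0) + x 1 * ev H" using ev_decomp by blast
    have "x i * pr F G = ev F * x i + ev G * (x 2 * x i)" by (simp only: pr_def algebra_simps)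
    also have "\<dots> \<asymp> (ser_const (F $ 0) + x 1 * ev H) * x i + 0"
      by (intro cg_add cg_mult_r H cg_mult_0(1) X12_K 3)
    also have "\<dots> = ser_const (F $ 0) * x i + ev H * (x 1 * x i)" by (simp add: algebra_simps)
    also have "\<dots> \<asymp> ser_const (F $ 0) * x i + 0" by (intro cg_add cg_refl cg_mult_0(1) X12_K 3)
    also have "\<dots> = sz (\<lambda>k. F $ 0 * (if k = i then 1 else 0))" by (simp only: sz_scale[symmetric] sz_unit[OF 3] add_0_right)
    finally have "x i * pr F G \<in> normal_span" by (rule normal_span_cg[OF _ normal_span_sz])
    moreover have "x i * sz l \<asymp> pr (fps_const (l i) * fps_X ^ s) 0"
    proof -
      have "x i * sz l \<asymp> ser_const (l i) * x 1 ^ s" by (rule X_sz[OF 3])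
      also have "\<dots> \<asymp> ev (fps_const (l i)) * ev (fps_X ^ s)"
        by (intro cg_mult cg_sym[OF ev_const] cg_sym[OF ev_X_power])
      also have "\<dots> \<asymp> ev (fps_const (l i) * fps_X ^ s)" by (rule cg_sym[OF ev_mult])
      finally show ?thesis by (simp only: pr_ev)
    qed
    then have "x i * sz l \<in> normal_span" by (rule normal_span_cg[OF _ normal_span_pr])
    ultimately show ?thesis ..
  qed
  then show ?thesis using normal_span_cg[OF f'] normal_span_add by blast
qed

lemma normal_span_sum: "finite S \<Longrightarrow> (\<And>i. i \<in> S \<Longrightarrow> f i \<in> normal_span) \<Longrightarrow> sum f S \<in> normal_span"
proof (induction S rule: finite_induct)
  case empty
  then show ?case using normal_span_const[of 0] by (simp add: C_0)
qed (simp add: normal_span_add)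

text \<open>Splitting off a constant term and the variables approximates any series modulo arbitrary powers of the maximal
ideal by combinations of \<open>x\<^sub>1\<^sup>i\<close>, \<open>x\<^sub>1\<^sup>i x\<^sub>2\<close> and the remaining variables; a high power of the maximal ideal is zero.\<close>

lemma normal_span_all: "f \<in> normal_span"
proof -
  have "\<exists>w\<in>normal_span. f - w \<in> mp N" for N
  proof (induction N arbitrary: f)
    case 0
    then show ?case using normal_span_const[of 0] by auto
  next
    case (Suc N)
    obtain w where w: "\<And>f. w f \<in> normal_span" "\<And>f. f - w f \<in> mp N" using Suc by metis
    let ?w = "ser_const (cf f 0) + (\<Sum>i\<in>{1..h}. x i * w (dser h i f))"
    have "?w \<in> normal_span" using normal_span_var w(1) by (intro normal_span_add normal_span_const normal_span_sum) auto
    moreover have "f - ?w \<asymp> (ser_const (cf f 0) + (\<Sum>i\<in>{1..h}. x i * dser h i f)) - ?w"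
      by (rule cg_diff[OF ser_decomp cg_refl])
    then have "f - ?w \<asymp> (\<Sum>i\<in>{1..h}. x i * (dser h i f - w (dser h i f)))"
      by (simp add: right_diff_distrib sum_subtractf)
    then have "f - ?w \<in> mp (Suc N)"
      by (rule mp_cg) (intro idl_sum[OF mp_idl] mp_prod w(2), simp add: ser_max_def)
    ultimately show ?case by blast
  qed
  then obtain w where w: "w \<in> normal_span" "f - w \<in> mp (2 * Suc s)" by blast
  then have "f \<asymp> w" using mp_nil by (auto simp: cg_def)
  then show ?thesis using w(1) by (rule normal_span_cg)
qed

end

section \<open>Evaluation of power series at nilpotent elements\<close>

text \<open>As products of more than \<open>s\<close> elements of the maximal ideal vanish, series can be evaluated at elements of it by
summing over the finitely many monomials of degree at most \<open>s\<close>.\<close>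

locale evaluation = local_alg ser_const I ser_max for I :: "'k::field_char_0 ser set" +
  fixes h s :: nat and X :: "nat \<Rightarrow> 'k ser"
  assumes nil: "mp (Suc s) \<subseteq> I" and s: "1 \<le> s" and X_max: "i \<in> {1..h} \<Longrightarrow> X i \<in> ser_max"
begin

definition Mon :: "(nat \<Rightarrow>\<^sub>0 nat) set" where
  "Mon = {m. Poly_Mapping.keys m \<subseteq> {1..h} \<and> tdeg m \<le> s}"

definition mon :: "(nat \<Rightarrow>\<^sub>0 nat) \<Rightarrow> 'k ser" where
  "mon m = (\<Prod>i\<in>{1..h}. X i ^ Poly_Mapping.lookup m i)"

definition evs :: "'k ser \<Rightarrow> 'k ser" where
  "evs f = (\<Sum>m\<in>Mon. ser_const (cf f m) * mon m)"

lemma finite_Mon: "finite Mon"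
proof (rule finite_subset)
  show "Mon \<subseteq> {a. Poly_Mapping.keys a \<subseteq> {1..h} \<and> (\<forall>i. Poly_Mapping.lookup a i \<le> s)}"
  proof
    fix m assume m: "m \<in> Mon"
    have "Poly_Mapping.lookup m i \<le> s" for i
    proof (cases "i \<in> Poly_Mapping.keys m")
      case True
      then have "Poly_Mapping.lookup m i \<le> tdeg m" unfolding tdeg_def by (intro member_le_sum) auto
      then show ?thesis using m by (simp add: Mon_def)
    qed (simp add: in_keys_iff)
    then show "m \<in> {a. Poly_Mapping.keys a \<subseteq> {1..h} \<and> (\<forall>i. Poly_Mapping.lookup a i \<le> s)}"
      using m by (simp add: Mon_def)
  qed
qed (rule finite_exponents_bounded, simp)

lemma mon_add: "mon (a + b) = mon a * mon b"
  by (simp add: mon_def lookup_add power_add prod.distrib)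

lemma mon_0 [simp]: "mon 0 = 1"
  by (simp add: mon_def)

lemma mon_mp: "Poly_Mapping.keys m \<subseteq> {1..h} \<Longrightarrow> mon m \<in> mp (tdeg m)"
proof -
  assume m: "Poly_Mapping.keys m \<subseteq> {1..h}"
  have "(\<Prod>i\<in>S. X i ^ Poly_Mapping.lookup m i) \<in> mp (\<Sum>i\<in>S. Poly_Mapping.lookup m i)" if "S \<subseteq> {1..h}" for S
    using finite_subset[OF that] that
    by (induction S rule: finite_induct) (auto intro!: mp_mult M_power X_max)
  then show ?thesis unfolding mon_def using tdeg_superset[OF _ m] by simp
qed

lemma evs_add: "evs (f + g) = evs f + evs g"
  by (simp add: evs_def C_add distrib_right sum.distrib)

lemma zero_Mon: "0 \<in> Mon"
  by (simp add: Mon_def)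

lemma evs_const: "evs (ser_const c) = ser_const c"
proof -
  have "evs (ser_const c) = (\<Sum>m\<in>Mon. if m = 0 then ser_const c else 0)"
    unfolding evs_def by (rule sum.cong) (auto simp: cf_const C_0)
  then show ?thesis using finite_Mon zero_Mon by (simp add: sum.delta)
qed

lemma evs_0 [simp]: "evs 0 = 0"
  by (simp add: evs_def C_0)

lemma evs_uminus: "evs (- f) = - evs f"
  using evs_add[of f "- f"] by (simp add: eq_neg_iff_add_eq_0 add.commute)

lemma evs_diff: "evs (f - g) = evs f - evs g"
  using evs_add[of f "- g"] by (simp add: evs_uminus)

lemma evs_sum: "evs (sum f A) = (\<Sum>i\<in>A. evs (f i))"
  by (induction A rule: infinite_finite_induct) (simp_all add: evs_add)

lemma evs_var: "i \<in> {1..h} \<Longrightarrow> evs (ser_var i) = X i"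
proof -
  assume i: "i \<in> {1..h}"
  let ?e = "Poly_Mapping.single i (1 :: nat)"
  have keys: "Poly_Mapping.keys ?e = {i}" by simp
  then have "tdeg ?e = 1" unfolding tdeg_def by simp
  then have e: "?e \<in> Mon" using i keys s by (simp add: Mon_def)
  have mon: "mon ?e = X i"
  proof -
    have "mon ?e = (\<Prod>k\<in>{1..h}. if k = i then X i else 1)"
      unfolding mon_def by (rule prod.cong) (auto simp: lookup_single when_def)
    then show ?thesis using i by (simp add: prod.delta)
  qed
  have "evs (ser_var i) = (\<Sum>m\<in>Mon. if m = ?e then mon ?e else 0)"
    unfolding evs_def by (rule sum.cong) (auto simp: cf_var C_0)
  also have "\<dots> = mon ?e" using finite_Mon e by (simp only: sum.delta if_True)
  finally show ?thesis by (simp only: mon)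
qed

lemma evs_cut: "cut h f = 0 \<Longrightarrow> evs f = 0"
proof -
  assume f: "cut h f = 0"
  have "cf f m = 0" if "m \<in> Mon" for m
  proof -
    have "cf (cut h f) m = 0" using f by simp
    then show ?thesis using that by (simp add: cf_cut Mon_def)
  qed
  then show ?thesis by (simp add: evs_def C_0)
qed

text \<open>The products of monomials are sorted by their exponent; those of degree above \<open>s\<close> vanish.\<close>

lemma evs_mult: "evs (f * g) \<asymp> evs f * evs g"
proof -
  define u where "u = (\<lambda>(a, b). (ser_const (cf f a) * mon a) * (ser_const (cf g b) * mon b))"
  define T where "T = {p \<in> Mon \<times> Mon. fst p + snd p \<in> Mon}"
  have uab: "u p = ser_const (cf f (fst p) * cf g (snd p)) * mon (fst p + snd p)" for p
    by (simp add: u_def case_prod_unfold C_mult mon_add ac_simps)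
  have fin: "finite (Mon \<times> Mon)" using finite_Mon by simp
  have TM: "T \<subseteq> Mon \<times> Mon" by (auto simp: T_def)
  have u0: "u p \<asymp> 0" if p: "p \<in> Mon \<times> Mon - T" for p
  proof -
    have "Poly_Mapping.keys (fst p + snd p) \<subseteq> {1..h}" using p by (auto simp: Mon_def keys_add_nat)
    moreover have "\<not> tdeg (fst p + snd p) \<le> s" using p calculation by (auto simp: T_def Mon_def)
    ultimately have "mon (fst p + snd p) \<in> mp (Suc s)"
      using mon_mp mp_antimono[of "Suc s" "tdeg (fst p + snd p)"] by auto
    then show ?thesis unfolding uab using nil I_mult by (auto simp: cg_0_iff)
  qed
  have "evs f * evs g = (\<Sum>p\<in>Mon \<times> Mon. u p)"
    by (simp add: evs_def u_def sum_product sum.cartesian_product)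
  also have "\<dots> = (\<Sum>p\<in>Mon \<times> Mon - T. u p) + (\<Sum>p\<in>T. u p)"
    by (rule sum.subset_diff[OF TM fin])
  also have "\<dots> \<asymp> 0 + (\<Sum>p\<in>T. u p)"
  proof (rule cg_add[OF _ cg_refl])
    have "(\<Sum>p\<in>Mon \<times> Mon - T. u p) \<asymp> (\<Sum>p\<in>Mon \<times> Mon - T. 0)" by (rule cg_sum) (rule u0)
    then show "(\<Sum>p\<in>Mon \<times> Mon - T. u p) \<asymp> 0" by simp
  qed
  also have "0 + (\<Sum>p\<in>T. u p) = (\<Sum>(m, p)\<in>Sigma Mon (\<lambda>m. {(a, b). a + b = m}). u p)"
    unfolding add_0_left
  proof (rule sum.reindex_bij_witness[of _ snd "\<lambda>p. (fst p + snd p, p)"])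
    fix q assume q: "q \<in> Sigma Mon (\<lambda>m. {(a, b). a + b = m})"
    then obtain m p where mp: "q = (m, p)" "m \<in> Mon" "fst p + snd p = m" by (cases q) auto
    have k: "Poly_Mapping.keys (fst p) \<subseteq> {1..h}" "Poly_Mapping.keys (snd p) \<subseteq> {1..h}"
      "tdeg (fst p) \<le> s" "tdeg (snd p) \<le> s"
      using mp(2) unfolding mp(3)[symmetric] by (auto simp: Mon_def keys_add_nat tdeg_add)
    then have "fst p \<in> Mon" "snd p \<in> Mon" by (simp_all add: Mon_def)
    then show "snd q \<in> T" using mp by (cases p) (simp add: T_def)
    show "(fst (snd q) + snd (snd q), snd q) = q" using mp by simp
  qed (auto simp: T_def)
  also have "\<dots> = (\<Sum>m\<in>Mon. \<Sum>p\<in>{(a, b). a + b = m}. u p)"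
    by (rule sum.Sigma[symmetric]) (simp_all add: finite_Mon)
  also have "\<dots> = evs (f * g)"
    unfolding evs_def
  proof (rule sum.cong[OF refl])
    fix m
    have "(\<Sum>p\<in>{(a, b). a + b = m}. u p)
        = (\<Sum>p\<in>{(a, b). a + b = m}. ser_const (case p of (a, b) \<Rightarrow> cf f a * cf g b) * mon m)"
      by (rule sum.cong) (auto simp: uab)
    then show "(\<Sum>p\<in>{(a, b). a + b = m}. u p) = ser_const (cf (f * g) m) * mon m"
      by (simp add: cf_mult C_sum sum_distrib_right)
  qed
  finally show ?thesis by (rule cg_sym)
qed

lemma evs_1: "evs 1 = 1"
  using evs_const[of 1] by simp

lemma evs_power: "evs (f ^ k) \<asymp> evs f ^ k"
proof (induction k)
  case (Suc k)
  then show ?case using cg_trans[OF evs_mult[of f "f ^ k"] cg_mult_l[OF Suc]] by simp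
qed (simp add: evs_1)

text \<open>By induction on the exponent, every element of a power of the maximal ideal is a value of the evaluation up to
an element of the next power.\<close>

lemma evs_surj:
  assumes span: "ser_max \<subseteq> lspan (mp 2) (X ` {1..h})"
  shows "\<exists>g. evs g \<asymp> f"
proof -
  define L where "L = (\<lambda>k. {f. \<exists>g. f - evs g \<in> mp k})"
  have scale: "ser_const c * f \<in> L k" if f: "f \<in> L k" for c f k
  proof -
    obtain g where g: "f - evs g \<in> mp k" using f unfolding L_def by blast
    have "ser_const c * f - ser_const c * evs g = ser_const c * (f - evs g)" by (simp add: algebra_simps)
    moreover have "ser_const c * evs g = evs (ser_const c * g)"
      unfolding evs_def sum_distrib_left cf_const_mult C_mult by (simp only: mult.assoc)
    ultimately have "ser_const c * f - evs (ser_const c * g) \<in> mp k"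
      using idl_mult[OF mp_idl g] by simp
    then show ?thesis unfolding L_def by blast
  qed
  have add: "f + g \<in> L k" if fg: "f \<in> L k" "g \<in> L k" for f g k
  proof -
    obtain u v where uv: "f - evs u \<in> mp k" "g - evs v \<in> mp k" using fg unfolding L_def by blast
    have "f + g - evs (u + v) = (f - evs u) + (g - evs v)" by (simp add: evs_add)
    then have "f + g - evs (u + v) \<in> mp k" using idl_add[OF mp_idl uv] by (simp only:)
    then show ?thesis unfolding L_def by blast
  qed
  have small: "f \<in> L k" if "f \<in> mp k" for f k
  proof -
    have "f - evs 0 \<in> mp k" using that by simp
    then show ?thesis unfolding L_def by blast
  qed
  have lin: "lin (L k)" for k
    unfolding lin_def using add scale small idl_0[OF mp_idl] by blast
  have M: "ser_max \<subseteq> L 2"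
  proof (rule subset_trans[OF span lspan_least[OF lin]])
    show "mp 2 \<subseteq> L 2" using small by blast
    show "X ` {1..h} \<subseteq> L 2"
    proof
      fix a assume "a \<in> X ` {1..h}"
      then obtain i where "i \<in> {1..h}" "a = X i" by blast
      then have "a - evs (ser_var i) \<in> mp 2" using evs_var idl_0[OF mp_idl] by simp
      then show "a \<in> L 2" unfolding L_def by blast
    qed
  qed
  have step: "mp k \<subseteq> L (Suc k)" for k
  proof (induction k)
    case 0
    show ?case
    proof
      fix f :: "'k ser"
      have "f - evs (ser_const (cf f 0)) \<in> mp (Suc 0)"
        unfolding evs_const mp_1 by (simp add: ser_max_def cf_const)
      then show "f \<in> L (Suc 0)" unfolding L_def by blast
    qed
  next
    case (Suc k)
    have "mp (Suc k) \<subseteq> L (Suc (Suc k)) \<inter> mp (Suc k)"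
    proof (rule mp_least)
      show "idl (L (Suc (Suc k)) \<inter> mp (Suc k))"
      proof (rule idlI)
        show "0 \<in> L (Suc (Suc k)) \<inter> mp (Suc k)" using lin_0[OF lin] idl_0[OF mp_idl] by blast
        show "f + g \<in> L (Suc (Suc k)) \<inter> mp (Suc k)"
          if "f \<in> L (Suc (Suc k)) \<inter> mp (Suc k)" "g \<in> L (Suc (Suc k)) \<inter> mp (Suc k)" for f g
          using that add idl_add[OF mp_idl] by blast
        fix f r :: "'k ser" assume f: "f \<in> L (Suc (Suc k)) \<inter> mp (Suc k)"
        obtain c where "r - ser_const c \<in> ser_max" using decomp by blast
        then have "(r - ser_const c) * f \<in> mp (Suc (Suc k))" using f by (intro mp_prod) auto
        then have "(r - ser_const c) * f + ser_const c * f \<in> L (Suc (Suc k))"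
          using f by (intro add[OF small scale]) auto
        then have "r * f \<in> L (Suc (Suc k))" by (simp add: algebra_simps)
        then show "r * f \<in> L (Suc (Suc k)) \<inter> mp (Suc k)" using f idl_mult[OF mp_idl] by blast
      qed
      show "I \<subseteq> L (Suc (Suc k)) \<inter> mp (Suc k)" using I_mp small by blast
      fix a b :: "'k ser" assume a: "a \<in> ser_max" and b: "b \<in> mp k"
      obtain u where u: "a - evs u \<in> mp 2" using a M unfolding L_def by blast
      obtain v where v: "b - evs v \<in> mp (Suc k)" using b Suc unfolding L_def by blast
      have "a - (a - evs u) \<in> ser_max" by (rule idl_diff[OF M_idl a subsetD[OF mp_2_M u]])
      then have "evs u \<in> ser_max" by simp
      then have 1: "evs u * (b - evs v) \<in> mp (Suc (Suc k))" using v by (rule mp_prod)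
      have "(a - evs u) * b \<in> mp (2 + k)" by (rule mp_mult[OF u b])
      then have 2: "(a - evs u) * b \<in> mp (Suc (Suc k))" by simp
      have 3: "evs u * evs v - evs (u * v) \<in> mp (Suc (Suc k))"
        using cg_sym[OF evs_mult] I_mp unfolding cg_def by blast
      have "a * b - evs (u * v) = (a - evs u) * b + evs u * (b - evs v) + (evs u * evs v - evs (u * v))"
        by (simp add: algebra_simps)
      also have "\<dots> \<in> mp (Suc (Suc k))" by (intro idl_add[OF mp_idl] 1 2 3)
      finally show "a * b \<in> L (Suc (Suc k)) \<inter> mp (Suc k)"
        using mp_prod[OF a b] unfolding L_def by blast
    qed
    then show ?case by blast
  qed
  have "f \<in> L k" for k
  proof (induction k)
    case 0
    then show ?case using small[of f 0] by simp
  next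
    case (Suc k)
    then obtain g where "f - evs g \<in> mp k" unfolding L_def by blast
    then obtain g' where "f - evs g - evs g' \<in> mp (Suc k)" using step unfolding L_def by blast
    then have "f - evs (g + g') \<in> mp (Suc k)" by (simp add: evs_add diff_diff_add)
    then show ?case unfolding L_def by blast
  qed
  then obtain g where "f - evs g \<in> mp (Suc s)" unfolding L_def by blast
  then have "f \<asymp> evs g" using nil by (auto simp: cg_def)
  then show ?thesis using cg_sym by blast
qed

end

section \<open>The classification\<close>

locale asg_quot = artin_quot h I
  for h and I :: "'k::{alg_closed_field, field_char_0} mps set" +
  fixes s t :: nat
  assumes asg: "asg ser_const I' ser_max h s t"
begin

sublocale asg ser_const I' ser_max h s t
  by (rule asg)

notation cg (infix "\<asymp>" 50)

abbreviation model_ideal :: "nat \<Rightarrow> 'k \<Rightarrow> 'k \<Rightarrow> nat \<Rightarrow> 'k mps set" where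
  "model_ideal p c d j \<equiv> ideal_Ipz h s t p (rho h (ser_const c + ser_const d * ser_var 1 ^ j))"

lemma model: "c \<noteq> 0 \<Longrightarrow> d = 0 \<or> 1 \<le> j \<Longrightarrow> model h s t p c d j (model_ideal p c d j)"
  by unfold_locales (use h t st in auto)

lemma n_eq: "s - t + 1 = n"
  using st by (simp add: n_def)

text \<open>Evaluation at the coordinates maps the generators of the model ideal to zero. Conversely, a series in its kernel is
modulo the model ideal a combination of the spanning elements, and their images are linearly independent, so all
coefficients vanish.\<close>

lemma isomorphic_of_system:
  assumes sys: "system p c d j X" and c: "c \<noteq> 0" and j: "d = 0 \<or> 1 \<le> j"
  shows "isomorphic_ideals h I (model_ideal p c d j)"
proof -
  interpret J: model h s t p c d j "model_ideal p c d j" by (rule model[OF c j])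
  interpret S: asg_system ser_const I' ser_max h s t p c d j X by unfold_locales (rule sys)
  interpret E: evaluation I' h s X
  proof unfold_locales
    show "1 \<le> s" using st t by simp
  qed (use nil S.X_M in auto)
  have var: "E.evs (J.x i) = X i" if "i \<in> {1..h}" for i by (rule E.evs_var[OF that])
  have v12: "E.evs (J.x 1) = X 1" "E.evs (J.x 2) = X 2" using var h by auto
  have var_power: "E.evs (J.x i ^ k) \<asymp> X i ^ k" if "i \<in> {1..h}" for i k
    using E.evs_power[of "J.x i" k] by (simp only: var[OF that])
  have x_power: "E.evs (J.x 1 ^ k) \<asymp> X 1 ^ k" for k by (rule var_power) (use h in auto)
  have y_power: "E.evs (J.x 2 ^ k) \<asymp> X 2 ^ k" for k by (rule var_power) (use h in auto)
  have mult_y: "E.evs (g * J.x 2) \<asymp> e * X 2" if "E.evs g \<asymp> e" for g e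
    using cg_trans[OF E.evs_mult[of g "J.x 2"] cg_mult_r[OF that]] by (simp only: v12)
  have scale: "E.evs (ser_const a * g) \<asymp> ser_const a * e" if "E.evs g \<asymp> e" for a g e
    using cg_trans[OF E.evs_mult[of "ser_const a" g] cg_mult_l[OF that]] by (simp only: E.evs_const)
  let ?L = "{f. E.evs f \<in> I'}"
  have L: "idl ?L"
  proof (rule idlI)
    fix f g assume f: "f \<in> ?L"
    then have "E.evs g * E.evs f \<in> I'" by (blast intro: I_mult)
    then show "g * f \<in> ?L" using cg_in_I[OF E.evs_mult[of g f]] by blast
    assume "g \<in> ?L"
    then show "f + g \<in> ?L" using f I_add by (simp add: E.evs_add)
  qed (simp add: I_0)
  have gen: "f \<in> ?L" if "E.evs f \<asymp> 0" for f using that by (simp add: cg_0_iff)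
  have evz: "E.evs J.z \<asymp> ser_const c + ser_const d * X 1 ^ j"
  proof -
    have "E.evs J.z = ser_const c + E.evs (ser_const d * J.x 1 ^ j)"
      by (simp only: J.z_def E.evs_add E.evs_const)
    also have "\<dots> \<asymp> ser_const c + ser_const d * X 1 ^ j" by (intro cg_add cg_refl scale x_power)
    finally show ?thesis .
  qed
  have JL: "J.I' \<subseteq> ?L"
  proof (rule J.I'_least[OF L])
    fix f :: "'k ser" assume "cut h f = 0"
    then show "f \<in> ?L" using I_0 by (simp add: E.evs_cut)
  next
    have "J.x i * J.x k \<in> ?L" if "1 \<le> i" "i < k" "k \<le> h" "(i, k) \<noteq> (1, 2)" for i k
    proof -
      have "E.evs (J.x i * J.x k) \<asymp> E.evs (J.x i) * E.evs (J.x k)" by (rule E.evs_mult)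
      also have "E.evs (J.x i) * E.evs (J.x k) = X i * X k" using that by (simp add: var)
      also have "\<dots> \<asymp> 0" by (rule S.X_prod[OF that])
      finally show ?thesis by (rule gen)
    qed
    moreover have "J.x k ^ 2 - J.x 1 ^ s \<in> ?L" if "3 \<le> k" "k \<le> h" for k
    proof -
      have "E.evs (J.x k ^ 2 - J.x 1 ^ s) = E.evs (J.x k ^ 2) - E.evs (J.x 1 ^ s)" by (rule E.evs_diff)
      also have "\<dots> \<asymp> X k ^ 2 - X 1 ^ s" by (intro cg_diff var_power x_power) (use that in auto)
      also have "\<dots> \<asymp> X 1 ^ s - X 1 ^ s" by (intro cg_diff cg_refl S.X_sq that)
      finally show ?thesis by (intro gen) simp
    qed
    moreover have "J.x 2 ^ 2 - J.x 1 ^ (p + 1) * J.x 2 - J.z * J.x 1 ^ (s - t + 1) \<in> ?L"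
    proof -
      have "E.evs (J.x 2 ^ 2 - J.x 1 ^ (p + 1) * J.x 2 - J.z * J.x 1 ^ n)
          = E.evs (J.x 2 ^ 2) - E.evs (J.x 1 ^ (p + 1) * J.x 2) - E.evs (J.z * J.x 1 ^ n)"
        by (simp only: E.evs_diff)
      also have "\<dots> \<asymp> X 2 ^ 2 - X 1 ^ (p + 1) * X 2 - (ser_const c + ser_const d * X 1 ^ j) * X 1 ^ n"
      proof (intro cg_diff y_power)
        show "E.evs (J.x 1 ^ (p + 1) * J.x 2) \<asymp> X 1 ^ (p + 1) * X 2"
          by (rule mult_y[OF x_power])
        show "E.evs (J.z * J.x 1 ^ n) \<asymp> (ser_const c + ser_const d * X 1 ^ j) * X 1 ^ n"
          by (rule cg_trans[OF E.evs_mult cg_mult[OF evz x_power]])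
      qed
      also have "\<dots> \<asymp> (X 1 ^ (p + 1) * X 2 + (ser_const c + ser_const d * X 1 ^ j) * X 1 ^ n)
          - X 1 ^ (p + 1) * X 2 - (ser_const c + ser_const d * X 1 ^ j) * X 1 ^ n"
        by (intro cg_diff cg_refl S.X_y2)
      also have "\<dots> = 0" by simp
      finally show ?thesis unfolding n_eq by (rule gen)
    qed
    moreover have "J.x 1 ^ t * J.x 2 \<in> ?L"
    proof -
      have "E.evs (J.x 1 ^ t * J.x 2) \<asymp> X 1 ^ t * X 2" by (rule mult_y[OF x_power])
      also have "\<dots> \<asymp> 0" by (rule S.xty)
      finally show ?thesis by (rule gen)
    qed
    ultimately show "gens h s t p J.z \<subseteq> ?L" unfolding gens_def by blast
  qed
  have LJ: "f \<in> J.I'" if f: "f \<in> ?L" for f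
  proof -
    have "f \<in> J.normal_span" by (rule J.normal_span_all)
    then obtain F G l where FGl: "J.cg f (J.pr F G + J.sz l)" unfolding J.normal_span_def by blast
    have "f - (J.pr F G + J.sz l) \<in> ?L" using FGl unfolding J.cg_def by (rule subsetD[OF JL])
    then have "f - (f - (J.pr F G + J.sz l)) \<in> ?L" by (rule idl_diff[OF L f])
    then have "E.evs (J.pr F G + J.sz l) \<in> I'" by (simp only: diff_diff_eq2 add_diff_cancel_left' mem_Collect_eq)
    moreover have "E.evs (J.pr F G + J.sz l) \<asymp> S.pr F G + S.sz l"
    proof -
      have ev: "E.evs (J.ev H) \<asymp> S.ev H" for H
        unfolding J.ev_def S.ev_def E.evs_sum by (intro cg_sum scale x_power)
      have "E.evs (J.ev G * J.x 2) \<asymp> S.ev G * X 2" by (rule mult_y[OF ev])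
      moreover have "E.evs (J.sz l) \<asymp> S.sz l"
        unfolding J.sz_def S.sz_def E.evs_sum by (intro cg_sum scale) (simp add: var)
      ultimately show ?thesis
        unfolding J.pr_def S.pr_def E.evs_add by (intro cg_add ev)
    qed
    ultimately have "S.pr F G + S.sz l \<asymp> 0" using cg_in_I unfolding cg_0_iff by blast
    note 0 = S.rep_indep[OF this]
    have "J.sz l = 0" unfolding J.sz_def by (intro sum.neutral ballI) (simp add: 0(3))
    moreover have "J.cg (J.pr F G) (J.pr 0 0)" by (rule J.pr_cong) (simp_all add: 0)
    ultimately have "J.cg (J.pr F G + J.sz l) 0" by (simp only: J.pr_0 add_0_right)
    with FGl have "J.cg f 0" by (rule J.cg_trans)
    then show ?thesis by (simp only: J.cg_0_iff)
  qed
  have quot2: "ser_quot2 h I (model_ideal p c d j)"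
    by (intro ser_quot2.intro ser_quot_axioms J.ser_quot_axioms)
  have "quot_map h I (model_ideal p c d j) E.evs"
    unfolding ser_quot2.quot_map_iff[OF quot2] q_eq_iff
  proof (intro conjI allI)
    show "E.evs f \<in> I' \<longleftrightarrow> f \<in> J.I'" for f using JL LJ by blast
    show "\<exists>g. E.evs g \<asymp> f" for f by (rule E.evs_surj[OF S.X_span])
  qed (simp_all add: E.evs_add E.evs_const E.evs_mult)
  then show ?thesis by (rule ser_quot2.isomorphic_of_quot_map[OF quot2])
qed

text \<open>The images of the variables are coordinates. They lie in the maximal ideal because they are nilpotent.\<close>

lemma system_of_isomorphic:
  assumes iso: "isomorphic_ideals h I (model_ideal p c d j)" and c: "c \<noteq> 0" and j: "d = 0 \<or> 1 \<le> j"
  shows "\<exists>X. system p c d j X"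
proof -
  interpret J: model h s t p c d j "model_ideal p c d j" by (rule model[OF c j])
  have quot2: "ser_quot2 h I (model_ideal p c d j)"
    by (intro ser_quot2.intro ser_quot_axioms J.ser_quot_axioms)
  obtain \<theta> where \<theta>: "quot_map h I (model_ideal p c d j) \<theta>"
    using ser_quot2.quot_map_of_isomorphic[OF quot2 iso] by blast
  have add: "\<theta> (f + g) \<asymp> \<theta> f + \<theta> g" and mult: "\<theta> (f * g) \<asymp> \<theta> f * \<theta> g"
    and const: "\<theta> (ser_const a) \<asymp> ser_const a" and surj: "\<exists>g. \<theta> g \<asymp> f"
    and ker: "\<theta> f \<in> I' \<longleftrightarrow> f \<in> J.I'" for f g a
    using \<theta> unfolding ser_quot2.quot_map_iff[OF quot2] q_eq_iff by blast+
  have cong: "\<theta> f \<asymp> \<theta> g" if "J.cg f g" for f g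
    using ser_quot2.quot_map_eq[OF quot2 \<theta>, of f g] that by (simp only: q_eq_iff J.q_eq_iff)
  have zero: "\<theta> 0 \<asymp> 0" using const[of 0] by simp
  have power: "\<theta> (f ^ k) \<asymp> \<theta> f ^ k" for f k
  proof (induction k)
    case 0
    show ?case using const[of 1] by simp
  next
    case (Suc k)
    then show ?case using cg_trans[OF mult[of f "f ^ k"] cg_mult_l[OF Suc]] by simp
  qed
  have sum: "\<theta> (sum f S) \<asymp> (\<Sum>i\<in>S. \<theta> (f i))" if "finite S" for S :: "nat set" and f
    using that
  proof (induction S rule: finite_induct)
    case (insert i S)
    have "\<theta> (f i + sum f S) \<asymp> \<theta> (f i) + (\<Sum>i\<in>S. \<theta> (f i))"
      by (rule cg_trans[OF add cg_add[OF cg_refl insert.IH]])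
    then show ?case using insert.hyps by simp
  qed (simp add: zero)
  have max: "\<theta> f \<in> ser_max" if f: "f \<in> ser_max" for f
  proof -
    let ?N = "2 * Suc s"
    have "f ^ ?N \<in> J.I'" using J.M_power[OF f, of ?N] J.mp_nil by blast
    then have "\<theta> (f ^ ?N) \<in> I'" by (simp only: ker)
    then have "\<theta> f ^ ?N \<in> I'" using cg_in_I[OF power] by blast
    then have "\<theta> f ^ ?N \<in> ser_max" using I_M by blast
    then have "cf (\<theta> f) 0 ^ ?N = 0" unfolding ser_max_def by (simp only: mem_Collect_eq cf_power_0)
    then show ?thesis by (auto simp: ser_max_def)
  qed
  define X where "X = (\<lambda>i. \<theta> (J.x i))"
  have Xp: "\<theta> (J.x i ^ k) \<asymp> X i ^ k" for i k unfolding X_def by (rule power)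
  have XM: "X i \<in> ser_max" for i unfolding X_def by (rule max) (simp add: ser_max_def)
  have "X i * X k \<asymp> 0" if "1 \<le> i" "i < k" "k \<le> h" "(i, k) \<noteq> (1, 2)" for i k
  proof -
    have "X i * X k \<asymp> \<theta> (J.x i * J.x k)" unfolding X_def by (rule cg_sym[OF mult])
    also have "\<dots> \<asymp> \<theta> 0" by (rule cong[OF J.x_prod[OF that]])
    also note zero
    finally show ?thesis .
  qed
  moreover have "X k ^ 2 \<asymp> X 1 ^ s" if "3 \<le> k" "k \<le> h" for k
  proof -
    have "X k ^ 2 \<asymp> \<theta> (J.x k ^ 2)" by (rule cg_sym[OF Xp])
    also have "\<dots> \<asymp> \<theta> (J.x 1 ^ s)" by (rule cong[OF J.x_sq[OF that]])
    also note Xp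
    finally show ?thesis .
  qed
  moreover have "X 2 ^ 2 \<asymp> X 1 ^ (p + 1) * X 2 + (ser_const c + ser_const d * X 1 ^ j) * X 1 ^ n"
  proof -
    have z: "\<theta> J.z \<asymp> ser_const c + ser_const d * X 1 ^ j"
      unfolding J.z_def by (intro cg_trans[OF add] cg_add const cg_trans[OF mult] cg_mult Xp)
    have "X 2 ^ 2 \<asymp> \<theta> (J.x 2 ^ 2)" by (rule cg_sym[OF Xp])
    also have "\<dots> \<asymp> \<theta> (J.x 1 ^ (p + 1) * J.x 2 + J.z * J.x 1 ^ n)"
      using J.x_y2 unfolding n_eq by (rule cong)
    also have "\<dots> \<asymp> \<theta> (J.x 1 ^ (p + 1) * J.x 2) + \<theta> (J.z * J.x 1 ^ n)" by (rule add)
    also have "\<dots> \<asymp> X 1 ^ (p + 1) * X 2 + (ser_const c + ser_const d * X 1 ^ j) * X 1 ^ n"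
    proof (rule cg_add)
      show "\<theta> (J.x 1 ^ (p + 1) * J.x 2) \<asymp> X 1 ^ (p + 1) * X 2"
        by (rule cg_trans[OF mult cg_mult[OF Xp]]) (simp add: X_def)
      show "\<theta> (J.z * J.x 1 ^ n) \<asymp> (ser_const c + ser_const d * X 1 ^ j) * X 1 ^ n"
        by (rule cg_trans[OF mult cg_mult[OF z Xp]])
    qed
    finally show ?thesis .
  qed
  moreover have "X 1 ^ t * X 2 \<asymp> 0"
  proof -
    have "X 1 ^ t * X 2 \<asymp> \<theta> (J.x 1 ^ t) * \<theta> (J.x 2)" unfolding X_def by (rule cg_mult_r[OF cg_sym[OF power]])
    also have "\<dots> \<asymp> \<theta> (J.x 1 ^ t * J.x 2)" by (rule cg_sym[OF mult])
    also have "\<dots> \<asymp> \<theta> 0" by (rule cong[OF J.x_xty])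
    also note zero
    finally show ?thesis .
  qed
  moreover have "ser_max \<subseteq> lspan (mp 2) (X ` {1..h})"
  proof
    let ?L = "lspan (mp 2) (X ` {1..h})"
    fix f :: "'k ser" assume f: "f \<in> ser_max"
    obtain g where g: "\<theta> g \<asymp> f" using surj by blast
    have gM: "g \<in> ser_max"
    proof -
      let ?a = "cf g 0"
      have "\<theta> ((g - ser_const ?a) + ser_const ?a) \<asymp> \<theta> (g - ser_const ?a) + ser_const ?a"
        by (rule cg_trans[OF add cg_add[OF cg_refl const]])
      then have "\<theta> (g - ser_const ?a) + ser_const ?a \<asymp> f"
        using cg_trans[OF cg_sym g] by simp
      then have "\<theta> (g - ser_const ?a) + ser_const ?a \<in> ser_max" by (rule cg_idl[OF M_idl I_M _ f])
      moreover have "\<theta> (g - ser_const ?a) \<in> ser_max" by (rule max) (simp add: ser_max_def cf_const)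
      ultimately have "\<theta> (g - ser_const ?a) + ser_const ?a - \<theta> (g - ser_const ?a) \<in> ser_max"
        by (rule idl_diff[OF M_idl])
      then have "ser_const ?a \<in> (ser_max :: 'k ser set)" by simp
      then show ?thesis by (simp add: ser_max_def cf_const)
    qed
    have "f \<asymp> \<theta> g" by (rule cg_sym[OF g])
    also have "\<dots> \<asymp> \<theta> (\<Sum>i\<in>{1..h}. J.x i * dser h i g)" by (rule cong[OF J.max_decomp[OF gM]])
    also have "\<dots> \<asymp> (\<Sum>i\<in>{1..h}. \<theta> (J.x i * dser h i g))" by (rule sum) simp
    also have "\<dots> \<asymp> (\<Sum>i\<in>{1..h}. X i * \<theta> (dser h i g))" unfolding X_def by (intro cg_sum mult)
    finally have "f \<asymp> (\<Sum>i\<in>{1..h}. X i * \<theta> (dser h i g))" .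
    then have "f - (\<Sum>i\<in>{1..h}. X i * \<theta> (dser h i g)) \<in> I'" by (simp only: cg_def)
    then have rest: "f - (\<Sum>i\<in>{1..h}. X i * \<theta> (dser h i g)) \<in> ?L"
      by (rule subsetD[OF lspan_superset(1) subsetD[OF I_mp]])
    have summand: "X i * \<theta> (dser h i g) \<in> ?L" if "i \<in> {1..h}" for i
    proof -
      obtain a where a: "\<theta> (dser h i g) - ser_const a \<in> ser_max" using decomp by blast
      have "X i * (\<theta> (dser h i g) - ser_const a) \<in> ?L"
        using M_mult[OF XM a] lspan_superset(1) by blast
      moreover have "ser_const a * X i \<in> ?L"
        using that lspan_superset(2) by (intro lin_scale[OF lspan_lin]) blast
      ultimately have "X i * (\<theta> (dser h i g) - ser_const a) + ser_const a * X i \<in> ?L"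
        by (rule lin_add[OF lspan_lin])
      then show ?thesis by (simp add: algebra_simps)
    qed
    have "(\<Sum>i\<in>S. X i * \<theta> (dser h i g)) \<in> ?L" if "finite S" "S \<subseteq> {1..h}" for S
      using that
    proof (induction S rule: finite_induct)
      case empty
      show ?case using lin_0[OF lspan_lin] by simp
    next
      case (insert i S)
      then show ?case using lin_add[OF lspan_lin summand[of i]] by simp
    qed
    then have "(\<Sum>i\<in>{1..h}. X i * \<theta> (dser h i g)) \<in> ?L" by blast
    with rest have "f - (\<Sum>i\<in>{1..h}. X i * \<theta> (dser h i g)) + (\<Sum>i\<in>{1..h}. X i * \<theta> (dser h i g)) \<in> ?L"
      by (rule lin_add[OF lspan_lin])
    then show "f \<in> ?L" by (simp only: diff_add_cancel)
  qed
  ultimately have "system p c d j X" unfolding system_def using XM by blast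
  then show ?thesis by blast
qed

lemma unique_normal_form:
  assumes "\<And>p z. (p, z) \<in> L \<longleftrightarrow>
    (\<exists>c d j. normal_label n t p c d j \<and> z = rho h (ser_const c + ser_const d * ser_var 1 ^ j))"
  shows "\<exists>!(p, z). (p, z) \<in> L \<and> isomorphic_ideals h I (ideal_Ipz h s t p z)"
proof -
  have lab: "c \<noteq> 0" "d = 0 \<or> 1 \<le> j" if "normal_label n t p c d j" for p j and c d :: 'k
    using that unfolding normal_label_def by (auto split: if_splits)
  obtain p c d j X where l: "normal_label n t p c d j" and sys: "system p c d j X" using system_exists by blast
  define z where "z = rho h (ser_const c + ser_const d * ser_var 1 ^ j)"
  have exists: "(p, z) \<in> L \<and> isomorphic_ideals h I (ideal_Ipz h s t p z)"
  proof
    show "(p, z) \<in> L" unfolding assms z_def using l by blast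
    show "isomorphic_ideals h I (ideal_Ipz h s t p z)"
      unfolding z_def by (rule isomorphic_of_system[OF sys lab[OF l]])
  qed
  have unique: "p' = p \<and> z' = z"
    if mem: "(p', z') \<in> L" and iso: "isomorphic_ideals h I (ideal_Ipz h s t p' z')" for p' z'
  proof -
    obtain c' d' j' where l': "normal_label n t p' c' d' j'"
      and z': "z' = rho h (ser_const c' + ser_const d' * ser_var 1 ^ j')"
      using mem unfolding assms by blast
    obtain X' where "system p' c' d' j' X'"
      using system_of_isomorphic[OF iso[unfolded z'] lab[OF l']] by blast
    then have eq: "p' = p" "c' = c" "d' = d" "d' \<noteq> 0 \<longrightarrow> j' = j"
      using normal_label_unique[OF _ l' sys l] by blast+
    have "ser_const d' * ser_var 1 ^ j' = (ser_const d * ser_var 1 ^ j :: 'k ser)"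
    proof (cases "d = 0")
      case True
      then show ?thesis using eq(3) by (simp only: C_0 mult_zero_left)
    next
      case False
      then show ?thesis using eq by simp
    qed
    then show ?thesis using eq unfolding z_def z' by simp
  qed
  show ?thesis
  proof (rule ex1I[of _ "(p, z)"])
    show "case (p, z) of (p, z) \<Rightarrow> (p, z) \<in> L \<and> isomorphic_ideals h I (ideal_Ipz h s t p z)"
      using exists by (simp only: prod.case)
    fix q assume q: "case q of (p, z) \<Rightarrow> (p, z) \<in> L \<and> isomorphic_ideals h I (ideal_Ipz h s t p z)"
    obtain p' z' where q': "q = (p', z')" by (cases q)
    have "(p', z') \<in> L" "isomorphic_ideals h I (ideal_Ipz h s t p' z')"
      using q unfolding q' by (simp_all only: prod.case)
    from unique[OF this] show "q = (p, z)" unfolding q' by simp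
  qed
qed

end

text \<open>The powers of the maximal ideal are stable from \<open>s + 1\<close> on, hence zero.\<close>

lemma asg_quot_of_type:
  fixes I :: "'k::{alg_closed_field, field_char_0} mps set"
  assumes h: "h \<ge> 2" and t: "t + 1 \<ge> 3" and st: "s \<ge> 2 * t" and I: "ideal I (mps_ring h)"
    and type: "almost_stretched_gorenstein_of_type h s t (mps_ring h Quot I) (quot_const h I)"
  shows "asg_quot h I s t"
proof -
  have gor: "gorenstein (mps_ring h Quot I) (quot_const h I)"
    and H: "hilbert_function (mps_ring h Quot I) (quot_const h I) 1 h"
      "\<And>j. 2 \<le> j \<and> j \<le> t \<Longrightarrow> hilbert_function (mps_ring h Quot I) (quot_const h I) j 2"
      "\<And>j. t + 1 \<le> j \<and> j \<le> s \<Longrightarrow> hilbert_function (mps_ring h Quot I) (quot_const h I) j 1"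
      "\<And>j. s < j \<Longrightarrow> hilbert_function (mps_ring h Quot I) (quot_const h I) j 0"
    using type unfolding almost_stretched_gorenstein_of_type_def by blast+
  have art: "artinian_local_ring (mps_ring h Quot I)" using gor unfolding gorenstein_def by blast
  interpret artin_quot h I
    by (intro artin_quot.intro ser_quot.intro artin_quot_axioms.intro I art)
  have decrease: "mp j = mp (Suc j)" if "s < j" for j
  proof
    have dim: "qdim (mp j) (mp (Suc j)) 0" by (rule hilbert_qdim[OF H(4)[OF that]])
    show "mp j \<subseteq> mp (Suc j)"
    proof (rule qdim_extend[OF dim, of "[]"])
      fix vs assume len: "length vs + length ([] :: 'k ser list) = 0"
        and sub: "mp j \<subseteq> lspan (mp (Suc j)) (set vs \<union> set [])"
      have "vs = []" using len by simp
      then show ?thesis using sub lspan_empty[OF mp_lin, of "Suc j"] by simp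
    qed simp_all
  qed (rule mp_Suc_subset)
  have stable: "mp j = mp (Suc s)" if "Suc s \<le> j" for j
    using that
  proof (induction j rule: dec_induct)
    case (step i)
    then have "s < i" by simp
    from \<open>mp i = mp (Suc s)\<close> show ?case unfolding decrease[OF \<open>s < i\<close>] .
  qed (rule refl)
  have "asg ser_const I' ser_max h s t"
  proof unfold_locales
    show "mp (Suc s) \<subseteq> I'" by (rule nilpotent[OF _ stable]) simp_all
    show "qdim (mp 1) (mp 2) h"
      using hilbert_qdim[OF H(1)] by (simp only: numeral_2_eq_2 One_nat_def)
    show "qdim (mp j) (mp (Suc j)) 2" if "2 \<le> j" "j \<le> t" for j by (rule hilbert_qdim[OF H(2)]) (use that in simp)
    show "qdim (mp j) (mp (Suc j)) 1" if "t + 1 \<le> j" "j \<le> s" for j by (rule hilbert_qdim[OF H(3)]) (use that in simp)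
    show "qdim {f. \<forall>g\<in>ser_max. g * f \<in> I'} I' 1" by (rule gorenstein_qdim[OF gor])
    show "2 \<le> h" by (rule h)
    show "2 \<le> t" using t by linarith
    show "2 * t \<le> s" by (rule st)
  qed
  then show ?thesis by (intro asg_quot.intro asg_quot_axioms.intro artin_quot_axioms)
qed

lemma regular_list_iff:
  assumes "t + 1 \<le> s" "2 \<le> t" "regular_couple s t"
  shows "(p, z) \<in> (regular_list h t :: (nat \<times> 'k::field_char_0 mps) set) \<longleftrightarrow>
    (\<exists>c d j. normal_label (Suc s - t) t p c d j \<and> z = rho h (ser_const c + ser_const d * ser_var 1 ^ j))"
proof -
  interpret R: type_hom "mps_ring h" "rho h :: 'k ser \<Rightarrow> 'k mps" by (rule rho_hom)
  have "\<not> (p + 2 \<le> t \<and> Suc s - t = 2 * Suc p)"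
  proof
    assume "p + 2 \<le> t \<and> Suc s - t = 2 * Suc p"
    then have "p \<le> t - 2 \<and> 2 * (p + 1) = s - t + 1" using assms(1) by auto
    then show False using assms(3) unfolding regular_couple_def by blast
  qed
  then have l: "normal_label (Suc s - t) t p c d j \<longleftrightarrow> p < t \<and> c = 1 \<and> d = 0" for c d :: 'k and j
    by (simp only: normal_label_def if_False)
  have one: "rho h (ser_const 1 + ser_const 0 * ser_var 1 ^ j :: 'k ser) = \<one>\<^bsub>mps_ring h\<^esub>" for j
  proof -
    have "ser_const 0 = (0 :: 'k ser)" by (rule ser_eqI) (simp add: cf_const)
    then show ?thesis by (simp add: R.hom_one)
  qed
  have "p < t \<longleftrightarrow> p \<le> t - 1" using assms(2) by auto
  then show ?thesis unfolding l regular_list_def using one by auto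
qed

lemma nonregular_list_iff:
  assumes "t + 1 \<le> s" "2 \<le> t" "2 \<le> h" "r \<le> t - 2" "2 * (r + 1) = s - t + 1"
  shows "(p, z) \<in> (nonregular_list h t r :: (nat \<times> 'k::field_char_0 mps) set) \<longleftrightarrow>
    (\<exists>c d j. normal_label (Suc s - t) t p c d j \<and> z = rho h (ser_const c + ser_const d * ser_var 1 ^ j))"
proof -
  interpret R: type_hom "mps_ring h" "rho h :: 'k ser \<Rightarrow> 'k mps" by (rule rho_hom)
  have cond: "p + 2 \<le> t \<and> Suc s - t = 2 * Suc p \<longleftrightarrow> p = r" using assms by auto
  have C0: "ser_const 0 = (0 :: 'k ser)" by (rule ser_eqI) (simp add: cf_const)
  have z0: "rho h (ser_const c + ser_const 0 * ser_var 1 ^ j :: 'k ser) = mps_const c" for c j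
    by (simp only: C0 mult_zero_left add_0_right rho_const)
  have z1: "rho h (ser_const c + ser_const 1 * ser_var 1 ^ j :: 'k ser)
      = mps_const c \<oplus>\<^bsub>mps_ring h\<^esub> mps_var 1 [^]\<^bsub>mps_ring h\<^esub> j" for c j
  proof -
    have "rho h (ser_var 1 :: 'k ser) = mps_var 1" by (rule rho_var) (use assms in auto)
    then show ?thesis by (simp only: ser_const_1 mult_1_left R.hom_add R.hom_power rho_const)
  qed
  have one: "mps_const 1 = (\<one>\<^bsub>mps_ring h\<^esub> :: 'k mps)"
    by (simp only: rho_const[of h, symmetric] ser_const_1 R.hom_one)
  show ?thesis
  proof (cases "p = r")
    case True
    then have l: "normal_label (Suc s - t) t p c d j \<longleftrightarrow>
        c \<noteq> 0 \<and> (d = 0 \<or> d = 1 \<and> 1 \<le> j \<and> j + r + 2 \<le> t)" for c d :: 'k and j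
      using cond assms by (auto simp: normal_label_def)
    have "(p, z) \<in> nonregular_list h t r \<longleftrightarrow> (\<exists>c. c \<noteq> 0 \<and> z = mps_const c) \<or>
        (\<exists>c j. c \<noteq> 0 \<and> 1 \<le> j \<and> j + r + 2 \<le> t \<and> z = mps_const c \<oplus>\<^bsub>mps_ring h\<^esub> mps_var 1 [^]\<^bsub>mps_ring h\<^esub> j)"
      unfolding nonregular_list_def using True by auto
    also have "\<dots> \<longleftrightarrow> (\<exists>c j. c \<noteq> 0 \<and> z = rho h (ser_const c + ser_const 0 * ser_var 1 ^ j)) \<or>
        (\<exists>c j. c \<noteq> 0 \<and> 1 \<le> j \<and> j + r + 2 \<le> t \<and> z = rho h (ser_const c + ser_const 1 * ser_var 1 ^ j))"
      unfolding z0 z1 by blast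
    finally show ?thesis unfolding l by blast
  next
    case False
    then have l: "normal_label (Suc s - t) t p c d j \<longleftrightarrow> p < t \<and> c = 1 \<and> d = 0" for c d :: 'k and j
      by (simp only: normal_label_def cond if_False)
    have "(p, z) \<in> nonregular_list h t r \<longleftrightarrow> p < t \<and> z = \<one>\<^bsub>mps_ring h\<^esub>"
      unfolding nonregular_list_def using False assms by auto
    then show ?thesis unfolding l one[symmetric] using z0 by auto
  qed
qed

theorem theorem4p3:
  fixes h s t :: nat
    and I :: "'k::{alg_closed_field, field_char_0} mps set"
  assumes "h \<ge> 2" and "s \<ge> t + 1" and "t + 1 \<ge> 3"
    and "ideal I (mps_ring h)"
    and "almost_stretched_gorenstein_of_type h s t (mps_ring h Quot I) (quot_const h I)"
    and "s \<ge> 2 * t"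
  shows "(regular_couple s t \<longrightarrow>
            (\<exists>!(p, z). (p, z) \<in> regular_list h t \<and>
               isomorphic_ideals h I (ideal_Ipz h s t p z))) \<and>
         (\<forall>r. r \<le> t - 2 \<and> 2 * (r + 1) = s - t + 1 \<longrightarrow>
            (\<exists>!(p, z). (p, z) \<in> nonregular_list h t r \<and>
               isomorphic_ideals h I (ideal_Ipz h s t p z)))"
proof -
  interpret asg_quot h I s t by (rule asg_quot_of_type[OF assms(1,3,6,4,5)])
  show ?thesis
  proof (intro conjI allI impI)
    assume "regular_couple s t"
    then show "\<exists>!(p, z). (p, z) \<in> regular_list h t \<and> isomorphic_ideals h I (ideal_Ipz h s t p z)"
      by (intro unique_normal_form, unfold n_def, intro regular_list_iff) (use assms t in auto)
  next
    fix r assume "r \<le> t - 2 \<and> 2 * (r + 1) = s - t + 1"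
    then show "\<exists>!(p, z). (p, z) \<in> nonregular_list h t r \<and> isomorphic_ideals h I (ideal_Ipz h s t p z)"
      by (intro unique_normal_form, unfold n_def, intro nonregular_list_iff) (use assms t in auto)
  qed
qed

end
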